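(* Let $S$ be a regular $F$-finite ring of prime characteristic $p$, let $I\subseteq J$ be ideals of $S$, and let $R=S/I$. Then $$C_R(J/I)=\left(\bigcap_{e>0} J^{[p^e]}:_S\left(I^{[p^e]}:_S I\right)\right)\Big/ I .$$
   Context: All rings are commutative, Noetherian, unital, of prime characteristic $p$. $F_*^eR$ denotes $R$ viewed as an $R$-module via the $e$-th iterate of Frobenius: $r\,F_*^es=F_*^e(r^{p^e}s)$. A ring is $F$-finite if $F_*R$ is a finitely generated $R$-module. For an ideal $K$, $K^{[p^e]}$ is the ideal generated by the $p^e$-th powers of elements of $K$, and $K:_SL=\{s\in S: sL\subseteq K\}$. The Cartier core of an ideal $\mathfrak b$ of $R$ (with respect to the full Cartier algebra $\bigoplus_{e\ge0}\operatorname{Hom}_R(F_*^eR,R)$) is $C_R(\mathfrak b)=\{r\in R:\phi(F_*^er)\in\mathfrak b\text{ for all }e>0\text{ and all }\phi\in\operatorname{Hom}_R(F_*^eR,R)\}$. *)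

theory Defs
  imports
    "HOL-Algebra.QuotRing"
    "HOL-Algebra.Ring_Divisibility"
    "HOL-Algebra.Module"
    "HOL-Library.Extended_Nat"
    "HOL-Computational_Algebra.Primes"
begin

section \<open>Localization\<close>

definition frac_rel :: "('a, 'm) ring_scheme \<Rightarrow> 'a set \<Rightarrow> (('a \<times> 'a) \<times> ('a \<times> 'a)) set"
  where "frac_rel R T =
    {((a, s), (b, t)). a \<in> carrier R \<and> s \<in> T \<and> b \<in> carrier R \<and> t \<in> T \<and>
      (\<exists>u\<in>T. u \<otimes>\<^bsub>R\<^esub> (a \<otimes>\<^bsub>R\<^esub> t) = u \<otimes>\<^bsub>R\<^esub> (b \<otimes>\<^bsub>R\<^esub> s))}"

definition fraction :: "('a, 'm) ring_scheme \<Rightarrow> 'a set \<Rightarrow> 'a \<Rightarrow> 'a \<Rightarrow> ('a \<times> 'a) set"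
  where "fraction R T a s = frac_rel R T `` {(a, s)}"

text \<open>The unions below range over all representatives of the two fractions; for a
  multiplicatively closed \<open>T\<close> every representative contributes the same class.\<close>

definition localization :: "('a, 'm) ring_scheme \<Rightarrow> 'a set \<Rightarrow> ('a \<times> 'a) set ring"
  where "localization R T =
    \<lparr>carrier = (carrier R \<times> T) // frac_rel R T,
     mult = (\<lambda>X Y. \<Union>(a, s)\<in>X. \<Union>(b, t)\<in>Y. fraction R T (a \<otimes>\<^bsub>R\<^esub> b) (s \<otimes>\<^bsub>R\<^esub> t)),
     one = fraction R T \<one>\<^bsub>R\<^esub> \<one>\<^bsub>R\<^esub>,
     zero = fraction R T \<zero>\<^bsub>R\<^esub> \<one>\<^bsub>R\<^esub>,
     add = (\<lambda>X Y. \<Union>(a, s)\<in>X. \<Union>(b, t)\<in>Y.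
       fraction R T ((a \<otimes>\<^bsub>R\<^esub> t) \<oplus>\<^bsub>R\<^esub> (b \<otimes>\<^bsub>R\<^esub> s)) (s \<otimes>\<^bsub>R\<^esub> t))\<rparr>"

definition localization_at :: "('a, 'm) ring_scheme \<Rightarrow> 'a set \<Rightarrow> ('a \<times> 'a) set ring"
  where "localization_at R P = localization R (carrier R - P)"


section \<open>Regular rings\<close>

text \<open>Only meaningful for nonzero rings: the zero ring has no primes, so the supremum is \<open>0\<close>.\<close>

definition krull_dim :: "('a, 'm) ring_scheme \<Rightarrow> enat"
  where "krull_dim R =
    Sup {enat n |n. \<exists>P :: nat \<Rightarrow> 'a set.
      (\<forall>i\<le>n. primeideal (P i) R) \<and> (\<forall>i<n. P i \<subset> P (Suc i))}"

text \<open>Only meaningful for finitely generated ideals.\<close>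

definition min_gens :: "('a, 'm) ring_scheme \<Rightarrow> 'a set \<Rightarrow> nat"
  where "min_gens R K =
    (LEAST n. \<exists>X. X \<subseteq> carrier R \<and> finite X \<and> card X = n \<and> Idl\<^bsub>R\<^esub> X = K)"

definition regular_local_ring :: "('a, 'm) ring_scheme \<Rightarrow> bool"
  where "regular_local_ring R \<longleftrightarrow> cring R \<and> noetherian_ring R \<and>
    (\<exists>M. (\<forall>N. maximalideal N R \<longleftrightarrow> N = M) \<and> enat (min_gens R M) = krull_dim R)"

definition regular_ring :: "('a, 'm) ring_scheme \<Rightarrow> bool"
  where "regular_ring R \<longleftrightarrow> cring R \<and> noetherian_ring R \<and>
    (\<forall>P. primeideal P R \<longrightarrow> regular_local_ring (localization_at R P))"


section \<open>Modules and Frobenius\<close>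

definition has_char :: "('a, 'm) ring_scheme \<Rightarrow> nat \<Rightarrow> bool"
  where "has_char R p \<longleftrightarrow> (\<forall>n::nat. add_pow R n \<one>\<^bsub>R\<^esub> = \<zero>\<^bsub>R\<^esub> \<longleftrightarrow> p dvd n)"

definition ring_module :: "('a, 'm) ring_scheme \<Rightarrow> ('a, 'a) module"
  where "ring_module R =
    \<lparr>carrier = carrier R, mult = mult R, one = one R, zero = zero R, add = add R,
     smult = mult R\<rparr>"

text \<open>The module \<open>F\<^sub>*\<^sup>e R\<close>; the element \<open>F\<^sub>*\<^sup>e x\<close> is represented by \<open>x\<close> itself.\<close>

definition frob_pushforward :: "('a, 'm) ring_scheme \<Rightarrow> nat \<Rightarrow> nat \<Rightarrow> ('a, 'a) module"
  where "frob_pushforward R p e =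
    \<lparr>carrier = carrier R, mult = mult R, one = one R, zero = zero R, add = add R,
     smult = (\<lambda>r x. (r [^]\<^bsub>R\<^esub> (p ^ e)) \<otimes>\<^bsub>R\<^esub> x)\<rparr>"

definition mod_hom ::
    "('a, 'm) ring_scheme \<Rightarrow> ('a, 'b, 'k) module_scheme \<Rightarrow> ('a, 'c, 'l) module_scheme \<Rightarrow> ('b \<Rightarrow> 'c) set"
  where "mod_hom R M N = {\<phi>. \<phi> \<in> carrier M \<rightarrow> carrier N \<and>
    (\<forall>x\<in>carrier M. \<forall>y\<in>carrier M. \<phi> (x \<oplus>\<^bsub>M\<^esub> y) = \<phi> x \<oplus>\<^bsub>N\<^esub> \<phi> y) \<and>
    (\<forall>r\<in>carrier R. \<forall>x\<in>carrier M. \<phi> (r \<odot>\<^bsub>M\<^esub> x) = r \<odot>\<^bsub>N\<^esub> \<phi> x)}"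

definition fin_gen_module :: "('a, 'm) ring_scheme \<Rightarrow> ('a, 'b, 'k) module_scheme \<Rightarrow> bool"
  where "fin_gen_module R M \<longleftrightarrow> (\<exists>X. finite X \<and> X \<subseteq> carrier M \<and>
    (\<forall>m\<in>carrier M. \<exists>c\<in>X \<rightarrow> carrier R. m = (\<Oplus>\<^bsub>M\<^esub>x\<in>X. c x \<odot>\<^bsub>M\<^esub> x)))"

definition F_finite :: "('a, 'm) ring_scheme \<Rightarrow> nat \<Rightarrow> bool"
  where "F_finite R p \<longleftrightarrow> fin_gen_module R (frob_pushforward R p 1)"

definition cartier_core :: "('a, 'm) ring_scheme \<Rightarrow> nat \<Rightarrow> 'a set \<Rightarrow> 'a set"
  where "cartier_core R p B = {r \<in> carrier R.
    \<forall>e>0. \<forall>\<phi>\<in>mod_hom R (frob_pushforward R p e) (ring_module R). \<phi> r \<in> B}"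


section \<open>Operations on ideals\<close>

definition frob_power :: "('a, 'm) ring_scheme \<Rightarrow> 'a set \<Rightarrow> nat \<Rightarrow> 'a set"
  where "frob_power R K q = Idl\<^bsub>R\<^esub> ((\<lambda>x. x [^]\<^bsub>R\<^esub> q) ` K)"

definition colon :: "('a, 'm) ring_scheme \<Rightarrow> 'a set \<Rightarrow> 'a set \<Rightarrow> 'a set"
  where "colon R K L = {s \<in> carrier R. \<forall>x\<in>L. s \<otimes>\<^bsub>R\<^esub> x \<in> K}"

definition quot_image :: "('a, 'm) ring_scheme \<Rightarrow> 'a set \<Rightarrow> 'a set \<Rightarrow> 'a set set"
  where "quot_image R K I = (\<lambda>x. I +>\<^bsub>R\<^esub> x) ` K"

end

theory Submission
  imports Defs
begin

text \<open>
  Write \<open>q = p ^ e\<close> and think of a map \<open>\<phi>\<close> with \<open>\<phi> (r ^ q * x) = r * \<phi> x\<close> as an \<open>S\<close>-linear map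
  \<open>F\<^sub>*\<^sup>e S \<rightarrow> S\<close>. Regularity enters only through one statement: locally at every maximal ideal \<open>M\<close> there
  are a single such map \<open>\<Psi>\<close>, finitely many pairs \<open>(b\<^sub>i, b'\<^sub>i)\<close> and some \<open>c \<notin> M\<close> with
  \<open>c * x = \<Sum> \<Psi> (b'\<^sub>i * x) ^ q * b\<^sub>i\<close> for all \<open>x\<close>. This says at once that \<open>F\<^sub>*\<^sup>e S\<close> is locally projective
  (the functionals \<open>\<Psi> (b'\<^sub>i * _)\<close> form a dual basis) and that \<open>\<Psi>\<close> locally generates
  \<open>Hom (F\<^sub>*\<^sup>e S, S)\<close> over \<open>F\<^sub>*\<^sup>e S\<close>.

  Granting it, the theorem is a short computation in the style of Fedder's criterion. Up to powers
  of \<open>c\<close>, a map \<open>\<phi>\<close> on \<open>R = S / I\<close> is induced by \<open>\<Psi> (s * _)\<close>, where \<open>s = \<Sum> b'\<^sub>i * u\<^sub>i ^ q\<close> and \<open>u\<^sub>i\<close> lifts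
  \<open>\<phi> (b\<^sub>i)\<close>. That \<open>\<phi>\<close> is well defined means \<open>\<Psi> (s * I) \<subseteq> I\<close>, and expanding \<open>c * s * x\<close> for \<open>x \<in> I\<close> in the
  dual basis gives \<open>c * s \<in> I\<^bsup>[q]\<^esup> : I\<close>. Hence \<open>r\<close> in the colon ideal forces \<open>\<phi> r \<in> J\<close>
  (\<open>quasi_cartier_maps_into\<close>). Conversely each \<open>s \<in> I\<^bsup>[q]\<^esup> : I\<close> gives maps \<open>\<Psi> (b'\<^sub>i * s * _)\<close> preserving
  \<open>I\<close>; if all of them send \<open>r\<close> into \<open>J\<close>, then the expansion of \<open>c * s * r\<close> lies in \<open>J\<^bsup>[q]\<^esup>\<close>
  (\<open>in_colon_of_cartier_maps\<close>). The factor \<open>c\<close> is harmless because an ideal not contained in any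
  maximal ideal is the whole ring.

  The dual basis comes from Kunz's theorem together with the fact that \<open>S / \<mm>\<^bsup>[q]\<^esup>\<close> has a simple socle
  when \<open>S\<close> is regular local with maximal ideal \<open>\<mm>\<close>. Both are proved by one induction that adjoins the
  generators of \<open>\<mm>\<close> one after the other (\<open>regular_frob_basis\<close>); everything is phrased modulo an ideal
  \<open>A\<close> of a fixed ring, so that no quotient ring changes the type. If \<open>F\<^sub>*\<^sup>e\<close> of the ring modulo
  \<open>A + (x)\<close> is free on \<open>b\<^sub>1, \<dots>, b\<^sub>n\<close>, then modulo the prime \<open>A\<close> it is free on the products \<open>x ^ i * b\<^sub>j\<close> with
  \<open>i < q\<close>; and if \<open>u\<close> generates the socle modulo \<open>A + (x) + \<mm>\<^bsup>[q]\<^esup>\<close>, then \<open>x ^ (q - 1) * u\<close> does so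
  modulo \<open>A + \<mm>\<^bsup>[q]\<^esup>\<close>. That the ideals which occur are prime rests on Krull's principal ideal theorem
  (\<open>prime_between\<close>), used to move a chain of primes so that its second member contains a given
  generator (\<open>prime_chain_through\<close>). Finally the coordinate \<open>\<Psi>\<close> of the socle generator defines a
  nondegenerate form \<open>(x, y) \<mapsto> \<Psi> (x * y)\<close>, and a Gram--Schmidt process produces the dual basis
  (\<open>gram_schmidt\<close>). Clearing denominators carries it from the local rings back to \<open>S\<close>
  (\<open>dual_basis_descends\<close>).
\<close>

section \<open>Ideals of Noetherian rings\<close>

locale noetherian_cring = cring R + noetherian_ring R for R (structure)

context cring
begin

definition adjoin :: "'a set \<Rightarrow> 'a \<Rightarrow> 'a set"
  where "adjoin A x = {a \<oplus> x \<otimes> r |a r. a \<in> A \<and> r \<in> carrier R}"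

lemma ideal_of_closedI:
  assumes "A \<subseteq> carrier R" "\<zero> \<in> A"
    and "\<And>a b. a \<in> A \<Longrightarrow> b \<in> A \<Longrightarrow> a \<oplus> b \<in> A"
    and "\<And>a r. a \<in> A \<Longrightarrow> r \<in> carrier R \<Longrightarrow> r \<otimes> a \<in> A"
  shows "ideal A R"
proof (rule idealI)
  show "ring R" by (rule ring_axioms)
  show "subgroup A (add_monoid R)"
  proof (unfold_locales)
    show "A \<subseteq> carrier (add_monoid R)" using assms(1) by simp
    fix a assume a: "a \<in> A"
    then have "a \<in> carrier R" using assms(1) by auto
    then have "inv\<^bsub>add_monoid R\<^esub> a = (\<ominus> \<one>) \<otimes> a"
      by (simp add: a_inv_def[symmetric] l_minus)
    then show "inv\<^bsub>add_monoid R\<^esub> a \<in> A" using assms(4)[OF a, of "\<ominus> \<one>"] by simp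
  qed (use assms in auto)
  fix a x assume ax: "a \<in> A" "x \<in> carrier R"
  then show "x \<otimes> a \<in> A" using assms by auto
  then show "a \<otimes> x \<in> A" using ax assms(1) m_comm[of a x] by auto
qed

lemma adjoin_ideal:
  assumes "ideal A R" "x \<in> carrier R"
  shows "ideal (adjoin A x) R"
proof -
  interpret A: ideal A R by fact
  show ?thesis
  proof (rule ideal_of_closedI)
    show "adjoin A x \<subseteq> carrier R" using assms(2) A.Icarr by (auto simp: adjoin_def)
    have "\<zero> = \<zero> \<oplus> x \<otimes> \<zero>" using assms(2) by simp
    then show "\<zero> \<in> adjoin A x" unfolding adjoin_def using A.zero_closed by blast
  next
    fix a b assume "a \<in> adjoin A x" "b \<in> adjoin A x"
    then obtain a1 r b1 s where
      *: "a = a1 \<oplus> x \<otimes> r" "a1 \<in> A" "r \<in> carrier R" "b = b1 \<oplus> x \<otimes> s" "b1 \<in> A" "s \<in> carrier R"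
      unfolding adjoin_def by blast
    note c = A.Icarr[OF *(2)] A.Icarr[OF *(5)] *(3,6) assms(2)
    have "a \<oplus> b = (a1 \<oplus> b1) \<oplus> x \<otimes> (r \<oplus> s)" unfolding *(1,4) using c by algebra
    then show "a \<oplus> b \<in> adjoin A x" unfolding adjoin_def using * by blast
  next
    fix a s assume "a \<in> adjoin A x" and s: "s \<in> carrier R"
    then obtain a1 r where *: "a = a1 \<oplus> x \<otimes> r" "a1 \<in> A" "r \<in> carrier R"
      unfolding adjoin_def by blast
    note c = A.Icarr[OF *(2)] *(3) assms(2) s
    have "s \<otimes> a = s \<otimes> a1 \<oplus> x \<otimes> (s \<otimes> r)" unfolding *(1) using c by algebra
    then show "s \<otimes> a \<in> adjoin A x" unfolding adjoin_def using * s A.I_l_closed by blast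
  qed
qed

lemma adjoinE:
  assumes "y \<in> adjoin A x"
  obtains a r where "a \<in> A" "r \<in> carrier R" "y = a \<oplus> x \<otimes> r"
  using assms unfolding adjoin_def by blast

lemma adjoinI: "a \<in> A \<Longrightarrow> r \<in> carrier R \<Longrightarrow> a \<oplus> x \<otimes> r \<in> adjoin A x"
  unfolding adjoin_def by blast

lemma adjoin_superset:
  assumes "ideal A R" "x \<in> carrier R" shows "A \<subseteq> adjoin A x"
proof
  fix a assume "a \<in> A"
  moreover have "a \<in> carrier R" using ideal.Icarr[OF assms(1)] \<open>a \<in> A\<close> .
  ultimately show "a \<in> adjoin A x" using adjoinI[of a A \<zero> x] assms(2) by simp
qed

lemma adjoin_mem:
  assumes "ideal A R" "x \<in> carrier R" shows "x \<in> adjoin A x"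
  using adjoinI[of \<zero> A \<one> x] assms additive_subgroup.zero_closed[OF ideal.axioms(1)[OF assms(1)]]
  by simp

lemma adjoin_minimal:
  assumes "ideal B R" "A \<subseteq> B" "x \<in> B" shows "adjoin A x \<subseteq> B"
proof
  fix y assume "y \<in> adjoin A x"
  then obtain a r where *: "a \<in> A" "r \<in> carrier R" "y = a \<oplus> x \<otimes> r" by (rule adjoinE)
  interpret B: ideal B R by fact
  show "y \<in> B" unfolding *(3) using * assms by (intro B.a_closed B.I_r_closed) auto
qed

lemma adjoin_mono: "A \<subseteq> B \<Longrightarrow> adjoin A x \<subseteq> adjoin B x"
  unfolding adjoin_def by blast

lemma primeideal_pow_mem:
  assumes "primeideal P R" "y \<in> carrier R" "y [^] (n::nat) \<in> P"
  shows "y \<in> P"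
proof -
  interpret P: primeideal P R by fact
  show ?thesis using assms(3)
  proof (induction n)
    case 0
    then have "P = carrier R" using P.one_imp_carrier by simp
    then show ?case using assms(2) by simp
  next
    case (Suc n)
    then show ?case using P.I_prime[of "y [^] n" y] assms(2) by auto
  qed
qed

lemma primeideal_one_notin: "primeideal P R \<Longrightarrow> \<one> \<notin> P"
  using ideal.one_imp_carrier primeideal.axioms(1) primeideal.I_notcarr by blast

lemma primeideal_compl_mult:
  assumes "primeideal P R" "s \<in> carrier R - P" "t \<in> carrier R - P"
  shows "s \<otimes> t \<in> carrier R - P"
  using primeideal.I_prime[OF assms(1), of s t] assms by auto

text \<open>The containment \<open>A\<^sub>P \<subseteq> B\<^sub>P\<close> of localized ideals, expressed by clearing denominators. With it
  the principal ideal theorem can be proved at a prime in the middle of a chain without forming the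
  local ring there.\<close>

definition locally_sub :: "'a set \<Rightarrow> 'a set \<Rightarrow> 'a set \<Rightarrow> bool"
  where "locally_sub P A B \<longleftrightarrow> (\<forall>a\<in>A. \<exists>s\<in>carrier R - P. s \<otimes> a \<in> B)"

text \<open>The localization at \<open>P\<close> of the quotient by \<open>C\<close> is Artinian.\<close>

definition local_dcc :: "'a set \<Rightarrow> 'a set \<Rightarrow> bool"
  where "local_dcc P C \<longleftrightarrow>
    (\<forall>A :: nat \<Rightarrow> 'a set. (\<forall>n. ideal (A n) R \<and> C \<subseteq> A n \<and> A (Suc n) \<subseteq> A n) \<longrightarrow>
      (\<exists>N. \<forall>n\<ge>N. locally_sub P (A n) (A (Suc n))))"

lemma locally_subI_unit:
  assumes "ideal B R" "A \<subseteq> carrier R" "s \<in> B" "s \<notin> P"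
  shows "locally_sub P A B"
proof -
  interpret B: ideal B R by fact
  show ?thesis unfolding locally_sub_def using assms B.Icarr B.I_r_closed by blast
qed

lemma locally_sub_subset:
  assumes "primeideal P R" "A \<subseteq> B" "A \<subseteq> carrier R"
  shows "locally_sub P A B"
  unfolding locally_sub_def
proof
  fix a assume "a \<in> A"
  then have "\<one> \<otimes> a \<in> B" using assms(2,3) by (metis l_one subsetD)
  then show "\<exists>s\<in>carrier R - P. s \<otimes> a \<in> B" using primeideal_one_notin[OF assms(1)] by blast
qed

lemma colon_elem_ideal:
  assumes "ideal A R" "b \<in> carrier R" shows "ideal {r \<in> carrier R. b \<otimes> r \<in> A} R"
  using ideal.helper_max_prime[OF assms(1)] assms(2) is_cring by blast

end

lemma (in noetherian_ring) family_maximalE: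
  assumes "I \<in> F" "\<And>I. I \<in> F \<Longrightarrow> ideal I R"
  obtains M where "M \<in> F" "\<And>N. N \<in> F \<Longrightarrow> M \<subseteq> N \<Longrightarrow> N = M"
proof -
  have "\<exists>M\<in>F. \<forall>X\<in>F. M \<subseteq> X \<longrightarrow> X = M"
  proof (rule subset_Zorn_nonempty)
    show "F \<noteq> {}" using assms(1) by blast
    fix C assume C: "C \<noteq> {}" "subset.chain F C"
    then have "subset.chain {I. ideal I R} C" using assms(2) unfolding pred_on.chain_def by auto
    then have "\<Union>C \<in> C" using ideal_chain_is_trivial C(1) by blast
    then show "\<Union>C \<in> F" using C(2) unfolding pred_on.chain_def by auto
  qed
  then show ?thesis using that by blast
qed

lemma (in noetherian_ring) exists_maximal_ideal:
  assumes "ideal I R" "I \<noteq> carrier R"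
  shows "\<exists>M. maximalideal M R \<and> I \<subseteq> M"
proof -
  let ?F = "{N. ideal N R \<and> I \<subseteq> N \<and> N \<noteq> carrier R}"
  have F: "I \<in> ?F" using assms by blast
  obtain M where M: "M \<in> ?F" "\<And>N. N \<in> ?F \<Longrightarrow> M \<subseteq> N \<Longrightarrow> N = M"
    by (rule family_maximalE[OF F]) (blast, rule that)
  have "maximalideal M R"
  proof (rule maximalidealI)
    show "ideal M R" "carrier R \<noteq> M" using M(1) by auto
    show "J = M \<or> J = carrier R" if "ideal J R" "M \<subseteq> J" "J \<subseteq> carrier R" for J
      using M(2)[of J] M(1) that by blast
  qed
  then show ?thesis using M(1) by blast
qed

text \<open>The local-global principle through which a denominator \<open>c \<notin> M\<close> is removed in the end.\<close>

lemma (in noetherian_cring) ideal_eq_carrier_locally: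
  assumes A: "ideal A R" and loc: "\<And>M. maximalideal M R \<Longrightarrow> \<exists>c\<in>carrier R - M. c \<in> A"
  shows "\<one> \<in> A"
proof (rule ccontr)
  assume "\<one> \<notin> A"
  then have "A \<noteq> carrier R" by auto
  then obtain M where "maximalideal M R" "A \<subseteq> M" using exists_maximal_ideal[OF A] by blast
  then show False using loc by blast
qed

section \<open>Krull's principal ideal theorem and chains of primes\<close>

context noetherian_cring
begin

text \<open>If \<open>P\<close> is minimal over \<open>B\<close>, then the ring modulo \<open>B\<close> becomes Artinian at \<open>P\<close>. By Noetherian
  induction one looks at a maximal counterexample \<open>C\<close>. It is not prime, because above the prime
  \<open>P\<close> every chain is locally constant. So there are \<open>a, b \<notin> C\<close> with \<open>a * b \<in> C\<close>, and
  both \<open>C + (b)\<close> and \<open>C : b\<close> (which contains \<open>a\<close>) are strictly larger than \<open>C\<close>. A descending chain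
  whose images under \<open>A \<mapsto> A + (b)\<close> and \<open>A \<mapsto> A : b\<close> both stabilize is itself stable.\<close>

lemma local_dcc_above:
  assumes P: "primeideal P R" and B: "ideal B R"
    and min: "\<And>B'. primeideal B' R \<Longrightarrow> B \<subseteq> B' \<Longrightarrow> B' \<subseteq> P \<Longrightarrow> B' = P"
  shows "local_dcc P B"
proof (rule ccontr)
  assume nB: "\<not> local_dcc P B"
  let ?F = "{C. ideal C R \<and> B \<subseteq> C \<and> \<not> local_dcc P C}"
  obtain C where C: "C \<in> ?F" and Cmax: "\<And>N. N \<in> ?F \<Longrightarrow> C \<subseteq> N \<Longrightarrow> N = C"
    using family_maximalE[of B ?F] nB B by blast
  interpret P: primeideal P R by fact
  interpret C: ideal C R using C by simp
  have "\<not> local_dcc P C" using C by blast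
  then obtain A where A': "\<forall>n::nat. ideal (A n) R \<and> C \<subseteq> A n \<and> A (Suc n) \<subseteq> A n"
      and unst': "\<not> (\<exists>N. \<forall>n\<ge>N. locally_sub P (A n) (A (Suc n)))"
    unfolding local_dcc_def by blast
  have A: "\<And>n. ideal (A n) R" "\<And>n. C \<subseteq> A n" "\<And>n. A (Suc n) \<subseteq> A n" using A' by blast+
  have unst: "\<And>N. \<exists>n\<ge>N. \<not> locally_sub P (A n) (A (Suc n))" using unst' by blast
  have anti: "A n \<subseteq> A k" if "k \<le> n" for k n
    using that A(3) by (rule lift_Suc_antimono_le[rotated])
  have Acarr: "A n \<subseteq> carrier R" for n using ideal.Icarr[OF A(1)] by blast
  have "\<exists>m. A m \<subseteq> P"
  proof (rule ccontr)
    assume "\<not> ?thesis"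
    then have "locally_sub P (A k) (A (Suc k))" for k
      using locally_subI_unit[OF A(1) Acarr] by blast
    then show False using unst by blast
  qed
  then obtain m where m: "A m \<subseteq> P" by blast
  then have CP: "C \<subseteq> P" using A(2) by blast
  have "\<not> primeideal C R"
  proof
    assume "primeideal C R"
    then have "C = P" using min C CP by blast
    obtain l where l: "l \<ge> m" "\<not> locally_sub P (A l) (A (Suc l))" using unst by blast
    have "A l \<subseteq> A (Suc l)" using anti[OF l(1)] m A(2)[of "Suc l"] \<open>C = P\<close> by blast
    then show False using l locally_sub_subset[OF P _ Acarr] by blast
  qed
  moreover have "C \<noteq> carrier R" using CP P.one_imp_carrier P.I_notcarr by blast
  ultimately obtain a b where ab: "a \<in> carrier R" "b \<in> carrier R" "a \<otimes> b \<in> C" "a \<notin> C" "b \<notin> C"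
    using primeidealI[OF C.is_ideal is_cring] by blast
  let ?D1 = "adjoin C b" and ?D2 = "{r \<in> carrier R. b \<otimes> r \<in> C}"
  have D1: "ideal ?D1 R" "C \<subset> ?D1"
    using adjoin_ideal[OF C.is_ideal ab(2)] adjoin_superset[OF C.is_ideal ab(2)]
      adjoin_mem[OF C.is_ideal ab(2)] ab(5) by auto
  have "a \<in> ?D2" using ab m_comm[of a b] by simp
  moreover have "C \<subseteq> ?D2" using ab(2) C.Icarr C.I_l_closed by auto
  ultimately have D2: "ideal ?D2 R" "C \<subset> ?D2"
    using colon_elem_ideal[OF C.is_ideal ab(2)] ab(4) by auto
  have stab: "local_dcc P ?D1" "local_dcc P ?D2"
    using Cmax[of ?D1] Cmax[of ?D2] D1 D2 C by blast+
  let ?A1 = "\<lambda>n. adjoin (A n) b" and ?A2 = "\<lambda>n. {r \<in> carrier R. b \<otimes> r \<in> A n}"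
  have "ideal (?A1 n) R \<and> ?D1 \<subseteq> ?A1 n \<and> ?A1 (Suc n) \<subseteq> ?A1 n" for n
    using adjoin_ideal[OF A(1) ab(2)] adjoin_mono A(2,3) by auto
  then obtain N1 where N1: "\<And>n. n \<ge> N1 \<Longrightarrow> locally_sub P (?A1 n) (?A1 (Suc n))"
    using stab(1)[unfolded local_dcc_def, rule_format, of ?A1] by blast
  have "ideal (?A2 n) R \<and> ?D2 \<subseteq> ?A2 n \<and> ?A2 (Suc n) \<subseteq> ?A2 n" for n
    using colon_elem_ideal[OF A(1) ab(2)] A(2,3) by blast
  then obtain N2 where N2: "\<And>n. n \<ge> N2 \<Longrightarrow> locally_sub P (?A2 n) (?A2 (Suc n))"
    using stab(2)[unfolded local_dcc_def, rule_format, of ?A2] by blast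
  obtain n where n: "n \<ge> max N1 N2" "\<not> locally_sub P (A n) (A (Suc n))" using unst by blast
  interpret An: ideal "A n" R by (rule A(1))
  interpret An': ideal "A (Suc n)" R by (rule A(1))
  have "locally_sub P (A n) (A (Suc n))"
    unfolding locally_sub_def
  proof
    fix x assume x: "x \<in> A n"
    then have "x \<in> ?A1 n" using adjoin_superset[OF A(1) ab(2)] by blast
    moreover have "locally_sub P (?A1 n) (?A1 (Suc n))" using N1 n(1) by simp
    ultimately obtain s where s: "s \<in> carrier R - P" "s \<otimes> x \<in> ?A1 (Suc n)"
      unfolding locally_sub_def by blast
    then obtain y r where yr: "y \<in> A (Suc n)" "r \<in> carrier R" "s \<otimes> x = y \<oplus> b \<otimes> r"
      by (auto elim: adjoinE)
    note c = ab(2) An'.Icarr[OF yr(1)] yr(2) An.Icarr[OF x]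
    have sc: "s \<in> carrier R" using s by simp
    have "b \<otimes> r = (y \<oplus> b \<otimes> r) \<oplus> \<ominus> y" using c by algebra
    then have "b \<otimes> r = s \<otimes> x \<oplus> \<ominus> y" unfolding yr(3) .
    moreover have "y \<in> A n" using yr(1) A(3) by blast
    ultimately have "b \<otimes> r \<in> A n" using x s An.I_l_closed An.a_closed An.a_inv_closed by auto
    moreover have "locally_sub P (?A2 n) (?A2 (Suc n))" using N2 n(1) by simp
    ultimately obtain t where t: "t \<in> carrier R - P" "b \<otimes> (t \<otimes> r) \<in> A (Suc n)"
      using yr(2) unfolding locally_sub_def by blast
    have tc: "t \<in> carrier R" using t by simp
    have "(t \<otimes> s) \<otimes> x = t \<otimes> (s \<otimes> x)" using c sc tc by algebra
    also have "\<dots> = t \<otimes> y \<oplus> b \<otimes> (t \<otimes> r)" unfolding yr(3) using c sc tc by algebra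
    finally have "(t \<otimes> s) \<otimes> x \<in> A (Suc n)"
      using t(2) An'.I_l_closed[OF yr(1) tc] An'.a_closed by simp
    then show "\<exists>s\<in>carrier R - P. s \<otimes> x \<in> A (Suc n)"
      using primeideal_compl_mult[OF P t(1) s(1)] by blast
  qed
  then show False using n(2) by blast
qed

text \<open>Nakayama's lemma at \<open>P\<close>, from the ascending chain condition: among the ideals between \<open>B\<close> and
  \<open>A\<close> that do not locally contain \<open>A\<close> choose a maximal one \<open>C\<close>. For \<open>a\<close> locally outside
  \<open>C\<close> the ideal \<open>C + (a)\<close> locally is all of \<open>A\<close>, and the hypothesis then yields
  \<open>(t * s - x * v) * a \<in> C\<close> with a coefficient outside \<open>P\<close>.\<close>

lemma local_nakayama:
  assumes P: "primeideal P R" and A: "ideal A R" and B: "ideal B R" and "x \<in> P"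
    and gen: "\<And>a. a \<in> A \<Longrightarrow> \<exists>s\<in>carrier R - P. \<exists>r\<in>A. \<exists>b\<in>B. s \<otimes> a = b \<oplus> x \<otimes> r"
    and "B \<subseteq> A"
  shows "locally_sub P A B"
proof (rule ccontr)
  assume nB: "\<not> locally_sub P A B"
  interpret P: primeideal P R by fact
  interpret A: ideal A R by fact
  let ?F = "{C. ideal C R \<and> B \<subseteq> C \<and> C \<subseteq> A \<and> \<not> locally_sub P A C}"
  obtain C where C: "C \<in> ?F" and Cmax: "\<And>N. N \<in> ?F \<Longrightarrow> C \<subseteq> N \<Longrightarrow> N = C"
    using family_maximalE[of B ?F] nB B assms by blast
  interpret C: ideal C R using C by simp
  obtain a where a: "a \<in> A" "\<And>s. s \<in> carrier R - P \<Longrightarrow> s \<otimes> a \<notin> C"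
    using C unfolding locally_sub_def by blast
  have ac: "a \<in> carrier R" using A.Icarr a by blast
  have "\<one> \<otimes> a \<notin> C" using a(2) primeideal_one_notin[OF P] by blast
  then have anC: "a \<notin> C" using ac by simp
  have "locally_sub P A (adjoin C a)"
  proof (rule ccontr)
    assume "\<not> ?thesis"
    moreover have "adjoin C a \<subseteq> A" using adjoin_minimal[OF A] C a by blast
    ultimately have "adjoin C a = C"
      using Cmax adjoin_ideal[OF C.is_ideal ac] adjoin_superset[OF C.is_ideal ac] C by blast
    then show False using adjoin_mem[OF C.is_ideal ac] anC by blast
  qed
  moreover obtain s r b where s: "s \<in> carrier R - P" "r \<in> A" "b \<in> B" "s \<otimes> a = b \<oplus> x \<otimes> r"
    using gen[OF a(1)] by blast
  ultimately obtain t where t: "t \<in> carrier R - P" "t \<otimes> r \<in> adjoin C a"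
    unfolding locally_sub_def by blast
  then obtain c v where v: "c \<in> C" "v \<in> carrier R" "t \<otimes> r = c \<oplus> a \<otimes> v" by (auto elim: adjoinE)
  have bC: "b \<in> C" using s C by blast
  have sc: "s \<in> carrier R" "t \<in> carrier R" using s t by auto
  note c = sc v(2) ac C.Icarr[OF v(1)] C.Icarr[OF bC] A.Icarr[OF s(2)] P.Icarr[OF \<open>x \<in> P\<close>]
  have "(t \<otimes> s \<ominus> x \<otimes> v) \<otimes> a = t \<otimes> (s \<otimes> a) \<ominus> x \<otimes> v \<otimes> a" using c by algebra
  also have "\<dots> = t \<otimes> b \<oplus> x \<otimes> (t \<otimes> r) \<ominus> x \<otimes> v \<otimes> a" unfolding s(4) using c by algebra
  also have "\<dots> = t \<otimes> b \<oplus> x \<otimes> c" unfolding v(3) using c by algebra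
  finally have "(t \<otimes> s \<ominus> x \<otimes> v) \<otimes> a \<in> C"
    using C.I_l_closed bC v(1) c C.a_closed by simp
  moreover have "t \<otimes> s \<ominus> x \<otimes> v \<in> carrier R - P"
  proof -
    have "t \<otimes> s \<in> P" if "t \<otimes> s \<ominus> x \<otimes> v \<in> P"
    proof -
      have "(t \<otimes> s \<ominus> x \<otimes> v) \<oplus> x \<otimes> v \<in> P" using that \<open>x \<in> P\<close> v(2) P.I_r_closed P.a_closed by auto
      moreover have "(t \<otimes> s \<ominus> x \<otimes> v) \<oplus> x \<otimes> v = t \<otimes> s" using c by algebra
      ultimately show ?thesis by simp
    qed
    then show ?thesis using primeideal_compl_mult[OF P t(1) s(1)] c by auto
  qed
  ultimately show False using a(2) by blast
qed

lemma mult_cancel_mod_prime: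
  assumes "primeideal P R" "x \<in> carrier R" "y \<in> carrier R" "x \<otimes> y \<in> P" "x \<notin> P"
  shows "y \<in> P"
  using primeideal.I_prime[OF assms(1), of x y] assms by blast

text \<open>The principal ideal theorem in the form needed for chains. If the claim fails, then \<open>x \<notin> Q\<close>
  and \<open>P\<close> is minimal over \<open>B = P0 + (x)\<close>, so the ring modulo \<open>B\<close> is Artinian at \<open>P\<close>. Choose \<open>y\<close> in \<open>Q\<close> outside
  \<open>P0\<close> and let \<open>A n\<close> be the contraction of the ideal \<open>(y ^ n)\<close> of the localization at \<open>Q\<close> of the ring
  modulo \<open>P0\<close>. The descending chain \<open>A n + (x)\<close> is eventually stable at \<open>P\<close>; since \<open>x\<close>, lying
  outside \<open>Q\<close>, is a nonzerodivisor modulo \<open>A n\<close>, Nakayama's lemma makes \<open>A n\<close> itself stable. Then \<open>y ^ n\<close> is a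
  multiple of \<open>y ^ (n + 1)\<close> in a local domain in which \<open>y\<close> is a nonzero nonunit.\<close>

lemma prime_between:
  assumes P0: "primeideal P0 R" and Q: "primeideal Q R" and P: "primeideal P R"
    and "P0 \<subset> Q" "Q \<subset> P" "x \<in> P"
  shows "\<exists>P'. primeideal P' R \<and> P0 \<subset> P' \<and> P' \<subset> P \<and> x \<in> P'"
proof (rule ccontr)
  assume "\<not> ?thesis"
  then have none: "False" if "primeideal P' R" "P0 \<subset> P'" "P' \<subset> P" "x \<in> P'" for P'
    using that by blast
  interpret P0: primeideal P0 R by fact
  interpret Q: primeideal Q R by fact
  interpret P: primeideal P R by fact
  have xQ: "x \<notin> Q" using none[OF Q] assms by blast
  have xc: "x \<in> carrier R" using P.Icarr assms by blast
  define B where "B = adjoin P0 x"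
  have min: "B' = P" if "primeideal B' R" "B \<subseteq> B'" "B' \<subseteq> P" for B'
  proof -
    have "x \<in> B'" "P0 \<subseteq> B'" using that(2) adjoin_mem[OF P0.is_ideal xc]
        adjoin_superset[OF P0.is_ideal xc] unfolding B_def by auto
    moreover have "x \<notin> P0" using xQ assms by blast
    ultimately show ?thesis using none that(1,3) by blast
  qed
  have dcc: "local_dcc P B"
    by (rule local_dcc_above[OF P adjoin_ideal[OF P0.is_ideal xc, folded B_def] min])
  obtain y where y: "y \<in> Q" "y \<notin> P0" using assms by blast
  have yc: "y \<in> carrier R" using y Q.Icarr by blast
  define A where "A n = {a \<in> carrier R. \<exists>s\<in>carrier R - Q. \<exists>r\<in>carrier R. \<exists>c\<in>P0.
    s \<otimes> a = y [^] n \<otimes> r \<oplus> c}" for n :: nat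
  have AI: "ideal (A n) R" for n
  proof (rule ideal_of_closedI)
    show "A n \<subseteq> carrier R" unfolding A_def by blast
    have "\<one> \<otimes> \<zero> = y [^] n \<otimes> \<zero> \<oplus> \<zero>" using yc by simp
    then show "\<zero> \<in> A n"
      unfolding A_def using primeideal_one_notin[OF Q] P0.zero_closed by blast
  next
    fix a b assume "a \<in> A n" "b \<in> A n"
    then obtain s r c t u d where
      *: "a \<in> carrier R" "b \<in> carrier R" "s \<in> carrier R - Q" "t \<in> carrier R - Q"
        "r \<in> carrier R" "u \<in> carrier R" "c \<in> P0" "d \<in> P0"
        "s \<otimes> a = y [^] n \<otimes> r \<oplus> c" "t \<otimes> b = y [^] n \<otimes> u \<oplus> d"
      unfolding A_def by blast
    have sc: "s \<in> carrier R" "t \<in> carrier R" "y [^] n \<in> carrier R" using * yc by auto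
    note cl = *(1,2,5,6) P0.Icarr[OF *(7)] P0.Icarr[OF *(8)] sc
    have "(s \<otimes> t) \<otimes> (a \<oplus> b) = t \<otimes> (s \<otimes> a) \<oplus> s \<otimes> (t \<otimes> b)" using cl by algebra
    also have "\<dots> = y [^] n \<otimes> (t \<otimes> r \<oplus> s \<otimes> u) \<oplus> (t \<otimes> c \<oplus> s \<otimes> d)"
      unfolding *(9,10) using cl by algebra
    finally have "(s \<otimes> t) \<otimes> (a \<oplus> b) = \<dots>" .
    moreover have "t \<otimes> c \<oplus> s \<otimes> d \<in> P0" using * sc P0.I_l_closed P0.a_closed by auto
    moreover have "t \<otimes> r \<oplus> s \<otimes> u \<in> carrier R" "a \<oplus> b \<in> carrier R" using cl by auto
    ultimately show "a \<oplus> b \<in> A n"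
      unfolding A_def using primeideal_compl_mult[OF Q *(3,4)] by blast
  next
    fix a v assume "a \<in> A n" and v: "v \<in> carrier R"
    then obtain s r c where
      *: "a \<in> carrier R" "s \<in> carrier R - Q" "r \<in> carrier R" "c \<in> P0"
        "s \<otimes> a = y [^] n \<otimes> r \<oplus> c"
      unfolding A_def by blast
    have sc: "s \<in> carrier R" "y [^] n \<in> carrier R" using * yc by auto
    note cl = *(1,3) P0.Icarr[OF *(4)] sc v
    have "s \<otimes> (v \<otimes> a) = v \<otimes> (s \<otimes> a)" using cl by algebra
    also have "\<dots> = y [^] n \<otimes> (v \<otimes> r) \<oplus> (v \<otimes> c)" unfolding *(5) using cl by algebra
    finally have "s \<otimes> (v \<otimes> a) = \<dots>" .
    moreover have "v \<otimes> c \<in> P0" "v \<otimes> r \<in> carrier R" "v \<otimes> a \<in> carrier R"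
      using * v P0.I_l_closed by auto
    ultimately show "v \<otimes> a \<in> A n" unfolding A_def using *(2) by blast
  qed
  have Adec: "A (Suc n) \<subseteq> A n" for n
  proof
    fix a assume "a \<in> A (Suc n)"
    then obtain s r c where
      *: "a \<in> carrier R" "s \<in> carrier R - Q" "r \<in> carrier R" "c \<in> P0"
        "s \<otimes> a = y [^] Suc n \<otimes> r \<oplus> c"
      unfolding A_def by blast
    have "s \<otimes> a = y [^] n \<otimes> (y \<otimes> r) \<oplus> c" unfolding *(5) using * yc by (simp add: m_assoc)
    moreover have "y \<otimes> r \<in> carrier R" using * yc by simp
    ultimately show "a \<in> A n" unfolding A_def using * by blast
  qed
  have P0A: "P0 \<subseteq> A n" for n
  proof
    fix c assume c: "c \<in> P0"
    then have "\<one> \<otimes> c = y [^] n \<otimes> \<zero> \<oplus> c" using yc P0.Icarr by simp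
    then show "c \<in> A n" unfolding A_def
      using primeideal_one_notin[OF Q] P0.Icarr c by blast
  qed
  have "ideal (adjoin (A n) x) R \<and> B \<subseteq> adjoin (A n) x \<and> adjoin (A (Suc n)) x \<subseteq> adjoin (A n) x" for n
    unfolding B_def using adjoin_ideal[OF AI xc] adjoin_mono[OF P0A] adjoin_mono[OF Adec] by blast
  then obtain N where N: "locally_sub P (adjoin (A N) x) (adjoin (A (Suc N)) x)"
    using dcc[unfolded local_dcc_def, rule_format, of "\<lambda>n. adjoin (A n) x"] by blast
  have cancel: "b \<in> A n" if h: "s \<in> carrier R - Q" "s \<otimes> b \<in> A n" "b \<in> carrier R" for s b n
  proof -
    obtain t r c where *: "t \<in> carrier R - Q" "r \<in> carrier R" "c \<in> P0"
      "t \<otimes> (s \<otimes> b) = y [^] n \<otimes> r \<oplus> c" using h(2) unfolding A_def by auto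
    have "(t \<otimes> s) \<otimes> b = y [^] n \<otimes> r \<oplus> c" using * h m_assoc by auto
    then show ?thesis
      unfolding A_def using primeideal_compl_mult[OF Q *(1) h(1)] *(2,3) h(3) by auto
  qed
  \<comment> \<open>From \<open>s a = b + x r\<close> one gets \<open>x r \<in> A N\<close>, hence \<open>r \<in> A N\<close>, because \<open>x \<notin> Q\<close>.\<close>
  interpret AN: ideal "A N" R by (rule AI)
  have "locally_sub P (A N) (A (Suc N))"
  proof (rule local_nakayama[OF P AI AI \<open>x \<in> P\<close> _ Adec])
    fix a assume a: "a \<in> A N"
    then obtain s where s: "s \<in> carrier R - P" "s \<otimes> a \<in> adjoin (A (Suc N)) x"
      using N adjoin_superset[OF AI xc] unfolding locally_sub_def by blast
    then obtain b r where br: "b \<in> A (Suc N)" "r \<in> carrier R" "s \<otimes> a = b \<oplus> x \<otimes> r"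
      by (auto elim: adjoinE)
    have bN: "b \<in> A N" using br Adec by blast
    have cl: "s \<in> carrier R" "b \<in> carrier R" "a \<in> carrier R" "r \<in> carrier R" "x \<in> carrier R"
      using s AN.Icarr a bN br xc by auto
    have "x \<otimes> r = (b \<oplus> x \<otimes> r) \<oplus> \<ominus> b" using cl by algebra
    also have "\<dots> = s \<otimes> a \<oplus> \<ominus> b" unfolding br(3) ..
    also have "\<dots> \<in> A N" using a bN cl AN.I_l_closed AN.a_closed AN.a_inv_closed by blast
    finally have "r \<in> A N" using cancel[of x r N] xQ xc cl by blast
    then show "\<exists>s\<in>carrier R - P. \<exists>r\<in>A N. \<exists>b\<in>A (Suc N). s \<otimes> a = b \<oplus> x \<otimes> r"
      using s br by blast
  qed
  moreover have "y [^] N \<in> A N"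
  proof -
    have "\<one> \<otimes> y [^] N = y [^] N \<otimes> \<one> \<oplus> \<zero>" using yc by simp
    then show ?thesis unfolding A_def using primeideal_one_notin[OF Q] yc P0.zero_closed by blast
  qed
  ultimately obtain s where s: "s \<in> carrier R - P" "s \<otimes> y [^] N \<in> A (Suc N)"
    unfolding locally_sub_def by blast
  then obtain t r c where *: "t \<in> carrier R - Q" "r \<in> carrier R" "c \<in> P0"
      "t \<otimes> (s \<otimes> y [^] N) = y [^] Suc N \<otimes> r \<oplus> c" unfolding A_def by blast
  have cl: "s \<in> carrier R" "t \<in> carrier R" "r \<in> carrier R" "y [^] N \<in> carrier R" "c \<in> carrier R"
    using s * yc P0.Icarr by auto
  have "y [^] N \<otimes> (t \<otimes> s \<ominus> y \<otimes> r) = t \<otimes> (s \<otimes> y [^] N) \<ominus> (y [^] N \<otimes> y) \<otimes> r"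
    using cl yc by algebra
  also have "\<dots> = c" unfolding *(4) nat_pow_Suc using cl yc by algebra
  finally have "y [^] N \<otimes> (t \<otimes> s \<ominus> y \<otimes> r) \<in> P0" using *(3) by simp
  moreover have "y [^] N \<notin> P0" using primeideal_pow_mem[OF P0 yc] y by blast
  ultimately have "t \<otimes> s \<ominus> y \<otimes> r \<in> P0" using mult_cancel_mod_prime[OF P0 cl(4), of "t \<otimes> s \<ominus> y \<otimes> r"] cl yc by simp
  then have "t \<otimes> s \<ominus> y \<otimes> r \<oplus> y \<otimes> r \<in> Q"
    using \<open>P0 \<subset> Q\<close> y(1) cl Q.I_r_closed Q.a_closed by blast
  moreover have "t \<otimes> s \<ominus> y \<otimes> r \<oplus> y \<otimes> r = t \<otimes> s" using cl yc by algebra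
  ultimately have "t \<otimes> s \<in> Q" by simp
  moreover have "s \<in> carrier R - Q" using s(1) \<open>Q \<subset> P\<close> by blast
  ultimately show False using primeideal_compl_mult[OF Q *(1), of s] by blast
qed

text \<open>Working downwards from the top, each member of the chain is replaced by one that contains \<open>x\<close>.\<close>

lemma prime_chain_through:
  assumes "\<And>i. i \<le> Suc n \<Longrightarrow> primeideal (P i) R" "\<And>i. i \<le> n \<Longrightarrow> P i \<subset> P (Suc i)"
    and "x \<in> P (Suc n)"
  shows "\<exists>P'. (\<forall>i\<le>Suc n. primeideal (P' i) R) \<and> (\<forall>i\<le>n. P' i \<subset> P' (Suc i))
    \<and> P' 0 = P 0 \<and> P' (Suc n) = P (Suc n) \<and> x \<in> P' 1"
  using assms
proof (induction n arbitrary: P)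
  case 0
  then show ?case by (intro exI[of _ P]) auto
next
  case (Suc n)
  obtain Q where Q: "primeideal Q R" "P n \<subset> Q" "Q \<subset> P (Suc (Suc n))" "x \<in> Q"
    using prime_between[of "P n" "P (Suc n)" "P (Suc (Suc n))" x] Suc.prems by auto
  let ?P = "P (Suc n := Q)"
  have "\<exists>P'. (\<forall>i\<le>Suc n. primeideal (P' i) R) \<and> (\<forall>i\<le>n. P' i \<subset> P' (Suc i))
    \<and> P' 0 = ?P 0 \<and> P' (Suc n) = ?P (Suc n) \<and> x \<in> P' 1"
  proof (rule Suc.IH)
    show "primeideal (?P i) R" if "i \<le> Suc n" for i using that Suc.prems(1) Q(1) by simp
    show "?P i \<subset> ?P (Suc i)" if "i \<le> n" for i using that Suc.prems(2)[of i] Q(2) by auto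
    show "x \<in> ?P (Suc n)" using Q by simp
  qed
  then obtain P' where P': "\<forall>i\<le>Suc n. primeideal (P' i) R" "\<forall>i\<le>n. P' i \<subset> P' (Suc i)"
      "P' 0 = P 0" "P' (Suc n) = Q" "x \<in> P' 1" by auto
  let ?P' = "P' (Suc (Suc n) := P (Suc (Suc n)))"
  have "primeideal (?P' i) R" if "i \<le> Suc (Suc n)" for i
    using that P'(1) Suc.prems(1) by (auto simp: le_Suc_eq)
  moreover have "?P' i \<subset> ?P' (Suc i)" if "i \<le> Suc n" for i
  proof (cases "i = Suc n")
    case True
    then show ?thesis using P'(4) Q(3) by simp
  next
    case False
    then show ?thesis using P'(2) that by simp
  qed
  ultimately show ?case using P'(3,5) by (intro exI[of _ ?P']) auto
qed

end

section \<open>Frobenius-linear combinations\<close>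

locale frob_cring = cring R for R (structure) +
  fixes q :: nat
  assumes q_pos: "0 < q"
    and frob_add: "a \<in> carrier R \<Longrightarrow> b \<in> carrier R \<Longrightarrow> (a \<oplus> b) [^] q = a [^] q \<oplus> b [^] q"
begin

lemma frob_zero: "\<zero> [^] q = \<zero>"
  using q_pos by (simp add: nat_pow_zero)

lemma frob_minus:
  assumes a: "a \<in> carrier R" shows "(\<ominus> a) [^] q = \<ominus> (a [^] q)"
proof -
  have "(\<ominus> a) [^] q \<oplus> a [^] q = (\<ominus> a \<oplus> a) [^] q" using a by (simp add: frob_add)
  also have "\<dots> = \<zero>" using a by (simp add: l_neg frob_zero)
  finally show ?thesis using a by (simp add: minus_equality[symmetric])
qed

lemma frob_diff:
  "a \<in> carrier R \<Longrightarrow> b \<in> carrier R \<Longrightarrow> (a \<ominus> b) [^] q = a [^] q \<ominus> b [^] q"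
  by (simp add: a_minus_def frob_add frob_minus)

lemma frob_in_ideal:
  assumes "ideal A R" "a \<in> A" shows "a [^] q \<in> A"
proof -
  have "a \<in> carrier R" using assms ideal.Icarr by metis
  moreover obtain n where "q = Suc n" using q_pos by (cases q) auto
  ultimately show ?thesis using ideal.I_l_closed[OF assms, of "a [^] n"] by simp
qed

text \<open>The additive closure of the products \<open>c\<^sup>q t\<close>. Taking all scalars \<open>c\<close> gives the span of \<open>T\<close> in
  the Frobenius pushforward; taking all \<open>t\<close> and the scalars from an ideal gives its Frobenius power.\<close>

inductive_set lin :: "'a set \<Rightarrow> 'a set \<Rightarrow> 'a set" for C T where
  zero: "\<zero> \<in> lin C T"
| step: "c \<in> C \<Longrightarrow> t \<in> T \<Longrightarrow> y \<in> lin C T \<Longrightarrow> c [^] q \<otimes> t \<oplus> y \<in> lin C T"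

lemma lin_closed:
  assumes "C \<subseteq> carrier R" "T \<subseteq> carrier R" "y \<in> lin C T" shows "y \<in> carrier R"
  using assms(3)
proof induction
  case (step c t y)
  then have "c \<in> carrier R" "t \<in> carrier R" using assms by auto
  then show ?case using step by simp
qed simp

lemma lin_add:
  assumes "C \<subseteq> carrier R" "T \<subseteq> carrier R" "y \<in> lin C T" "z \<in> lin C T"
  shows "y \<oplus> z \<in> lin C T"
  using assms(3)
proof induction
  case zero
  then show ?case using assms(4) lin_closed[OF assms(1,2,4)] by simp
next
  case (step c t y)
  have "c [^] q \<otimes> t \<oplus> (y \<oplus> z) \<in> lin C T" using step by (intro lin.step)
  moreover have "c \<in> carrier R" "t \<in> carrier R" using assms step by auto
  ultimately show ?case
    using lin_closed[OF assms(1,2)] step assms(4) by (simp add: a_assoc)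
qed

lemma lin_single:
  assumes "C \<subseteq> carrier R" "T \<subseteq> carrier R" "c \<in> C" "t \<in> T"
  shows "c [^] q \<otimes> t \<in> lin C T"
proof -
  have "c \<in> carrier R" "t \<in> carrier R" using assms by auto
  then show ?thesis using lin.step[OF assms(3,4) lin.zero] by simp
qed

lemma lin_mono: "C \<subseteq> C' \<Longrightarrow> T \<subseteq> T' \<Longrightarrow> lin C T \<subseteq> lin C' T'"
proof
  fix y assume "C \<subseteq> C'" "T \<subseteq> T'" "y \<in> lin C T"
  from this(3,1,2) show "y \<in> lin C' T'"
    by (induction) (auto intro: lin.intros)
qed

lemma lin_least:
  assumes "\<zero> \<in> B" "\<And>c t. c \<in> C \<Longrightarrow> t \<in> T \<Longrightarrow> c [^] q \<otimes> t \<in> B"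
    and "\<And>a b. a \<in> B \<Longrightarrow> b \<in> B \<Longrightarrow> a \<oplus> b \<in> B"
  shows "lin C T \<subseteq> B"
proof
  fix y assume "y \<in> lin C T" then show "y \<in> B" by induction (use assms in auto)
qed

lemma lin_frob_smult:
  assumes "C \<subseteq> carrier R" "T \<subseteq> carrier R" "r \<in> carrier R"
    and "\<And>c. c \<in> C \<Longrightarrow> r \<otimes> c \<in> C'" "y \<in> lin C T"
  shows "r [^] q \<otimes> y \<in> lin C' T"
  using assms(5)
proof induction
  case zero
  then show ?case using assms(3) lin.zero by simp
next
  case (step c t y)
  have cl: "c \<in> carrier R" "t \<in> carrier R" "y \<in> carrier R" "c [^] q \<in> carrier R" "r [^] q \<in> carrier R"
    using step assms(1,2,3) lin_closed by auto
  have "r [^] q \<otimes> (c [^] q \<otimes> t \<oplus> y) = (r [^] q \<otimes> c [^] q) \<otimes> t \<oplus> r [^] q \<otimes> y" using cl by algebra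
  also have "\<dots> = (r \<otimes> c) [^] q \<otimes> t \<oplus> r [^] q \<otimes> y" using cl assms(3) by (simp add: nat_pow_distrib)
  also have "\<dots> \<in> lin C' T" using step assms by (intro lin.step) auto
  finally show ?case .
qed

lemma lin_mult:
  assumes "C \<subseteq> carrier R" "T \<subseteq> carrier R" "r \<in> carrier R"
    and "\<And>t. t \<in> T \<Longrightarrow> r \<otimes> t \<in> T'" "y \<in> lin C T"
  shows "r \<otimes> y \<in> lin C T'"
  using assms(5)
proof induction
  case zero
  then show ?case using assms(3) lin.zero by simp
next
  case (step c t y)
  have cl: "c \<in> carrier R" "t \<in> carrier R" "y \<in> carrier R" "c [^] q \<in> carrier R"
    using step assms(1,2,3) lin_closed by auto
  have "r \<otimes> (c [^] q \<otimes> t \<oplus> y) = c [^] q \<otimes> (r \<otimes> t) \<oplus> r \<otimes> y" using cl assms(3) by algebra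
  also have "\<dots> \<in> lin C T'" using step assms by (intro lin.step) auto
  finally show ?case .
qed

abbreviation span :: "'a set \<Rightarrow> 'a set" where "span T \<equiv> lin (carrier R) T"

lemma span_superset: "T \<subseteq> carrier R \<Longrightarrow> T \<subseteq> span T"
proof
  fix t assume "T \<subseteq> carrier R" "t \<in> T"
  from this(2,1) have "\<one> [^] q \<otimes> t \<in> span T" by (intro lin_single) auto
  moreover have "t \<in> carrier R" using \<open>T \<subseteq> carrier R\<close> \<open>t \<in> T\<close> by (rule subsetD)
  ultimately show "t \<in> span T" by simp
qed

lemma span_smult:
  "T \<subseteq> carrier R \<Longrightarrow> r \<in> carrier R \<Longrightarrow> y \<in> span T \<Longrightarrow> r [^] q \<otimes> y \<in> span T"
  by (rule lin_frob_smult[of "carrier R" T r]) auto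

lemma span_minus:
  assumes T: "T \<subseteq> carrier R" and y: "y \<in> span T" shows "\<ominus> y \<in> span T"
proof -
  have yc: "y \<in> carrier R" using lin_closed[OF _ T y] by simp
  have "(\<ominus> \<one>) [^] q \<otimes> y \<in> span T" using assms by (intro span_smult) auto
  moreover have "(\<ominus> \<one>) [^] q \<otimes> y = \<ominus> y" using yc by (simp add: frob_minus l_minus)
  ultimately show ?thesis by simp
qed

lemma span_add:
  "T \<subseteq> carrier R \<Longrightarrow> y \<in> span T \<Longrightarrow> z \<in> span T \<Longrightarrow> y \<oplus> z \<in> span T"
  by (rule lin_add) auto

lemma span_le_span:
  assumes "T \<subseteq> carrier R" "T' \<subseteq> span T" shows "span T' \<subseteq> span T"
proof (rule lin_least)
  show "\<zero> \<in> span T" by (rule lin.zero)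
  show "c [^] q \<otimes> t \<in> span T" if "c \<in> carrier R" "t \<in> T'" for c t
    using span_smult[OF assms(1) that(1)] that(2) assms(2) by blast
qed (use span_add[OF assms(1)] in auto)

lemma span_insert:
  assumes "T \<subseteq> carrier R" "t \<in> carrier R" "y \<in> span (insert t T)"
  shows "\<exists>c\<in>carrier R. \<exists>w\<in>span T. y = c [^] q \<otimes> t \<oplus> w"
  using assms(3)
proof induction
  case zero
  have "\<zero> = \<zero> [^] q \<otimes> t \<oplus> \<zero>" using assms by (simp add: frob_zero)
  then show ?case using lin.zero by blast
next
  case (step d s y)
  then obtain c w where cw: "c \<in> carrier R" "w \<in> span T" "y = c [^] q \<otimes> t \<oplus> w" by blast
  have wc: "w \<in> carrier R" using lin_closed[OF _ assms(1) cw(2)] by simp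
  show ?case
  proof (cases "s = t")
    case True
    have "d [^] q \<otimes> s \<oplus> y = (d \<oplus> c) [^] q \<otimes> t \<oplus> w"
      unfolding True cw(3) using step(1) cw(1) wc assms(2)
      by (simp add: frob_add l_distr a_assoc)
    then show ?thesis using step(1) cw by blast
  next
    case False
    then have s: "s \<in> T" "s \<in> carrier R" using step assms by auto
    have "d [^] q \<otimes> s \<oplus> y = c [^] q \<otimes> t \<oplus> (d [^] q \<otimes> s \<oplus> w)"
      unfolding cw(3) using step(1) cw(1) wc assms(2) s(2) by (simp add: a_lcomm)
    moreover have "d [^] q \<otimes> s \<oplus> w \<in> span T" using step(1) s cw by (intro lin.step)
    ultimately show ?thesis using cw(1) by blast
  qed
qed

text \<open>An ideal is stable under the twisted scalars, so the part of a combination that comes from \<open>A\<close>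
  may be collected into one summand.\<close>

lemma span_un_ideal:
  assumes A: "ideal A R" and T: "T \<subseteq> carrier R" and y: "y \<in> span (T \<union> A)"
  shows "\<exists>w\<in>span T. \<exists>a\<in>A. y = w \<oplus> a"
  using y
proof induction
  interpret A: ideal A R by fact
  case zero
  have "\<zero> = \<zero> \<oplus> \<zero>" by simp
  then show ?case using lin.zero A.zero_closed by blast
next
  interpret A: ideal A R by fact
  case (step d s y)
  then obtain w a where wa: "w \<in> span T" "a \<in> A" "y = w \<oplus> a" by blast
  have wc: "w \<in> carrier R" "a \<in> carrier R" "d [^] q \<in> carrier R"
    using lin_closed[OF _ T wa(1)] A.Icarr wa step(1) by auto
  show ?case
  proof (cases "s \<in> A")
    case True
    then have "s \<in> carrier R" using A.Icarr by blast
    then have "d [^] q \<otimes> s \<oplus> y = w \<oplus> (d [^] q \<otimes> s \<oplus> a)" unfolding wa(3) using wc by algebra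
    moreover have "d [^] q \<otimes> s \<oplus> a \<in> A" using True wa wc A.I_l_closed A.a_closed by blast
    ultimately show ?thesis using wa by blast
  next
    case False
    then have s: "s \<in> T" "s \<in> carrier R" using step T by auto
    have "d [^] q \<otimes> s \<oplus> y = (d [^] q \<otimes> s \<oplus> w) \<oplus> a" unfolding wa(3) using wc s by algebra
    moreover have "d [^] q \<otimes> s \<oplus> w \<in> span T" using step(1) s wa by (intro lin.step)
    ultimately show ?thesis using wa by blast
  qed
qed

abbreviation bracket :: "'a set \<Rightarrow> 'a set" where "bracket K \<equiv> lin K (carrier R)"

lemma bracket_ideal:
  assumes "K \<subseteq> carrier R" shows "ideal (bracket K) R"
proof (rule ideal_of_closedI)
  show "bracket K \<subseteq> carrier R" using lin_closed[OF assms] by blast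
  show "a \<oplus> b \<in> bracket K" if "a \<in> bracket K" "b \<in> bracket K" for a b
    using lin_add[OF assms _ that] by simp
  show "r \<otimes> a \<in> bracket K" if "a \<in> bracket K" "r \<in> carrier R" for a r
    by (rule lin_mult[OF assms _ that(2) _ that(1)]) (use that in auto)
qed (rule lin.zero)

lemma frob_power_eq_bracket:
  assumes K: "K \<subseteq> carrier R" shows "frob_power R K q = bracket K"
proof
  have sub: "(\<lambda>x. x [^] q) ` K \<subseteq> carrier R" using K by auto
  show "frob_power R K q \<subseteq> bracket K"
    unfolding frob_power_def
  proof (rule genideal_minimal[OF bracket_ideal[OF K]], safe)
    fix x assume x: "x \<in> K"
    have "x [^] q \<otimes> \<one> \<in> bracket K" using K x by (intro lin_single) auto
    then show "x [^] q \<in> bracket K" using x K by auto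
  qed
  interpret I: ideal "Idl ((\<lambda>x. x [^] q) ` K)" R by (rule genideal_ideal[OF sub])
  show "bracket K \<subseteq> frob_power R K q"
    unfolding frob_power_def
    by (rule lin_least) (use genideal_self[OF sub] I.I_r_closed in \<open>auto\<close>)
qed

fun comb :: "'a list \<Rightarrow> 'a list \<Rightarrow> 'a" where
  "comb (c # cs) (b # bs) = c [^] q \<otimes> b \<oplus> comb cs bs"
| "comb _ _ = \<zero>"

lemma comb_closed:
  "set cs \<subseteq> carrier R \<Longrightarrow> set bs \<subseteq> carrier R \<Longrightarrow> comb cs bs \<in> carrier R"
  by (induction cs bs rule: comb.induct) auto

lemma comb_in_span:
  "set cs \<subseteq> carrier R \<Longrightarrow> comb cs bs \<in> span (set bs)"
proof (induction cs bs rule: comb.induct)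
  case (1 c cs b bs)
  have "comb cs bs \<in> span (set bs)" using 1 by simp
  moreover have "span (set bs) \<subseteq> span (set (b # bs))" by (rule lin_mono) auto
  ultimately have "comb cs bs \<in> span (set (b # bs))" by blast
  then show ?case using 1(2) by (auto intro: lin.step)
qed (auto intro: lin.zero)

lemma span_imp_comb:
  assumes "set bs \<subseteq> carrier R" "y \<in> span (set bs)"
  shows "\<exists>cs. length cs = length bs \<and> set cs \<subseteq> carrier R \<and> y = comb cs bs"
  using assms
proof (induction bs arbitrary: y)
  case Nil
  have "y = \<zero>" using Nil(2) by (cases rule: lin.cases) auto
  then show ?case by simp
next
  case (Cons b bs)
  then obtain c w where cw: "c \<in> carrier R" "w \<in> span (set bs)" "y = c [^] q \<otimes> b \<oplus> w"
    using span_insert[of "set bs" b y] by auto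
  then obtain cs where "length cs = length bs" "set cs \<subseteq> carrier R" "w = comb cs bs"
    using Cons by auto
  then show ?case using cw by (intro exI[of _ "c # cs"]) auto
qed

lemma comb_append:
  "length cs = length bs \<Longrightarrow> set cs \<subseteq> carrier R \<Longrightarrow> set ds \<subseteq> carrier R \<Longrightarrow>
   set bs \<subseteq> carrier R \<Longrightarrow> set bs' \<subseteq> carrier R \<Longrightarrow>
   comb (cs @ ds) (bs @ bs') = comb cs bs \<oplus> comb ds bs'"
  by (induction cs bs rule: comb.induct) (auto simp: comb_closed a_assoc)

lemma comb_map_mult:
  "x \<in> carrier R \<Longrightarrow> set cs \<subseteq> carrier R \<Longrightarrow> set bs \<subseteq> carrier R \<Longrightarrow>
   comb cs (map (\<lambda>b. x \<otimes> b) bs) = x \<otimes> comb cs bs"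
  by (induction cs bs rule: comb.induct) (auto simp: comb_closed r_distr m_lcomm)

lemma comb_add:
  "length cs = length bs \<Longrightarrow> length ds = length bs \<Longrightarrow> set cs \<subseteq> carrier R \<Longrightarrow> set ds \<subseteq> carrier R \<Longrightarrow>
   set bs \<subseteq> carrier R \<Longrightarrow>
   comb (map2 (\<lambda>c d. c \<oplus> d) cs ds) bs = comb cs bs \<oplus> comb ds bs"
proof (induction cs bs arbitrary: ds rule: comb.induct)
  case (1 c cs b bs)
  then obtain d es where ds: "ds = d # es" by (cases ds) auto
  have cl: "c [^] q \<in> carrier R" "d [^] q \<in> carrier R" "b \<in> carrier R"
     "comb cs bs \<in> carrier R" "comb es bs \<in> carrier R" using 1 ds by (auto simp: comb_closed)
  have "comb (map2 (\<oplus>) (c # cs) ds) (b # bs)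
      = (c [^] q \<oplus> d [^] q) \<otimes> b \<oplus> (comb cs bs \<oplus> comb es bs)" using 1 ds by (simp add: frob_add)
  also have "\<dots> = (c [^] q \<otimes> b \<oplus> comb cs bs) \<oplus> (d [^] q \<otimes> b \<oplus> comb es bs)" using cl by algebra
  finally show ?case using ds by simp
qed auto

lemma comb_smult:
  "length cs = length bs \<Longrightarrow> set cs \<subseteq> carrier R \<Longrightarrow> set bs \<subseteq> carrier R \<Longrightarrow> r \<in> carrier R \<Longrightarrow>
   comb (map (\<lambda>c. r \<otimes> c) cs) bs = r [^] q \<otimes> comb cs bs"
  by (induction cs bs rule: comb.induct) (auto simp: comb_closed r_distr nat_pow_distrib m_assoc)

end

section \<open>Local rings with finite Frobenius\<close>

locale local_frob = noetherian_cring R + frob_cring R q for R (structure) and q +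
  fixes m Y :: "'a set"
  assumes m_prime: "primeideal m R"
    and unit: "a \<in> carrier R \<Longrightarrow> a \<notin> m \<Longrightarrow> a \<in> Units R"
    and Y_finite: "finite Y" and Y_carrier: "Y \<subseteq> carrier R" and Y_span: "carrier R \<subseteq> span Y"
begin

sublocale m: primeideal m R by (rule m_prime)

lemma m_sub: "m \<subseteq> carrier R" using m.Icarr by blast

lemma one_minus_unit:
  assumes c: "c \<in> m"
  obtains u where "u \<in> carrier R" "u \<otimes> (\<one> \<ominus> c) = \<one>"
proof -
  have cc: "c \<in> carrier R" using c m.Icarr by blast
  have "\<one> \<ominus> c \<notin> m"
  proof
    assume "\<one> \<ominus> c \<in> m"
    then have "\<one> \<ominus> c \<oplus> c \<in> m" using c m.a_closed by blast
    moreover have "\<one> \<ominus> c \<oplus> c = \<one>" using cc by algebra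
    ultimately show False using primeideal_one_notin[OF m_prime] by simp
  qed
  then have "\<one> \<ominus> c \<in> Units R" using unit cc by simp
  then show ?thesis using that[of "inv (\<one> \<ominus> c)"] by simp
qed

text \<open>The part of Krull's intersection theorem used below: elements that can be divided by
  \<open>x \<in> m\<close> modulo \<open>A\<close> over and over again lie in \<open>A\<close>. Otherwise choose \<open>c\<close> among them with
  \<open>A + (c)\<close> maximal; writing \<open>c\<close> as \<open>x r\<close> modulo \<open>A\<close> gives \<open>A + (c) = A + (r)\<close>, so \<open>r\<close> is
  a multiple of \<open>x r\<close> modulo \<open>A\<close>, and \<open>1 - x t\<close> is a unit.\<close>

lemma krull_descent:
  assumes A: "ideal A R" and Z: "Z \<subseteq> carrier R" and x: "x \<in> m"
    and step: "\<And>c. c \<in> Z \<Longrightarrow> \<exists>a\<in>A. \<exists>r\<in>Z. c = a \<oplus> x \<otimes> r"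
  shows "Z \<subseteq> A"
proof (rule ccontr)
  assume "\<not> Z \<subseteq> A"
  then obtain c0 where c0: "c0 \<in> Z" "c0 \<notin> A" by blast
  interpret A: ideal A R by fact
  have xc: "x \<in> carrier R" using x m.Icarr by blast
  let ?F = "adjoin A ` (Z - A)"
  have F0: "adjoin A c0 \<in> ?F" using c0 by blast
  have FI: "ideal I R" if "I \<in> ?F" for I using that adjoin_ideal[OF A] Z by blast
  obtain M where M: "M \<in> ?F" "\<And>N. N \<in> ?F \<Longrightarrow> M \<subseteq> N \<Longrightarrow> N = M"
    by (rule family_maximalE[OF F0 FI]) (assumption, rule that)
  then obtain c where c: "c \<in> Z" "c \<notin> A" "M = adjoin A c" by blast
  obtain a r where ar: "a \<in> A" "r \<in> Z" "c = a \<oplus> x \<otimes> r" using step[OF c(1)] by blast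
  have cl: "a \<in> carrier R" "r \<in> carrier R" using ar Z A.Icarr by auto
  have "r \<notin> A"
  proof
    assume "r \<in> A"
    then have "c \<in> A" unfolding ar(3) using ar(1) xc A.I_l_closed A.a_closed by blast
    then show False using c(2) by blast
  qed
  interpret Ar: ideal "adjoin A r" R by (rule adjoin_ideal[OF A cl(2)])
  have "c \<in> adjoin A r"
  proof -
    have "c = a \<oplus> r \<otimes> x" unfolding ar(3) using cl xc by algebra
    then show ?thesis using adjoinI[OF ar(1) xc, of r] by simp
  qed
  then have "M \<subseteq> adjoin A r"
    unfolding c(3) using adjoin_minimal[OF Ar.is_ideal adjoin_superset[OF A cl(2)]] by blast
  then have "adjoin A r = M" using M(2) ar(2) \<open>r \<notin> A\<close> by blast
  then have "r \<in> adjoin A c" using adjoin_mem[OF A cl(2)] c(3) by blast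
  then obtain b t where bt: "b \<in> A" "t \<in> carrier R" "r = b \<oplus> c \<otimes> t" by (rule adjoinE)
  have "x \<otimes> t \<in> m" using x bt m.I_r_closed by blast
  then obtain u where u: "u \<in> carrier R" "u \<otimes> (\<one> \<ominus> x \<otimes> t) = \<one>" by (rule one_minus_unit)
  have bc: "b \<in> carrier R" using bt A.Icarr by blast
  have "(\<one> \<ominus> x \<otimes> t) \<otimes> r = r \<ominus> x \<otimes> t \<otimes> r" using cl xc bt(2) by algebra
  also have "\<dots> = (b \<oplus> c \<otimes> t) \<ominus> x \<otimes> t \<otimes> r" using bt(3) by simp
  also have "\<dots> = b \<oplus> a \<otimes> t" unfolding ar(3) using cl xc bt(2) bc by algebra
  finally have *: "(\<one> \<ominus> x \<otimes> t) \<otimes> r = b \<oplus> a \<otimes> t" .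
  have "r = (u \<otimes> (\<one> \<ominus> x \<otimes> t)) \<otimes> r" using u cl by simp
  also have "\<dots> = u \<otimes> ((\<one> \<ominus> x \<otimes> t) \<otimes> r)" using u(1) cl xc bt(2) by (simp add: m_assoc)
  also have "\<dots> = u \<otimes> (b \<oplus> a \<otimes> t)" unfolding * ..
  also have "\<dots> \<in> A"
    by (rule A.I_l_closed[OF A.a_closed[OF bt(1) A.I_r_closed[OF ar(1) bt(2)]] u(1)])
  finally show False using \<open>r \<notin> A\<close> by blast
qed

text \<open>Nakayama's lemma for the Frobenius pushforward: the finitely many generators are eliminated one
  at a time, since each is congruent modulo \<open>N\<close> and the remaining generators to
  \<open>c\<^sup>q\<close> times itself with \<open>c \<in> m\<close>, and \<open>1 - c\<^sup>q = (1 - c)\<^sup>q\<close> is the \<open>q\<close>-th power of a unit.\<close>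

lemma span_nakayama:
  assumes N: "N \<subseteq> carrier R" "span N \<subseteq> N"
    and full: "\<And>y. y \<in> carrier R \<Longrightarrow> \<exists>n\<in>N. \<exists>w\<in>bracket m. y = n \<oplus> w"
  shows "carrier R \<subseteq> N"
proof -
  have "carrier R \<subseteq> N" if "finite Z" "Z \<subseteq> carrier R" "carrier R \<subseteq> span (N \<union> Z)" for Z
    using that
  proof (induction Z)
    case empty
    then show ?case using N(2) by simp
  next
    case (insert y Z)
    let ?G = "span (N \<union> Z)"
    have NZ: "N \<union> Z \<subseteq> carrier R" and y: "y \<in> carrier R" using N insert by auto
    have G: "?G \<subseteq> carrier R" using lin_closed[OF _ NZ] by blast
    have decomp: "\<exists>c\<in>m. \<exists>g\<in>?G. w = c [^] q \<otimes> y \<oplus> g" if "w \<in> bracket m" for w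
      using that
    proof induction
      case zero
      have "\<zero> = \<zero> [^] q \<otimes> y \<oplus> \<zero>" using y by (simp add: frob_zero)
      then show ?case using lin.zero m.zero_closed by blast
    next
      case (step c t w)
      then obtain d g where dg: "d \<in> m" "g \<in> ?G" "w = d [^] q \<otimes> y \<oplus> g" by blast
      have "t \<in> span (insert y (N \<union> Z))" using insert.prems(2) step(2) by auto
      then obtain e h where eh: "e \<in> carrier R" "h \<in> ?G" "t = e [^] q \<otimes> y \<oplus> h"
        using span_insert[OF NZ y] by blast
      have cd: "c \<in> carrier R" "d \<in> carrier R" using step dg m.Icarr by auto
      have cl: "c [^] q \<in> carrier R" "d [^] q \<in> carrier R" "e [^] q \<in> carrier R"
         "g \<in> carrier R" "h \<in> carrier R" using cd eh dg G by auto
      have "(c \<otimes> e \<oplus> d) [^] q = c [^] q \<otimes> e [^] q \<oplus> d [^] q"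
        using cd eh by (simp add: frob_add nat_pow_distrib)
      then have "c [^] q \<otimes> t \<oplus> w = (c \<otimes> e \<oplus> d) [^] q \<otimes> y \<oplus> (c [^] q \<otimes> h \<oplus> g)"
        unfolding eh(3) dg(3) using cl y by simp algebra
      moreover have "c \<otimes> e \<oplus> d \<in> m" using step(1) eh(1) dg(1) m.I_r_closed m.a_closed by blast
      moreover have "c [^] q \<otimes> h \<oplus> g \<in> ?G"
        using span_add[OF NZ] span_smult[OF NZ cd(1)] eh dg by blast
      ultimately show ?case by blast
    qed
    obtain n w where nw: "n \<in> N" "w \<in> bracket m" "y = n \<oplus> w" using full[OF y] by blast
    obtain c g where cg: "c \<in> m" "g \<in> ?G" "w = c [^] q \<otimes> y \<oplus> g" using decomp[OF nw(2)] by blast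
    obtain u where u: "u \<in> carrier R" "u \<otimes> (\<one> \<ominus> c) = \<one>" using one_minus_unit[OF cg(1)] .
    have cc: "c \<in> carrier R" using cg m.Icarr by blast
    have cl: "c [^] q \<in> carrier R" "n \<in> carrier R" "g \<in> carrier R" using cc cg nw N G by auto
    have "(\<one> \<ominus> c) [^] q = \<one> \<ominus> c [^] q" using cc by (simp add: frob_diff)
    then have "(\<one> \<ominus> c) [^] q \<otimes> y = y \<ominus> c [^] q \<otimes> y" using cl y by simp algebra
    also have "\<dots> = (n \<oplus> (c [^] q \<otimes> y \<oplus> g)) \<ominus> c [^] q \<otimes> y" using nw(3) cg(3) by simp
    also have "\<dots> = n \<oplus> g" using cl y by algebra
    finally have *: "(\<one> \<ominus> c) [^] q \<otimes> y = n \<oplus> g" .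
    have "y = (u \<otimes> (\<one> \<ominus> c)) [^] q \<otimes> y" using y u by simp
    also have "\<dots> = u [^] q \<otimes> ((\<one> \<ominus> c) [^] q \<otimes> y)"
      using y u(1) cc by (simp add: nat_pow_distrib m_assoc)
    also have "\<dots> = u [^] q \<otimes> (n \<oplus> g)" unfolding * ..
    also have "\<dots> \<in> ?G"
      using span_smult[OF NZ u(1)] span_add[OF NZ] span_superset[OF NZ] nw(1) cg(2) by blast
    finally have "insert y (N \<union> Z) \<subseteq> ?G" using span_superset[OF NZ] by blast
    then have "span (insert y (N \<union> Z)) \<subseteq> ?G" using span_le_span[OF NZ] by blast
    then show ?case using insert by auto
  qed
  moreover have "span Y \<subseteq> span (N \<union> Y)" by (rule lin_mono) auto
  ultimately show ?thesis using Y_finite Y_carrier Y_span by blast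
qed

section \<open>Bases of the Frobenius pushforward modulo an ideal\<close>

text \<open>The classes of \<open>bs\<close> form a basis of \<open>F\<^sub>*\<^sup>e (R / A)\<close> over \<open>R / A\<close>. Stating this elementwise
  keeps all the quotients that occur in the induction inside one ring.\<close>

definition frob_basis :: "'a set \<Rightarrow> 'a list \<Rightarrow> bool" where
  "frob_basis A bs \<longleftrightarrow> set bs \<subseteq> carrier R \<and> carrier R \<subseteq> span (set bs \<union> A) \<and>
    (\<forall>cs. length cs = length bs \<longrightarrow> set cs \<subseteq> carrier R \<longrightarrow> comb cs bs \<in> A \<longrightarrow> set cs \<subseteq> A)"

abbreviation with_bracket :: "'a set \<Rightarrow> 'a set" where
  "with_bracket A \<equiv> set_add R A (bracket m)"

text \<open>Every nonzero element of \<open>R / (A + m\<^bsup>[q]\<^esup>)\<close> divides the class of \<open>u\<close>; when this class is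
  nonzero, it generates the socle.\<close>

definition socle_gen :: "'a set \<Rightarrow> 'a \<Rightarrow> bool" where
  "socle_gen A u \<longleftrightarrow> (\<forall>y\<in>carrier R. y \<notin> with_bracket A \<longrightarrow>
     (\<exists>z\<in>carrier R. z \<otimes> y \<ominus> u \<in> with_bracket A))"

text \<open>Over the residue field the generators are sifted: one that lies in the span of those
  kept so far is omitted, and any other one keeps the list independent because a coefficient
  outside \<open>m\<close> could be inverted.\<close>

lemma independent_mod_m:
  assumes "set ys \<subseteq> carrier R"
  shows "\<exists>bs. set bs \<subseteq> carrier R \<and> set ys \<subseteq> span (set bs \<union> m) \<and>
    (\<forall>cs. length cs = length bs \<longrightarrow> set cs \<subseteq> carrier R \<longrightarrow> comb cs bs \<in> m \<longrightarrow> set cs \<subseteq> m)"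
  using assms
proof (induction ys)
  case Nil
  show ?case by (intro exI[of _ "[]"]) simp
next
  case (Cons y ys)
  then obtain bs where bs: "set bs \<subseteq> carrier R" "set ys \<subseteq> span (set bs \<union> m)"
    and ind: "\<And>cs. length cs = length bs \<Longrightarrow> set cs \<subseteq> carrier R \<Longrightarrow> comb cs bs \<in> m \<Longrightarrow> set cs \<subseteq> m"
    by auto
  have y: "y \<in> carrier R" using Cons by simp
  have bm: "set bs \<union> m \<subseteq> carrier R" using bs m_sub by blast
  show ?case
  proof (cases "y \<in> span (set bs \<union> m)")
    case True
    then show ?thesis using bs ind by (intro exI[of _ bs]) auto
  next
    case False
    have "set cs \<subseteq> m" if cs: "length cs = length (y # bs)" "set cs \<subseteq> carrier R" "comb cs (y # bs) \<in> m" for cs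
    proof -
      obtain c ds where c: "cs = c # ds" using cs(1) by (cases cs) auto
      have dl: "length ds = length bs" "set ds \<subseteq> carrier R" "c \<in> carrier R" using cs c by auto
      have cl: "c [^] q \<in> carrier R" "comb ds bs \<in> carrier R" using dl comb_closed bs by auto
      have mem: "c [^] q \<otimes> y \<oplus> comb ds bs \<in> m" using cs c by simp
      have "c \<in> m"
      proof (rule ccontr)
        assume "c \<notin> m"
        then have u: "inv c \<in> carrier R" "inv c \<otimes> c = \<one>" using unit dl(3) by auto
        have "comb ds bs \<in> span (set bs \<union> m)"
          using comb_in_span[OF dl(2), of bs] lin_mono[of "carrier R" "carrier R" "set bs" "set bs \<union> m"] by blast
        then have "(c [^] q \<otimes> y \<oplus> comb ds bs) \<oplus> \<ominus> comb ds bs \<in> span (set bs \<union> m)"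
          using mem span_superset[OF bm] span_minus[OF bm] span_add[OF bm] by blast
        moreover have "(c [^] q \<otimes> y \<oplus> comb ds bs) \<oplus> \<ominus> comb ds bs = c [^] q \<otimes> y" using cl y by algebra
        ultimately have "(inv c) [^] q \<otimes> (c [^] q \<otimes> y) \<in> span (set bs \<union> m)"
          using span_smult[OF bm u(1)] by simp
        moreover have "(inv c) [^] q \<otimes> (c [^] q \<otimes> y) = (inv c \<otimes> c) [^] q \<otimes> y"
          using u(1) dl(3) y by (simp add: nat_pow_distrib m_assoc)
        ultimately show False using False u y by simp
      qed
      then have "c [^] q \<otimes> y \<in> m" using frob_in_ideal[OF m.is_ideal] y m.I_r_closed by blast
      then have "\<ominus> (c [^] q \<otimes> y) \<oplus> (c [^] q \<otimes> y \<oplus> comb ds bs) \<in> m" using mem m.a_closed m.a_inv_closed by blast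
      moreover have "\<ominus> (c [^] q \<otimes> y) \<oplus> (c [^] q \<otimes> y \<oplus> comb ds bs) = comb ds bs" using cl y by algebra
      ultimately have "set ds \<subseteq> m" using ind dl by simp
      then show ?thesis using c \<open>c \<in> m\<close> by simp
    qed
    moreover have "set (y # ys) \<subseteq> span (set (y # bs) \<union> m)"
    proof -
      have "span (set bs \<union> m) \<subseteq> span (set (y # bs) \<union> m)" by (rule lin_mono) auto
      moreover have "y \<in> span (set (y # bs) \<union> m)"
        using span_superset[of "set (y # bs) \<union> m"] y bm by auto
      ultimately show ?thesis using bs by auto
    qed
    ultimately show ?thesis using y bs by (intro exI[of _ "y # bs"]) simp
  qed
qed

lemma frob_basis_m: "\<exists>bs. frob_basis m bs \<and> bs \<noteq> [] \<and> socle_gen m (hd bs)"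
proof -
  obtain ys where ys: "set ys = Y" using finite_list[OF Y_finite] by blast
  then obtain bs where bs: "set bs \<subseteq> carrier R" "Y \<subseteq> span (set bs \<union> m)"
    "\<forall>cs. length cs = length bs \<longrightarrow> set cs \<subseteq> carrier R \<longrightarrow> comb cs bs \<in> m \<longrightarrow> set cs \<subseteq> m"
    using independent_mod_m[of ys] Y_carrier by auto
  have bm: "set bs \<union> m \<subseteq> carrier R" using bs m_sub by blast
  have full: "carrier R \<subseteq> span (set bs \<union> m)" using span_le_span[OF bm bs(2)] Y_span by blast
  then have "frob_basis m bs" unfolding frob_basis_def using bs by blast
  moreover have "bs \<noteq> []"
  proof
    assume "bs = []"
    then have "\<one> \<in> span ({} \<union> m)" using full by auto
    then obtain w a where "w \<in> span {}" "a \<in> m" "\<one> = w \<oplus> a"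
      using span_un_ideal[OF m.is_ideal, of "{}" \<one>] by auto
    moreover have "w = \<zero>" using \<open>w \<in> span {}\<close> by (cases rule: lin.cases) auto
    ultimately show False using primeideal_one_notin[OF m_prime] m_sub by auto
  qed
  moreover have "socle_gen m (hd bs)"
    unfolding socle_gen_def
  proof (intro ballI impI)
    fix y assume y: "y \<in> carrier R" "y \<notin> with_bracket m"
    interpret b: ideal "bracket m" R by (rule bracket_ideal[OF m_sub])
    interpret E: ideal "with_bracket m" R by (rule add_ideals[OF m.is_ideal b.is_ideal])
    have "y \<notin> m"
    proof
      assume "y \<in> m"
      moreover have "y = y \<oplus> \<zero>" using y by simp
      ultimately have "y \<in> with_bracket m" unfolding set_add_def' using lin.zero by blast
      then show False using y by blast
    qed
    then have u: "inv y \<in> carrier R" "inv y \<otimes> y = \<one>" using unit y by auto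
    have hc: "hd bs \<in> carrier R" using bs(1) \<open>bs \<noteq> []\<close> by auto
    have "(hd bs \<otimes> inv y) \<otimes> y \<ominus> hd bs = \<zero>" using u hc y by (simp add: m_assoc r_neg a_minus_def)
    then show "\<exists>z\<in>carrier R. z \<otimes> y \<ominus> hd bs \<in> with_bracket m"
      using E.zero_closed u(1) hc by (intro bexI[of _ "hd bs \<otimes> inv y"]) auto
  qed
  ultimately show ?thesis by blast
qed

lemma bracket_m_ideal: "ideal (bracket m) R" by (rule bracket_ideal[OF m_sub])

lemma with_bracket_ideal: "ideal A R \<Longrightarrow> ideal (with_bracket A) R"
  using add_ideals bracket_m_ideal by blast

lemma with_bracketE:
  assumes "y \<in> with_bracket A"
  obtains a w where "a \<in> A" "w \<in> bracket m" "y = a \<oplus> w"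
  using assms unfolding set_add_def' by blast

lemma with_bracketI: "a \<in> A \<Longrightarrow> w \<in> bracket m \<Longrightarrow> a \<oplus> w \<in> with_bracket A"
  unfolding set_add_def' by blast

lemma with_bracket_right: assumes "ideal A R" "w \<in> bracket m" shows "w \<in> with_bracket A"
proof -
  have "w \<in> carrier R" using ideal.Icarr[OF bracket_m_ideal assms(2)] .
  then show ?thesis
    using with_bracketI[OF additive_subgroup.zero_closed[OF ideal.axioms(1)[OF assms(1)]] assms(2)] by simp
qed

lemma with_bracket_adjoin:
  assumes A: "ideal A R" and x: "x \<in> carrier R"
  shows "with_bracket (adjoin A x) = adjoin (with_bracket A) x"
proof
  interpret A: ideal A R by fact
  have bc: "w \<in> carrier R" if "w \<in> bracket m" for w using ideal.Icarr[OF bracket_m_ideal that] .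
  show "with_bracket (adjoin A x) \<subseteq> adjoin (with_bracket A) x"
  proof
    fix y assume "y \<in> with_bracket (adjoin A x)"
    then obtain a r w where *: "a \<in> A" "r \<in> carrier R" "w \<in> bracket m" "y = (a \<oplus> x \<otimes> r) \<oplus> w"
      by (auto elim!: with_bracketE adjoinE)
    have "y = (a \<oplus> w) \<oplus> x \<otimes> r" unfolding *(4) using A.Icarr[OF *(1)] *(2) bc[OF *(3)] x by algebra
    then show "y \<in> adjoin (with_bracket A) x" using adjoinI[OF with_bracketI] * by blast
  qed
  show "adjoin (with_bracket A) x \<subseteq> with_bracket (adjoin A x)"
  proof
    fix y assume "y \<in> adjoin (with_bracket A) x"
    then obtain a r w where *: "a \<in> A" "r \<in> carrier R" "w \<in> bracket m" "y = (a \<oplus> w) \<oplus> x \<otimes> r"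
      by (auto elim!: with_bracketE adjoinE)
    have "y = (a \<oplus> x \<otimes> r) \<oplus> w" unfolding *(4) using A.Icarr[OF *(1)] *(2) bc[OF *(3)] x by algebra
    then show "y \<in> with_bracket (adjoin A x)" using with_bracketI[OF adjoinI] * by blast
  qed
qed

text \<open>Because Frobenius is additive, coefficients \<open>a + x r\<close> with \<open>a \<in> A\<close> contribute \<open>x\<^sup>q r\<^sup>q\<close> modulo
  \<open>A\<close>. This is what lets \<open>x\<^sup>q\<close> be cancelled in a relation.\<close>

lemma comb_adjoin:
  assumes A: "ideal A R" and x: "x \<in> carrier R"
    and "length cs = length bs" "set cs \<subseteq> adjoin A x" "set bs \<subseteq> carrier R"
  shows "\<exists>rs. set rs \<subseteq> carrier R \<and> list_all2 (\<lambda>c r. \<exists>a\<in>A. c = a \<oplus> x \<otimes> r) cs rs \<and>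
      (\<exists>a\<in>A. comb cs bs = a \<oplus> x [^] q \<otimes> comb rs bs)"
  using assms(3-5)
proof (induction cs bs rule: comb.induct)
  case (1 c cs b bs)
  interpret A: ideal A R by fact
  obtain rs a where rs: "set rs \<subseteq> carrier R" "list_all2 (\<lambda>c r. \<exists>a\<in>A. c = a \<oplus> x \<otimes> r) cs rs"
     "a \<in> A" "comb cs bs = a \<oplus> x [^] q \<otimes> comb rs bs" using 1 by auto
  obtain a' r where r: "a' \<in> A" "r \<in> carrier R" "c = a' \<oplus> x \<otimes> r" using 1 by (auto elim: adjoinE)
  have aq: "a' [^] q \<in> A" using frob_in_ideal[OF A r(1)] .
  have b: "b \<in> carrier R" using 1 by simp
  have cl: "a' [^] q \<in> carrier R" "x [^] q \<in> carrier R" "r [^] q \<in> carrier R" "a \<in> carrier R"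
    "comb rs bs \<in> carrier R" using A.Icarr aq x r rs comb_closed 1 by auto
  have "c [^] q = a' [^] q \<oplus> x [^] q \<otimes> r [^] q"
    unfolding r(3) using A.Icarr[OF r(1)] r(2) x by (simp add: frob_add nat_pow_distrib)
  then have "comb (c # cs) (b # bs) = (a' [^] q \<otimes> b \<oplus> a) \<oplus> x [^] q \<otimes> comb (r # rs) (b # bs)"
    unfolding comb.simps rs(4) using cl b by simp algebra
  moreover have "a' [^] q \<otimes> b \<oplus> a \<in> A" using A.a_closed[OF A.I_r_closed[OF aq b] rs(3)] .
  ultimately show ?case using r rs by (intro exI[of _ "r # rs"]) auto
next
  case ("2_1" bs)
  interpret A: ideal A R by fact
  have "\<zero> = \<zero> \<oplus> x [^] q \<otimes> comb [] bs" using x by simp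
  moreover have "cs = []" if "length cs = length ([] :: 'a list)" for cs :: "'a list" using that by simp
  ultimately show ?case using A.zero_closed by (intro exI[of _ "[]"]) auto
next
  case ("2_2" cs)
  interpret A: ideal A R by fact
  have "\<zero> = \<zero> \<oplus> x [^] q \<otimes> comb [] ([] :: 'a list)" using x by simp
  then show ?case using A.zero_closed "2_2" by (intro exI[of _ "[]"]) auto
qed

text \<open>The products \<open>x\<^sup>i b\<close> with \<open>i < n\<close> and \<open>b\<close> in \<open>bs\<close>. The highest power stands first so that the
  future socle generator \<open>x\<^bsup>n-1\<^esup> u\<close> is the head of the list.\<close>

primrec monomial_lift :: "'a \<Rightarrow> 'a list \<Rightarrow> nat \<Rightarrow> 'a list" where
  "monomial_lift x bs 0 = []"
| "monomial_lift x bs (Suc n) = map (\<lambda>b. x \<otimes> b) (monomial_lift x bs n) @ bs"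

lemma monomial_lift_closed:
  "x \<in> carrier R \<Longrightarrow> set bs \<subseteq> carrier R \<Longrightarrow> set (monomial_lift x bs n) \<subseteq> carrier R"
  by (induction n) auto

lemma hd_monomial_lift:
  "x \<in> carrier R \<Longrightarrow> set bs \<subseteq> carrier R \<Longrightarrow> bs \<noteq> [] \<Longrightarrow>
    monomial_lift x bs (Suc n) \<noteq> [] \<and> hd (monomial_lift x bs (Suc n)) = x [^] n \<otimes> hd bs"
proof (induction n)
  case 0
  then have "hd bs \<in> carrier R" by auto
  then show ?case using 0 by simp
next
  case (Suc n)
  then have h: "hd bs \<in> carrier R" by auto
  let ?l = "monomial_lift x bs (Suc n)"
  have l: "?l \<noteq> []" "hd ?l = x [^] n \<otimes> hd bs" using Suc by blast+
  have "monomial_lift x bs (Suc (Suc n)) = map (\<lambda>b. x \<otimes> b) ?l @ bs"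
    by (rule monomial_lift.simps(2))
  moreover have "x \<otimes> (x [^] n \<otimes> hd bs) = x [^] Suc n \<otimes> hd bs"
    using h Suc.prems(1) nat_pow_Suc2[of x n] by (simp add: m_assoc)
  ultimately show ?case using l by (simp add: hd_map del: monomial_lift.simps)
qed

text \<open>Reading a relation modulo \<open>x\<close> shows that the coefficients of the products without a factor
  \<open>x\<close> lie in \<open>A + (x)\<close>. Their contribution is then divisible by \<open>x\<^sup>q\<close>, so one factor \<open>x\<close> can be
  cancelled modulo the prime \<open>A\<close> and the relation becomes shorter. The error terms that arise in
  this way are multiples of \<open>x\<^sup>n\<close>, which is why relations modulo \<open>A + (x\<^sup>n)\<close> are considered.\<close>

lemma monomial_lift_independent:
  assumes A: "primeideal A R" and x: "x \<in> m" "x \<notin> A" and bs: "frob_basis (adjoin A x) bs"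
    and "n \<le> q" "length cs = length (monomial_lift x bs n)" "set cs \<subseteq> carrier R"
    and "comb cs (monomial_lift x bs n) \<in> adjoin A (x [^] n)"
  shows "set cs \<subseteq> adjoin A x"
  using assms(5-8)
proof (induction n arbitrary: cs)
  case (Suc n)
  interpret A: primeideal A R by fact
  have xc: "x \<in> carrier R" using x m.Icarr by blast
  have bsc: "set bs \<subseteq> carrier R" using bs unfolding frob_basis_def by blast
  let ?l = "monomial_lift x bs n"
  have lc: "set ?l \<subseteq> carrier R" using monomial_lift_closed[OF xc bsc] .
  define ds es where "ds = take (length ?l) cs" and "es = drop (length ?l) cs"
  have cs: "cs = ds @ es" "length ds = length ?l" "length es = length bs"
    using Suc.prems by (auto simp: ds_def es_def)
  have dec: "set ds \<subseteq> carrier R" "set es \<subseteq> carrier R" using Suc.prems cs by auto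
  obtain a y where ay: "a \<in> A" "y \<in> carrier R"
    "comb cs (monomial_lift x bs (Suc n)) = a \<oplus> x [^] Suc n \<otimes> y"
    using Suc.prems(4) by (rule adjoinE)
  have "comb cs (monomial_lift x bs (Suc n)) = comb ds (map (\<lambda>b. x \<otimes> b) ?l) \<oplus> comb es bs"
    unfolding cs(1) using cs dec lc bsc xc by (simp, subst comb_append) auto
  also have "comb ds (map (\<lambda>b. x \<otimes> b) ?l) = x \<otimes> comb ds ?l" by (rule comb_map_mult[OF xc dec(1) lc])
  finally have eq: "x \<otimes> comb ds ?l \<oplus> comb es bs = a \<oplus> (x [^] n \<otimes> x) \<otimes> y" using ay(3) by simp
  have cl: "comb ds ?l \<in> carrier R" "comb es bs \<in> carrier R" "a \<in> carrier R" "x [^] n \<in> carrier R"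
    using comb_closed dec lc bsc A.Icarr ay(1) xc by auto
  have "comb es bs = (x \<otimes> comb ds ?l \<oplus> comb es bs) \<ominus> x \<otimes> comb ds ?l" using cl xc by algebra
  also have "\<dots> = a \<oplus> x \<otimes> (x [^] n \<otimes> y \<ominus> comb ds ?l)" unfolding eq using cl xc ay(2) by algebra
  finally have "comb es bs \<in> adjoin A x" using adjoinI[OF ay(1)] cl ay(2) by simp
  then have es: "set es \<subseteq> adjoin A x" using bs cs(3) dec(2) unfolding frob_basis_def by blast
  obtain rs b where rs: "set rs \<subseteq> carrier R" "b \<in> A" "comb es bs = b \<oplus> x [^] q \<otimes> comb rs bs"
    using comb_adjoin[OF A.is_ideal xc cs(3) es bsc] by blast
  obtain k where k: "q = Suc n + k" using Suc.prems(1) le_Suc_ex by blast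
  have xq: "x [^] q = x \<otimes> x [^] n \<otimes> x [^] k"
    unfolding k nat_pow_mult[OF xc, symmetric] nat_pow_Suc using xc cl by algebra
  have cl2: "b \<in> carrier R" "comb rs bs \<in> carrier R" "x [^] k \<in> carrier R"
    using A.Icarr rs(1,2) comb_closed[OF rs(1) bsc] xc by auto
  let ?z = "y \<ominus> x [^] k \<otimes> comb rs bs"
  have zc: "?z \<in> carrier R" using cl2 ay(2) by simp
  have "x \<otimes> (comb ds ?l \<ominus> x [^] n \<otimes> ?z)
      = (x \<otimes> comb ds ?l \<oplus> comb es bs) \<ominus> comb es bs \<ominus> x \<otimes> (x [^] n \<otimes> ?z)"
    using cl zc xc by algebra
  also have "\<dots> = (a \<oplus> (x [^] n \<otimes> x) \<otimes> y) \<ominus> comb es bs \<ominus> x \<otimes> (x [^] n \<otimes> ?z)"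
    unfolding eq ..
  also have "\<dots> = a \<ominus> b" unfolding rs(3) xq using cl cl2 ay(2) xc by algebra
  also have "\<dots> \<in> A" unfolding a_minus_def by (intro A.a_closed A.a_inv_closed ay rs)
  finally have "comb ds ?l \<ominus> x [^] n \<otimes> ?z \<in> A"
    using mult_cancel_mod_prime[OF A xc] x(2) cl zc by simp
  then have "(comb ds ?l \<ominus> x [^] n \<otimes> ?z) \<oplus> x [^] n \<otimes> ?z \<in> adjoin A (x [^] n)"
    using adjoinI zc by blast
  moreover have "(comb ds ?l \<ominus> x [^] n \<otimes> ?z) \<oplus> x [^] n \<otimes> ?z = comb ds ?l" using cl zc by algebra
  ultimately have "set ds \<subseteq> adjoin A x" using Suc.IH[of ds] Suc.prems(1) cs dec by simp
  then show ?case using es cs by simp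
qed simp

lemma monomial_lift_spans:
  assumes A: "ideal A R" and x: "x \<in> carrier R" and bs: "frob_basis (adjoin A x) bs"
    and y: "y \<in> carrier R"
  shows "\<exists>w\<in>span (set (monomial_lift x bs n) \<union> A). \<exists>z\<in>carrier R. y = w \<oplus> x [^] n \<otimes> z"
  using y
proof (induction n arbitrary: y)
  case 0
  have "y = \<zero> \<oplus> x [^] (0::nat) \<otimes> y" using 0 x by simp
  then show ?case using 0 lin.zero by blast
next
  case (Suc n)
  interpret A: ideal A R by fact
  have bsc: "set bs \<subseteq> carrier R" using bs unfolding frob_basis_def by blast
  let ?l = "monomial_lift x bs n" and ?l' = "monomial_lift x bs (Suc n)"
  have lc: "set ?l \<union> A \<subseteq> carrier R" "set ?l' \<union> A \<subseteq> carrier R"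
    using monomial_lift_closed[OF x bsc] A.Icarr by blast+
  have "y \<in> span (set bs \<union> adjoin A x)" using bs Suc.prems unfolding frob_basis_def by blast
  then obtain v a r where v: "v \<in> span (set bs)" "a \<in> A" "r \<in> carrier R" "y = v \<oplus> (a \<oplus> x \<otimes> r)"
    using span_un_ideal[OF adjoin_ideal[OF A x] bsc] by (blast elim: adjoinE)
  obtain w z where wz: "w \<in> span (set ?l \<union> A)" "z \<in> carrier R" "r = w \<oplus> x [^] n \<otimes> z"
    using Suc.IH[OF v(3)] by blast
  have cl: "v \<in> carrier R" "a \<in> carrier R" "w \<in> carrier R" "x [^] n \<in> carrier R"
    using lin_closed[OF _ bsc v(1)] A.Icarr[OF v(2)] lin_closed[OF _ lc(1) wz(1)] x by auto
  have "y = (v \<oplus> a \<oplus> x \<otimes> w) \<oplus> (x [^] n \<otimes> x) \<otimes> z"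
    unfolding v(4) wz(3) using cl x wz(2) by algebra
  moreover have "v \<oplus> a \<oplus> x \<otimes> w \<in> span (set ?l' \<union> A)"
  proof (intro span_add[OF lc(2)])
    show "v \<in> span (set ?l' \<union> A)"
      using v(1) lin_mono[of "carrier R" "carrier R" "set bs" "set ?l' \<union> A"] by auto
    show "a \<in> span (set ?l' \<union> A)" using span_superset[OF lc(2)] v(2) by blast
    show "x \<otimes> w \<in> span (set ?l' \<union> A)"
    proof (rule lin_mult[OF _ lc(1) x _ wz(1)])
      show "x \<otimes> t \<in> set ?l' \<union> A" if "t \<in> set ?l \<union> A" for t
        using that A.I_l_closed[OF _ x] by auto
    qed simp
  qed
  ultimately show ?case using wz(2) by auto
qed

text \<open>The products span modulo \<open>x\<^sup>q\<close>, which suffices by Nakayama's lemma. In a relation all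
  coefficients are divisible by \<open>x\<close> modulo \<open>A\<close>; dividing them by \<open>x\<close> gives a relation again,
  so \<open>krull_descent\<close> puts them into \<open>A\<close>.\<close>

lemma frob_basis_lift:
  assumes A: "primeideal A R" and x: "x \<in> m" "x \<notin> A" and bs: "frob_basis (adjoin A x) bs"
  shows "frob_basis A (monomial_lift x bs q)"
proof -
  interpret A: primeideal A R by fact
  have xc: "x \<in> carrier R" using x m.Icarr by blast
  have bsc: "set bs \<subseteq> carrier R" using bs unfolding frob_basis_def by blast
  let ?l = "monomial_lift x bs q"
  have lc: "set ?l \<subseteq> carrier R" using monomial_lift_closed[OF xc bsc] .
  have lA: "set ?l \<union> A \<subseteq> carrier R" using lc A.Icarr by blast
  have "carrier R \<subseteq> span (set ?l \<union> A)"
  proof (rule span_nakayama)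
    show "span (set ?l \<union> A) \<subseteq> carrier R" using lin_closed[OF _ lA] by blast
    show "span (span (set ?l \<union> A)) \<subseteq> span (set ?l \<union> A)" by (rule span_le_span[OF lA]) simp
    fix y assume "y \<in> carrier R"
    then obtain w z where "w \<in> span (set ?l \<union> A)" "z \<in> carrier R" "y = w \<oplus> x [^] q \<otimes> z"
      using monomial_lift_spans[OF A.is_ideal xc bs, of y q] by blast
    moreover have "x [^] q \<otimes> z \<in> bracket m" using \<open>z \<in> carrier R\<close> x m_sub by (intro lin_single) auto
    ultimately show "\<exists>n\<in>span (set ?l \<union> A). \<exists>w\<in>bracket m. y = n \<oplus> w" by blast
  qed
  moreover have "set cs \<subseteq> A" if cs: "length cs = length ?l" "set cs \<subseteq> carrier R" "comb cs ?l \<in> A" for cs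
  proof -
    let ?Z = "{c. \<exists>cs. length cs = length ?l \<and> set cs \<subseteq> carrier R \<and> comb cs ?l \<in> A \<and> c \<in> set cs}"
    have "?Z \<subseteq> A"
    proof (rule krull_descent[OF A.is_ideal _ x(1)])
      show "?Z \<subseteq> carrier R" by blast
      fix c assume "c \<in> ?Z"
      then obtain cs where cs: "length cs = length ?l" "set cs \<subseteq> carrier R" "comb cs ?l \<in> A" "c \<in> set cs"
        by blast
      have xqc: "x [^] q \<in> carrier R" using xc by simp
      have "comb cs ?l \<in> adjoin A (x [^] q)" using adjoin_superset[OF A.is_ideal xqc] cs(3) by blast
      then have sub: "set cs \<subseteq> adjoin A x"
        by (rule monomial_lift_independent[OF A x bs order_refl cs(1,2)])
      obtain rs a where rs: "set rs \<subseteq> carrier R" "list_all2 (\<lambda>c r. \<exists>a\<in>A. c = a \<oplus> x \<otimes> r) cs rs"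
        "a \<in> A" "comb cs ?l = a \<oplus> x [^] q \<otimes> comb rs ?l"
        using comb_adjoin[OF A.is_ideal xc cs(1) sub lc] by blast
      have rc: "comb rs ?l \<in> carrier R" using comb_closed[OF rs(1) lc] .
      have "x [^] q \<otimes> comb rs ?l = (a \<oplus> x [^] q \<otimes> comb rs ?l) \<oplus> \<ominus> a"
        using rc xqc A.Icarr[OF rs(3)] by algebra
      also have "\<dots> = comb cs ?l \<oplus> \<ominus> a" using rs(4) by simp
      also have "\<dots> \<in> A" by (intro A.a_closed cs A.a_inv_closed rs)
      finally have "comb rs ?l \<in> A"
        using mult_cancel_mod_prime[OF A xqc rc] primeideal_pow_mem[OF A xc] x(2) by blast
      moreover have len: "length rs = length ?l" using rs(2) cs(1) list_all2_lengthD by fastforce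
      moreover obtain i where i: "i < length cs" "c = cs ! i" using cs(4) by (metis in_set_conv_nth)
      moreover have "\<exists>a\<in>A. cs ! i = a \<oplus> x \<otimes> rs ! i" using list_all2_nthD[OF rs(2) i(1)] .
      moreover have "rs ! i \<in> set rs" using i(1) len cs(1) by simp
      ultimately show "\<exists>a\<in>A. \<exists>r\<in>?Z. c = a \<oplus> x \<otimes> r" using rs(1) by blast
    qed
    then show ?thesis using cs by blast
  qed
  ultimately show ?thesis unfolding frob_basis_def using lc by blast
qed

text \<open>Let \<open>x\<^sup>i w\<close> represent \<open>y\<close> with the largest possible exponent \<open>i < q\<close>. Then \<open>w\<close> does not vanish
  modulo \<open>x\<close>, hence some multiple \<open>z w\<close> is \<open>u\<close> modulo \<open>x\<close>, and multiplying by the missing power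
  \<open>x\<^bsup>q-1-i\<^esup>\<close> kills the error term, which is divisible by \<open>x\<^sup>q\<close>.\<close>

lemma socle_gen_lift:
  assumes A: "ideal A R" and x: "x \<in> m" and u: "u \<in> carrier R" and soc: "socle_gen (adjoin A x) u"
    and n: "q = Suc n"
  shows "socle_gen A (x [^] n \<otimes> u)"
  unfolding socle_gen_def
proof (intro ballI impI)
  have xc: "x \<in> carrier R" using x m.Icarr by blast
  let ?E = "with_bracket A"
  interpret E: ideal ?E R by (rule with_bracket_ideal[OF A])
  have xq: "x [^] q \<in> ?E"
  proof -
    have "x [^] q \<otimes> \<one> \<in> bracket m" using x m_sub by (intro lin_single) auto
    then show ?thesis using with_bracket_right[OF A] xc by simp
  qed
  fix y assume y: "y \<in> carrier R" "y \<notin> ?E"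
  define P where "P i \<longleftrightarrow> (\<exists>w\<in>carrier R. \<exists>e\<in>?E. y = e \<oplus> x [^] i \<otimes> w)" for i :: nat
  have "y = \<zero> \<oplus> x [^] (0::nat) \<otimes> y" using y by simp
  then have P0: "P 0" unfolding P_def using E.zero_closed y(1) by blast
  have Pq: "\<not> P q"
  proof
    assume "P q"
    then obtain w e where "w \<in> carrier R" "e \<in> ?E" "y = e \<oplus> x [^] q \<otimes> w" unfolding P_def by blast
    then have "y \<in> ?E" using E.a_closed E.I_r_closed[OF xq] by simp
    then show False using y by blast
  qed
  obtain i where i: "i < q" "P i" "\<not> P (Suc i)"
  proof -
    have "\<exists>i<q. P i \<and> \<not> P (Suc i)" using P0 Pq by (metis dec_induct zero_le)
    then show ?thesis using that by blast
  qed
  obtain w e where we: "w \<in> carrier R" "e \<in> ?E" "y = e \<oplus> x [^] i \<otimes> w" using i(2) unfolding P_def by blast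
  have ec: "e \<in> carrier R" using E.Icarr we by blast
  have xi: "x [^] i \<in> carrier R" using xc by simp
  have "w \<notin> with_bracket (adjoin A x)"
  proof
    assume "w \<in> with_bracket (adjoin A x)"
    then obtain e' r where er: "e' \<in> ?E" "r \<in> carrier R" "w = e' \<oplus> x \<otimes> r"
      unfolding with_bracket_adjoin[OF A xc] by (rule adjoinE)
    have "y = (e \<oplus> x [^] i \<otimes> e') \<oplus> x [^] Suc i \<otimes> r"
      unfolding we(3) er(3) nat_pow_Suc using ec E.Icarr[OF er(1)] er(2) xc xi by algebra
    moreover have "e \<oplus> x [^] i \<otimes> e' \<in> ?E" by (rule E.a_closed[OF we(2) E.I_l_closed[OF er(1) xi]])
    ultimately show False using i(3) er(2) unfolding P_def by blast
  qed
  then obtain z where z: "z \<in> carrier R" "z \<otimes> w \<ominus> u \<in> with_bracket (adjoin A x)"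
    using soc we(1) unfolding socle_gen_def by blast
  then obtain e' r where er: "e' \<in> ?E" "r \<in> carrier R" "z \<otimes> w \<ominus> u = e' \<oplus> x \<otimes> r"
    unfolding with_bracket_adjoin[OF A xc] by (auto elim: adjoinE)
  obtain k where k: "n = k + i" using i(1) n by (metis add.commute le_Suc_ex less_Suc_eq_le)
  have xn: "x [^] n = x [^] k \<otimes> x [^] i" unfolding k using xc by (simp add: nat_pow_mult)
  have xk: "x [^] k \<in> carrier R" "x [^] n \<in> carrier R" using xc by auto
  have xqn: "x [^] q = x [^] n \<otimes> x" unfolding n by simp
  have "(x [^] k \<otimes> z) \<otimes> y \<ominus> x [^] n \<otimes> u
      = (x [^] k \<otimes> z) \<otimes> e \<oplus> x [^] n \<otimes> (z \<otimes> w \<ominus> u)"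
    unfolding we(3) xn using ec we(1) z(1) u xk xi by algebra
  also have "\<dots> = (x [^] k \<otimes> z) \<otimes> e \<oplus> (x [^] n \<otimes> e' \<oplus> x [^] q \<otimes> r)"
    unfolding er(3) xqn using ec E.Icarr[OF er(1)] er(2) z(1) xk xc by algebra
  also have "\<dots> \<in> ?E"
    by (intro E.a_closed E.I_l_closed[OF we(2)] E.I_l_closed[OF er(1)] E.I_r_closed[OF xq] er)
       (use xk z in auto)
  finally show "\<exists>z\<in>carrier R. z \<otimes> y \<ominus> x [^] n \<otimes> u \<in> ?E"
    using xk z(1) by (intro bexI[of _ "x [^] k \<otimes> z"]) auto
qed

text \<open>The induction over a regular system of parameters. The hypotheses say that the ring modulo \<open>A\<close>
  has embedding dimension at most \<open>d\<close> and a chain of primes of length \<open>d\<close>; that \<open>A\<close> is the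
  bottom of every such chain shows in particular that it is prime. In the step, a generator \<open>x\<close>
  outside \<open>P 0\<close> exists because \<open>P 0 \<noteq> m\<close>. After the chain has been moved through \<open>x\<close>, the
  induction hypothesis gives \<open>A + (x) = P' 1\<close>. Every element of \<open>P 0\<close> is therefore divisible by
  \<open>x\<close> modulo \<open>A\<close> with quotient in \<open>P 0\<close> again, whence \<open>P 0 = A\<close>.\<close>

lemma regular_frob_basis:
  assumes "ideal A R" "X \<subseteq> carrier R" "finite X" "card X \<le> d" "Idl (A \<union> X) = m"
    and "\<And>i. i \<le> d \<Longrightarrow> primeideal (P i) R" "\<And>i. i < d \<Longrightarrow> P i \<subset> P (Suc i)" "A \<subseteq> P 0" "P d = m"
  shows "A = P 0 \<and> (\<exists>bs. frob_basis A bs \<and> bs \<noteq> [] \<and> socle_gen A (hd bs))"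
  using assms
proof (induction d arbitrary: A X P)
  case 0
  interpret A: ideal A R by fact
  have "X = {}" using 0 by simp
  then have "m \<subseteq> A" using 0(5) genideal_minimal[OF A.is_ideal order_refl] by simp
  then have "A = m" "P 0 = m" using 0 by auto
  then show ?case using frob_basis_m by simp
next
  case (Suc d)
  interpret A: ideal A R by fact
  have P0: "primeideal (P 0) R" using Suc.prems(6) by simp
  interpret P0: primeideal "P 0" R by fact
  have AX: "A \<union> X \<subseteq> carrier R" using A.Icarr Suc.prems(2) by blast
  have lt: "P 0 \<subset> m"
  proof -
    have "P (Suc 0) \<subseteq> P (Suc k)" if "k \<le> d" for k
      using that
    proof (induction k)
      case (Suc k)
      then show ?case using Suc.prems \<open>\<And>i. i < Suc d \<Longrightarrow> P i \<subset> P (Suc i)\<close>[of "Suc k"] by auto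
    qed simp
    then have "P (Suc 0) \<subseteq> P (Suc d)" by simp
    then show ?thesis using Suc.prems(7)[of 0] Suc.prems(9) by auto
  qed
  have "\<not> X \<subseteq> P 0"
  proof
    assume "X \<subseteq> P 0"
    then have "Idl (A \<union> X) \<subseteq> P 0" using genideal_minimal[OF P0.is_ideal] Suc.prems(8) by simp
    then show False using lt Suc.prems(5) by blast
  qed
  then obtain x where x: "x \<in> X" "x \<notin> P 0" by blast
  have xm: "x \<in> m" using genideal_self[OF AX] x Suc.prems(5) by blast
  have xc: "x \<in> carrier R" using xm m.Icarr by blast
  obtain P' where P': "\<forall>i\<le>Suc d. primeideal (P' i) R" "\<forall>i\<le>d. P' i \<subset> P' (Suc i)"
      "P' 0 = P 0" "P' (Suc d) = m" "x \<in> P' 1"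
    using prime_chain_through[of d P x] Suc.prems(6,7,9) xm by auto
  let ?A = "adjoin A x"
  have idA: "ideal ?A R" by (rule adjoin_ideal[OF A.is_ideal xc])
  have P1: "primeideal (P' 1) R" using P'(1) by simp
  have sub1: "?A \<subseteq> P' 1"
  proof (rule adjoin_minimal)
    show "ideal (P' 1) R" using P1 primeideal.axioms(1) by blast
    have "P' 0 \<subset> P' 1" using P'(2) by simp
    then show "A \<subseteq> P' 1" using Suc.prems(8) P'(3) by simp
    show "x \<in> P' 1" by (rule P'(5))
  qed
  have cup: "?A \<union> (X - {x}) \<subseteq> carrier R" using ideal.Icarr[OF idA] Suc.prems(2) by blast
  have gen: "Idl (?A \<union> (X - {x})) = m"
  proof
    have "?A \<subseteq> m" by (rule adjoin_minimal[OF m.is_ideal _ xm]) (use genideal_self[OF AX] Suc.prems(5) in blast)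
    moreover have "X \<subseteq> m" using genideal_self[OF AX] Suc.prems(5) by blast
    ultimately show "Idl (?A \<union> (X - {x})) \<subseteq> m" by (intro genideal_minimal[OF m.is_ideal]) blast
    have "A \<union> X \<subseteq> ?A \<union> (X - {x})"
      using adjoin_superset[OF A.is_ideal xc] adjoin_mem[OF A.is_ideal xc] by blast
    then have "A \<union> X \<subseteq> Idl (?A \<union> (X - {x}))" using genideal_self[OF cup] by blast
    then show "m \<subseteq> Idl (?A \<union> (X - {x}))"
      unfolding Suc.prems(5)[symmetric] by (rule genideal_minimal[OF genideal_ideal[OF cup]])
  qed
  have "?A = (\<lambda>i. P' (Suc i)) 0 \<and> (\<exists>bs. frob_basis ?A bs \<and> bs \<noteq> [] \<and> socle_gen ?A (hd bs))"
  proof (rule Suc.IH[OF idA _ _ _ gen])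
    show "X - {x} \<subseteq> carrier R" "finite (X - {x})" using Suc.prems by auto
    show "card (X - {x}) \<le> d" using Suc.prems(3,4) x(1) by simp
    show "primeideal (P' (Suc i)) R" if "i \<le> d" for i using P'(1) that by simp
    show "P' (Suc i) \<subset> P' (Suc (Suc i))" if "i < d" for i using P'(2) that by simp
    show "?A \<subseteq> P' (Suc 0)" using sub1 by simp
    show "P' (Suc d) = m" by (rule P'(4))
  qed
  then obtain bs where A1: "?A = P' 1" and bs: "frob_basis ?A bs" "bs \<noteq> []" "socle_gen ?A (hd bs)"
    by auto
  have "P 0 \<subseteq> A"
  proof (rule krull_descent[OF A.is_ideal _ xm])
    show "P 0 \<subseteq> carrier R" using P0.Icarr by blast
    fix c assume c: "c \<in> P 0"
    have "P' 0 \<subset> P' 1" using P'(2) by simp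
    then have "c \<in> ?A" using c A1 P'(3) by blast
    then obtain a r where ar: "a \<in> A" "r \<in> carrier R" "c = a \<oplus> x \<otimes> r" by (rule adjoinE)
    have cl: "a \<in> carrier R" using A.Icarr ar by blast
    have "x \<otimes> r = (a \<oplus> x \<otimes> r) \<oplus> \<ominus> a" using cl xc ar(2) by algebra
    also have "\<dots> = c \<oplus> \<ominus> a" using ar(3) by simp
    also have "\<dots> \<in> P 0" using c ar(1) Suc.prems(8) by (intro P0.a_closed P0.a_inv_closed) auto
    finally have "r \<in> P 0" by (rule mult_cancel_mod_prime[OF P0 xc ar(2) _ x(2)])
    then show "\<exists>a\<in>A. \<exists>r\<in>P 0. c = a \<oplus> x \<otimes> r" using ar by blast
  qed
  then have A0: "A = P 0" using Suc.prems(8) by blast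
  obtain n where n: "q = Suc n" using q_pos by (cases q) auto
  have bsc: "set bs \<subseteq> carrier R" using bs(1) unfolding frob_basis_def by blast
  have hd: "hd bs \<in> carrier R" using bsc bs(2) by auto
  have "frob_basis A (monomial_lift x bs q)"
    using frob_basis_lift[OF P0 xm x(2)] bs(1) unfolding A0 by blast
  moreover have "socle_gen A (hd (monomial_lift x bs q))" "monomial_lift x bs q \<noteq> []"
    using socle_gen_lift[OF A.is_ideal xm hd bs(3) n] hd_monomial_lift[OF xc bsc bs(2), of n] n by auto
  ultimately show ?case using A0 by blast
qed

end

section \<open>Frobenius-linear maps and dual bases\<close>

context frob_cring
begin

text \<open>The linear maps from the Frobenius pushforward to the ring.\<close>

definition cartier_map :: "('a \<Rightarrow> 'a) \<Rightarrow> bool" where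
  "cartier_map \<Phi> \<longleftrightarrow> (\<forall>x\<in>carrier R. \<Phi> x \<in> carrier R) \<and>
    (\<forall>x\<in>carrier R. \<forall>y\<in>carrier R. \<Phi> (x \<oplus> y) = \<Phi> x \<oplus> \<Phi> y) \<and>
    (\<forall>r\<in>carrier R. \<forall>x\<in>carrier R. \<Phi> (r [^] q \<otimes> x) = r \<otimes> \<Phi> x)"

text \<open>The operator \<open>x \<mapsto> \<Sum> \<Phi> (b' x)\<^sup>q b\<close> over the pairs \<open>(b, b')\<close> of the list. If it is the identity,
  then the elements \<open>b\<close> and the functionals \<open>\<Phi> (b' _)\<close> form a dual basis.\<close>

primrec dual_sum :: "('a \<Rightarrow> 'a) \<Rightarrow> ('a \<times> 'a) list \<Rightarrow> 'a \<Rightarrow> 'a" where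
  "dual_sum \<Phi> [] x = \<zero>"
| "dual_sum \<Phi> (bb # bs) x = \<Phi> (snd bb \<otimes> x) [^] q \<otimes> fst bb \<oplus> dual_sum \<Phi> bs x"

lemma cartier_closed: "cartier_map \<Phi> \<Longrightarrow> x \<in> carrier R \<Longrightarrow> \<Phi> x \<in> carrier R"
  unfolding cartier_map_def by blast

lemma cartier_add:
  "cartier_map \<Phi> \<Longrightarrow> x \<in> carrier R \<Longrightarrow> y \<in> carrier R \<Longrightarrow> \<Phi> (x \<oplus> y) = \<Phi> x \<oplus> \<Phi> y"
  unfolding cartier_map_def by blast

lemma cartier_smult:
  "cartier_map \<Phi> \<Longrightarrow> r \<in> carrier R \<Longrightarrow> x \<in> carrier R \<Longrightarrow> \<Phi> (r [^] q \<otimes> x) = r \<otimes> \<Phi> x"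
  unfolding cartier_map_def by blast

lemma cartier_zero: assumes "cartier_map \<Phi>" shows "\<Phi> \<zero> = \<zero>"
  using cartier_smult[OF assms zero_closed zero_closed] cartier_closed[OF assms zero_closed] by simp

lemma cartier_minus:
  assumes "cartier_map \<Phi>" "x \<in> carrier R" shows "\<Phi> (\<ominus> x) = \<ominus> \<Phi> x"
proof -
  have "\<Phi> (\<ominus> x) \<oplus> \<Phi> x = \<Phi> (\<ominus> x \<oplus> x)" using assms by (simp add: cartier_add)
  then have "\<Phi> (\<ominus> x) \<oplus> \<Phi> x = \<zero>" using assms by (simp add: l_neg cartier_zero)
  then show ?thesis
    using cartier_closed[OF assms(1)] assms(2) by (simp add: minus_equality[symmetric])
qed

lemma cartier_diff:
  "cartier_map \<Phi> \<Longrightarrow> x \<in> carrier R \<Longrightarrow> y \<in> carrier R \<Longrightarrow> \<Phi> (x \<ominus> y) = \<Phi> x \<ominus> \<Phi> y"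
  by (simp add: a_minus_def cartier_add cartier_minus)

lemma cartier_bracket:
  assumes \<Phi>: "cartier_map \<Phi>" and K: "ideal K R" and y: "y \<in> bracket K"
  shows "\<Phi> y \<in> K"
  using y
proof induction
  interpret K: ideal K R by fact
  case zero
  then show ?case by (simp add: cartier_zero[OF \<Phi>])
next
  interpret K: ideal K R by fact
  case (step c t y)
  have cl: "c \<in> carrier R" "t \<in> carrier R" using step K.Icarr by auto
  have "bracket K \<subseteq> carrier R" using lin_closed[of K "carrier R"] K.Icarr by blast
  then have yc: "y \<in> carrier R" using step by blast
  have "\<Phi> (c [^] q \<otimes> t \<oplus> y) = c \<otimes> \<Phi> t \<oplus> \<Phi> y"
    using cl yc by (simp add: cartier_add[OF \<Phi>] cartier_smult[OF \<Phi>])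
  also have "\<dots> \<in> K"
    by (rule K.a_closed[OF K.I_r_closed[OF step(1) cartier_closed[OF \<Phi> cl(2)]] step(4)])
  finally show ?case .
qed

context
  fixes \<Phi> assumes \<Phi>: "cartier_map \<Phi>"
begin

lemma dual_sum_closed:
  "set bs \<subseteq> carrier R \<times> carrier R \<Longrightarrow> x \<in> carrier R \<Longrightarrow> dual_sum \<Phi> bs x \<in> carrier R"
  by (induction bs) (auto simp: cartier_closed[OF \<Phi>])

lemma dual_sum_add:
  assumes "set bs \<subseteq> carrier R \<times> carrier R" "x \<in> carrier R" "y \<in> carrier R"
  shows "dual_sum \<Phi> bs (x \<oplus> y) = dual_sum \<Phi> bs x \<oplus> dual_sum \<Phi> bs y"
  using assms
proof (induction bs)
  case (Cons b bs)
  obtain b1 b2 where b: "b = (b1, b2)" "b1 \<in> carrier R" "b2 \<in> carrier R" using Cons by (cases b) auto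
  have cl: "\<Phi> (b2 \<otimes> x) [^] q \<in> carrier R" "\<Phi> (b2 \<otimes> y) [^] q \<in> carrier R"
    "dual_sum \<Phi> bs x \<in> carrier R" "dual_sum \<Phi> bs y \<in> carrier R"
    using Cons.prems b cartier_closed[OF \<Phi>] dual_sum_closed by auto
  have "\<Phi> (b2 \<otimes> (x \<oplus> y)) [^] q = \<Phi> (b2 \<otimes> x) [^] q \<oplus> \<Phi> (b2 \<otimes> y) [^] q"
    using b Cons.prems by (simp add: r_distr cartier_add[OF \<Phi>] frob_add cartier_closed[OF \<Phi>])
  then show ?case using Cons b cl by simp algebra
qed simp

lemma dual_sum_smult:
  assumes "set bs \<subseteq> carrier R \<times> carrier R" "x \<in> carrier R" "r \<in> carrier R"
  shows "dual_sum \<Phi> bs (r [^] q \<otimes> x) = r [^] q \<otimes> dual_sum \<Phi> bs x"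
  using assms
proof (induction bs)
  case (Cons b bs)
  obtain b1 b2 where b: "b = (b1, b2)" "b1 \<in> carrier R" "b2 \<in> carrier R" using Cons by (cases b) auto
  have cl: "\<Phi> (b2 \<otimes> x) [^] q \<in> carrier R" "\<Phi> (b2 \<otimes> x) \<in> carrier R" "r [^] q \<in> carrier R"
    "dual_sum \<Phi> bs x \<in> carrier R"
    using Cons.prems b cartier_closed[OF \<Phi>] dual_sum_closed by auto
  have "b2 \<otimes> (r [^] q \<otimes> x) = r [^] q \<otimes> (b2 \<otimes> x)" using b cl Cons.prems by algebra
  then have "\<Phi> (b2 \<otimes> (r [^] q \<otimes> x)) [^] q = r [^] q \<otimes> \<Phi> (b2 \<otimes> x) [^] q"
    using b Cons.prems cl by (simp add: cartier_smult[OF \<Phi>] nat_pow_distrib)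
  then show ?case using Cons b cl by (simp add: r_distr m_assoc)
qed simp

lemma dual_sum_diff:
  assumes "set bs \<subseteq> carrier R \<times> carrier R" "x \<in> carrier R" "y \<in> carrier R"
  shows "dual_sum \<Phi> bs (x \<ominus> y) = dual_sum \<Phi> bs x \<ominus> dual_sum \<Phi> bs y"
proof -
  have "\<ominus> y = (\<ominus> \<one>) [^] q \<otimes> y" using assms by (simp add: frob_minus l_minus)
  then have "dual_sum \<Phi> bs (\<ominus> y) = \<ominus> dual_sum \<Phi> bs y"
    using dual_sum_smult[OF assms(1,3), of "\<ominus> \<one>"] assms dual_sum_closed
    by (simp add: frob_minus l_minus)
  then show ?thesis using dual_sum_add[OF assms(1,2), of "\<ominus> y"] assms by (simp add: a_minus_def)
qed

text \<open>These operators have adjoints for the form \<open>(z, x) \<mapsto> \<Phi> (z x)\<close>; this is what allows a vector to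
  be made orthogonal to the ones already chosen.\<close>

lemma dual_sum_adjoint:
  assumes "set bs \<subseteq> carrier R \<times> carrier R" "z \<in> carrier R"
  shows "\<exists>z'\<in>carrier R. \<forall>x\<in>carrier R. \<Phi> (z \<otimes> dual_sum \<Phi> bs x) = \<Phi> (z' \<otimes> x)"
  using assms
proof (induction bs)
  case Nil
  then show ?case by (intro bexI[of _ \<zero>]) (auto simp: cartier_zero[OF \<Phi>])
next
  case (Cons b bs)
  obtain b1 b2 where b: "b = (b1, b2)" "b1 \<in> carrier R" "b2 \<in> carrier R" using Cons by (cases b) auto
  obtain w where w: "w \<in> carrier R" "\<And>x. x \<in> carrier R \<Longrightarrow> \<Phi> (z \<otimes> dual_sum \<Phi> bs x) = \<Phi> (w \<otimes> x)"
    using Cons by auto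
  let ?c = "\<Phi> (z \<otimes> b1)"
  have c: "?c \<in> carrier R" "?c [^] q \<in> carrier R" using cartier_closed[OF \<Phi>] b Cons.prems by auto
  show ?case
  proof (intro bexI ballI)
    show "?c [^] q \<otimes> b2 \<oplus> w \<in> carrier R" using c b w by simp
    fix x assume x: "x \<in> carrier R"
    have cl: "\<Phi> (b2 \<otimes> x) [^] q \<in> carrier R" "\<Phi> (b2 \<otimes> x) \<in> carrier R" "dual_sum \<Phi> bs x \<in> carrier R"
      using cartier_closed[OF \<Phi>] b x Cons.prems dual_sum_closed by auto
    have "z \<otimes> dual_sum \<Phi> (b # bs) x = \<Phi> (b2 \<otimes> x) [^] q \<otimes> (z \<otimes> b1) \<oplus> z \<otimes> dual_sum \<Phi> bs x"
      unfolding b dual_sum.simps fst_conv snd_conv using cl b Cons.prems(2) by algebra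
    then have "\<Phi> (z \<otimes> dual_sum \<Phi> (b # bs) x) = \<Phi> (b2 \<otimes> x) \<otimes> ?c \<oplus> \<Phi> (w \<otimes> x)"
      using cl b Cons.prems(2) w(2)[OF x] by (simp add: cartier_add[OF \<Phi>] cartier_smult[OF \<Phi>])
    also have "\<dots> = ?c \<otimes> \<Phi> (b2 \<otimes> x) \<oplus> \<Phi> (w \<otimes> x)" using m_comm[OF cl(2) c(1)] by simp
    also have "\<dots> = \<Phi> (?c [^] q \<otimes> (b2 \<otimes> x) \<oplus> w \<otimes> x)"
      using c b x w(1) by (simp add: cartier_add[OF \<Phi>] cartier_smult[OF \<Phi>])
    also have "?c [^] q \<otimes> (b2 \<otimes> x) \<oplus> w \<otimes> x = (?c [^] q \<otimes> b2 \<oplus> w) \<otimes> x" using c b x w by algebra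
    finally show "\<Phi> (z \<otimes> dual_sum \<Phi> (b # bs) x) = \<Phi> ((?c [^] q \<otimes> b2 \<oplus> w) \<otimes> x)" .
  qed
qed

end
end

context local_frob
begin

text \<open>The coordinate belonging to the first basis vector.\<close>

lemma coordinate_cartier_map:
  assumes bs: "frob_basis {\<zero>} bs" "bs \<noteq> []"
  shows "\<exists>\<Phi>. cartier_map \<Phi> \<and> \<Phi> (hd bs) = \<one>"
proof -
  have bsc: "set bs \<subseteq> carrier R" using bs unfolding frob_basis_def by blast
  define rep where "rep y cs \<longleftrightarrow> length cs = length bs \<and> set cs \<subseteq> carrier R \<and> comb cs bs = y" for y cs
  have ex: "\<exists>cs. rep y cs" if y: "y \<in> carrier R" for y
  proof -
    have "y \<in> span (set bs \<union> {\<zero>})" using bs y unfolding frob_basis_def by blast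
    then obtain w where "w \<in> span (set bs)" "y = w \<oplus> \<zero>"
      using span_un_ideal[OF zeroideal bsc] by blast
    moreover from this have "w \<in> carrier R" using lin_closed[OF _ bsc] by blast
    ultimately show ?thesis using span_imp_comb[OF bsc] unfolding rep_def by fastforce
  qed
  have rep_add: "rep (y \<oplus> z) (map2 (\<lambda>c d. c \<oplus> d) cs ds)" if "rep y cs" "rep z ds" for y z cs ds
  proof -
    have "set (map2 (\<lambda>c d. c \<oplus> d) cs ds) \<subseteq> carrier R"
      using that unfolding rep_def by (auto elim!: in_set_zipE)
    then show ?thesis using that comb_add[OF _ _ _ _ bsc, of cs ds] unfolding rep_def by auto
  qed
  have rep_smult: "rep (r [^] q \<otimes> y) (map (\<lambda>c. r \<otimes> c) cs)" if "rep y cs" "r \<in> carrier R" for y r cs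
    using that comb_smult[of cs bs r] bsc unfolding rep_def by auto
  have uniq: "cs = ds" if "rep y cs" "rep y ds" for y cs ds
  proof -
    let ?es = "map2 (\<lambda>c d. c \<oplus> d) cs (map (\<lambda>c. (\<ominus> \<one>) \<otimes> c) ds)"
    have yc: "y \<in> carrier R" using that(1) comb_closed bsc unfolding rep_def by blast
    have "rep (y \<oplus> (\<ominus> \<one>) [^] q \<otimes> y) ?es" using rep_add[OF that(1) rep_smult[OF that(2)]] by simp
    moreover have "y \<oplus> (\<ominus> \<one>) [^] q \<otimes> y = \<zero>" using yc by (simp add: frob_minus l_minus r_neg)
    ultimately have "rep \<zero> ?es" by simp
    then have es: "length ?es = length bs" "set ?es \<subseteq> carrier R" "comb ?es bs \<in> {\<zero>}"
      unfolding rep_def by blast+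
    have "\<forall>cs. length cs = length bs \<longrightarrow> set cs \<subseteq> carrier R \<longrightarrow> comb cs bs \<in> {\<zero>} \<longrightarrow> set cs \<subseteq> {\<zero>}"
      using bs(1) unfolding frob_basis_def by blast
    from this[rule_format, OF es] have "set ?es \<subseteq> {\<zero>}" .
    have len: "length cs = length ds" using that unfolding rep_def by simp
    show ?thesis
    proof (rule nth_equalityI[OF len])
      fix i assume i: "i < length cs"
      then have mem: "cs ! i \<in> carrier R" "ds ! i \<in> carrier R" using that len unfolding rep_def by auto
      have "?es ! i \<in> set ?es" using i len by (intro nth_mem) simp
      then have "?es ! i = \<zero>" using \<open>set ?es \<subseteq> {\<zero>}\<close> by blast
      then have "cs ! i \<oplus> (\<ominus> \<one>) \<otimes> ds ! i = \<zero>" using i len by simp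
      then have "cs ! i \<ominus> ds ! i = \<zero>" using mem by (simp add: l_minus a_minus_def)
      then show "cs ! i = ds ! i" using mem by (simp add: r_right_minus_eq)
    qed
  qed
  define \<Phi> where "\<Phi> y = hd (SOME cs. rep y cs)" for y
  have \<Phi>: "\<Phi> y = hd cs" if "rep y cs" for y cs
    unfolding \<Phi>_def using uniq[OF that someI[of "rep y", OF that]] by simp
  have hdc: "hd cs \<in> carrier R" "cs \<noteq> []" if "rep y cs" for y cs
    using that bs(2) unfolding rep_def by (cases cs; auto)+
  have "cartier_map \<Phi>"
    unfolding cartier_map_def
  proof (intro conjI ballI)
    fix x assume x: "x \<in> carrier R"
    then obtain cs where cs: "rep x cs" using ex by blast
    then show "\<Phi> x \<in> carrier R" using \<Phi> hdc by simp
    show "\<Phi> (x \<oplus> y) = \<Phi> x \<oplus> \<Phi> y" if y: "y \<in> carrier R" for y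
    proof -
      obtain ds where ds: "rep y ds" using ex[OF y] by blast
      have "hd (map2 (\<lambda>c d. c \<oplus> d) cs ds) = hd cs \<oplus> hd ds"
        using hdc(2)[OF cs] hdc(2)[OF ds] by (cases cs; cases ds) auto
      then show ?thesis using \<Phi>[OF rep_add[OF cs ds]] \<Phi>[OF cs] \<Phi>[OF ds] by simp
    qed
  next
    fix r x assume "r \<in> carrier R" "x \<in> carrier R"
    moreover from this obtain cs where cs: "rep x cs" using ex by blast
    ultimately show "\<Phi> (r [^] q \<otimes> x) = r \<otimes> \<Phi> x"
      using \<Phi>[OF rep_smult[OF cs]] \<Phi>[OF cs] hdc(2)[OF cs] by (simp add: hd_map)
  qed
  moreover have "\<Phi> (hd bs) = \<one>"
  proof -
    obtain b l where b: "bs = b # l" using bs(2) by (cases bs) auto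
    have "comb (replicate (length l) \<zero>) l = \<zero>" using bsc unfolding b
      by (induction l) (auto simp: frob_zero)
    then have "rep b (\<one> # replicate (length l) \<zero>)" using bsc unfolding rep_def b by auto
    then show ?thesis using \<Phi> b by fastforce
  qed
  ultimately show ?thesis by blast
qed

text \<open>The operator \<open>g\<close> belonging to the list is the orthogonal projection onto the part already
  treated. If the component \<open>y - g y\<close> of the next vector does not vanish modulo \<open>m\<^bsup>[q]\<^esup>\<close>, then
  nondegeneracy provides \<open>z\<close> pairing to \<open>1\<close> with it, and the rank-one operator
  with functional \<open>x \<mapsto> \<Phi> (z (x - g x))\<close> and value \<open>y - g y\<close> is added to \<open>g\<close>. The adjoint \<open>w\<close> of \<open>z\<close> writes this
  functional as \<open>\<Phi> ((z - w) _)\<close>. Only idempotence of \<open>g\<close> has to be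
  maintained, so no indices of an orthonormal system appear.\<close>

lemma gram_schmidt:
  assumes \<Phi>: "cartier_map \<Phi>"
    and nondeg: "\<And>y. y \<in> carrier R \<Longrightarrow> y \<notin> bracket m \<Longrightarrow> \<exists>z\<in>carrier R. \<Phi> (z \<otimes> y) = \<one>"
    and "set ys \<subseteq> carrier R"
  shows "\<exists>bs. set bs \<subseteq> carrier R \<times> carrier R \<and>
    (\<forall>x\<in>carrier R. dual_sum \<Phi> bs (dual_sum \<Phi> bs x) = dual_sum \<Phi> bs x) \<and>
    (\<forall>y\<in>set ys. y \<ominus> dual_sum \<Phi> bs y \<in> bracket m)"
  using assms(3)
proof (induction ys)
  case Nil
  show ?case by (intro exI[of _ "[]"]) simp
next
  case (Cons y ys)
  then obtain bs where bs: "set bs \<subseteq> carrier R \<times> carrier R"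
      "\<And>x. x \<in> carrier R \<Longrightarrow> dual_sum \<Phi> bs (dual_sum \<Phi> bs x) = dual_sum \<Phi> bs x"
      "\<And>y. y \<in> set ys \<Longrightarrow> y \<ominus> dual_sum \<Phi> bs y \<in> bracket m"
    by auto
  interpret B: ideal "bracket m" R by (rule bracket_m_ideal)
  let ?g = "dual_sum \<Phi> bs"
  note gc = dual_sum_closed[OF \<Phi> bs(1)] and gdiff = dual_sum_diff[OF \<Phi> bs(1)]
    and gadd = dual_sum_add[OF \<Phi> bs(1)] and gsm = dual_sum_smult[OF \<Phi> bs(1)]
  have yc: "y \<in> carrier R" using Cons by simp
  show ?case
  proof (cases "y \<ominus> ?g y \<in> bracket m")
    case True
    then show ?thesis using bs by (intro exI[of _ bs]) auto
  next
    case False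
    let ?y = "y \<ominus> ?g y"
    have y'c: "?y \<in> carrier R" using yc gc by simp
    obtain z where z: "z \<in> carrier R" "\<Phi> (z \<otimes> ?y) = \<one>" using nondeg[OF y'c False] by blast
    obtain w where w: "w \<in> carrier R" "\<And>x. x \<in> carrier R \<Longrightarrow> \<Phi> (z \<otimes> ?g x) = \<Phi> (w \<otimes> x)"
      using dual_sum_adjoint[OF \<Phi> bs(1) z(1)] by blast
    let ?f = "\<lambda>x. \<Phi> ((z \<ominus> w) \<otimes> x)"
    have f: "?f x = \<Phi> (z \<otimes> (x \<ominus> ?g x))" if x: "x \<in> carrier R" for x
    proof -
      have "?f x = \<Phi> (z \<otimes> x \<ominus> w \<otimes> x)" using z w x by algebra
      also have "\<dots> = \<Phi> (z \<otimes> x \<ominus> z \<otimes> ?g x)"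
        using w(2)[OF x] z w(1) x gc by (simp add: cartier_diff[OF \<Phi>])
      also have "z \<otimes> x \<ominus> z \<otimes> ?g x = z \<otimes> (x \<ominus> ?g x)" using z x gc[OF x] by algebra
      finally show ?thesis .
    qed
    have fc: "?f x \<in> carrier R" if "x \<in> carrier R" for x
      using that z w cartier_closed[OF \<Phi>] by simp
    let ?bs = "(?y, z \<ominus> w) # bs"
    let ?h = "dual_sum \<Phi> ?bs"
    have h: "?h x = ?f x [^] q \<otimes> ?y \<oplus> ?g x" for x by simp
    have gy': "?g ?y = \<zero>" using gdiff[OF yc gc[OF yc]] bs(2)[OF yc] gc[OF yc] by (simp add: r_neg a_minus_def)
    have fg: "?f (?g x) = \<zero>" if x: "x \<in> carrier R" for x
    proof -
      have "?g x \<ominus> ?g (?g x) = \<zero>" using bs(2)[OF x] gc[OF x] by (simp add: r_neg a_minus_def)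
      then show ?thesis using f[OF gc[OF x]] z by (simp add: cartier_zero[OF \<Phi>])
    qed
    have fy': "?f ?y = \<one>"
    proof -
      have "?y \<ominus> ?g ?y = ?y" unfolding gy' using y'c by algebra
      then show ?thesis using f[OF y'c] z by simp
    qed
    have fh: "?f (?h x) = ?f x" if x: "x \<in> carrier R" for x
    proof -
      have "?f (?h x) = \<Phi> (?f x [^] q \<otimes> ((z \<ominus> w) \<otimes> ?y) \<oplus> (z \<ominus> w) \<otimes> ?g x)"
      proof -
        have "?f x [^] q \<in> carrier R" "z \<ominus> w \<in> carrier R" using fc[OF x] z w by auto
        then have "(z \<ominus> w) \<otimes> ?h x = ?f x [^] q \<otimes> ((z \<ominus> w) \<otimes> ?y) \<oplus> (z \<ominus> w) \<otimes> ?g x"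
          unfolding h using y'c gc[OF x] by (simp add: r_distr m_lcomm)
        then show ?thesis by simp
      qed
      also have "\<dots> = ?f x \<otimes> ?f ?y \<oplus> ?f (?g x)"
      proof -
        have "z \<ominus> w \<in> carrier R" using z w by simp
        then show ?thesis using fc[OF x] y'c gc[OF x]
          by (simp add: cartier_add[OF \<Phi>] cartier_smult[OF \<Phi>])
      qed
      also have "\<dots> = ?f x" using fc[OF x] fy' fg[OF x] by simp
      finally show ?thesis .
    qed
    have gh: "?g (?h x) = ?g x" if x: "x \<in> carrier R" for x
      using gadd[of "?f x [^] q \<otimes> ?y" "?g x"] gsm[OF y'c fc[OF x]] gy' fc[OF x] y'c gc[OF x] bs(2)[OF x]
      unfolding h by simp
    have hh: "?h (?h x) = ?h x" if x: "x \<in> carrier R" for x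
      unfolding h[of "?h x"] fh[OF x] gh[OF x] by (rule h[symmetric])
    have resid: "x \<ominus> ?h x = (x \<ominus> ?g x) \<ominus> ?f x [^] q \<otimes> ?y" if x: "x \<in> carrier R" for x
    proof -
      have "?f x [^] q \<otimes> ?y \<in> carrier R" using fc[OF x] y'c by simp
      then show ?thesis unfolding h using x gc[OF x] by algebra
    qed
    have "v \<ominus> ?h v \<in> bracket m" if v: "v \<in> set (y # ys)" for v
    proof (cases "v = y")
      case True
      have "?f y = \<one>" using f[OF yc] z by simp
      then have "y \<ominus> ?h y = \<zero>" using resid[OF yc] y'c by (simp add: r_neg a_minus_def)
      then show ?thesis using True B.zero_closed by simp
    next
      case False
      then have v': "v \<in> set ys" "v \<in> carrier R" using v Cons.prems by auto
      have r: "v \<ominus> ?g v \<in> bracket m" using bs(3)[OF v'(1)] .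
      have "?f v \<in> m"
        unfolding f[OF v'(2)] by (rule cartier_bracket[OF \<Phi> m.is_ideal B.I_l_closed[OF r z(1)]])
      then have "?f v [^] q \<otimes> ?y \<in> bracket m" by (intro lin_single[OF m_sub _ _ y'c]) auto
      then have "(v \<ominus> ?g v) \<oplus> \<ominus> (?f v [^] q \<otimes> ?y) \<in> bracket m"
        by (rule B.a_closed[OF r B.a_inv_closed])
      then show ?thesis unfolding resid[OF v'(2)] by (simp only: a_minus_def[of R "v \<ominus> ?g v"])
    qed
    moreover have "set ?bs \<subseteq> carrier R \<times> carrier R" using bs(1) y'c z w by simp
    ultimately show ?thesis using hh by (intro exI[of _ ?bs]) blast
  qed
qed

text \<open>For \<open>y\<close> outside \<open>m\<^bsup>[q]\<^esup>\<close> the socle property makes some \<open>z y\<close> congruent to the socle generator,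
  on which the coordinate map \<open>\<Phi>\<close> takes the value \<open>1\<close>; so \<open>\<Phi> (z y)\<close> is a unit and the form is
  nondegenerate. The Gram--Schmidt projection of a generating set is then the identity
  modulo \<open>m\<^bsup>[q]\<^esup>\<close>, hence surjective by Nakayama's lemma, and an idempotent surjection is the
  identity.\<close>

lemma dual_basis_of_frob_basis:
  assumes bs: "frob_basis {\<zero>} bs" "bs \<noteq> []" "socle_gen {\<zero>} (hd bs)"
  shows "\<exists>\<Phi> ds. cartier_map \<Phi> \<and> set ds \<subseteq> carrier R \<times> carrier R \<and>
    (\<forall>x\<in>carrier R. dual_sum \<Phi> ds x = x)"
proof -
  obtain \<Phi> where \<Phi>: "cartier_map \<Phi>" "\<Phi> (hd bs) = \<one>" using coordinate_cartier_map[OF bs(1,2)] by blast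
  have hc: "hd bs \<in> carrier R" using bs unfolding frob_basis_def by auto
  interpret B: ideal "bracket m" R by (rule bracket_m_ideal)
  have w0: "w \<in> with_bracket {\<zero>} \<longleftrightarrow> w \<in> bracket m" for w
    using B.Icarr by (auto simp: set_add_def')
  have nondeg: "\<exists>z\<in>carrier R. \<Phi> (z \<otimes> y) = \<one>" if y: "y \<in> carrier R" "y \<notin> bracket m" for y
  proof -
    obtain z where z: "z \<in> carrier R" "z \<otimes> y \<ominus> hd bs \<in> bracket m"
      using bs(3) y w0 unfolding socle_gen_def by blast
    let ?c = "\<Phi> (hd bs \<ominus> z \<otimes> y)"
    have "hd bs \<ominus> z \<otimes> y = \<ominus> (z \<otimes> y \<ominus> hd bs)" using hc z(1) y by algebra
    then have "hd bs \<ominus> z \<otimes> y \<in> bracket m" using B.a_inv_closed[OF z(2)] by simp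
    then have c: "?c \<in> m" by (rule cartier_bracket[OF \<Phi>(1) m.is_ideal])
    obtain u where u: "u \<in> carrier R" "u \<otimes> (\<one> \<ominus> ?c) = \<one>" by (rule one_minus_unit[OF c])
    have zy: "\<Phi> (z \<otimes> y) \<in> carrier R" using cartier_closed[OF \<Phi>(1)] z y by simp
    have "?c = \<one> \<ominus> \<Phi> (z \<otimes> y)" using hc z(1) y(1) \<Phi> by (simp add: cartier_diff)
    then have "\<one> \<ominus> ?c = \<Phi> (z \<otimes> y)" using zy by simp algebra
    moreover have "\<Phi> ((u [^] q \<otimes> z) \<otimes> y) = u \<otimes> \<Phi> (z \<otimes> y)"
      using cartier_smult[OF \<Phi>(1) u(1), of "z \<otimes> y"] u(1) z(1) y(1) by (simp add: m_assoc)
    ultimately have "\<Phi> ((u [^] q \<otimes> z) \<otimes> y) = \<one>" using u(2) by simp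
    then show ?thesis using u(1) z(1) by (intro bexI[of _ "u [^] q \<otimes> z"]) auto
  qed
  obtain ys where ys: "set ys = Y" using finite_list[OF Y_finite] by blast
  then obtain ds where ds: "set ds \<subseteq> carrier R \<times> carrier R"
      "\<And>x. x \<in> carrier R \<Longrightarrow> dual_sum \<Phi> ds (dual_sum \<Phi> ds x) = dual_sum \<Phi> ds x"
      "\<And>y. y \<in> Y \<Longrightarrow> y \<ominus> dual_sum \<Phi> ds y \<in> bracket m"
    using gram_schmidt[OF \<Phi>(1) nondeg, of ys] Y_carrier by auto
  let ?g = "dual_sum \<Phi> ds"
  note gc = dual_sum_closed[OF \<Phi>(1) ds(1)] and gadd = dual_sum_add[OF \<Phi>(1) ds(1)]
    and gsm = dual_sum_smult[OF \<Phi>(1) ds(1)]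
  have g0: "?g \<zero> = \<zero>" using gsm[OF zero_closed zero_closed] gc[OF zero_closed] by (simp add: frob_zero)
  have "span Y \<subseteq> {x \<in> carrier R. x \<ominus> ?g x \<in> bracket m}"
  proof (rule lin_least)
    show "\<zero> \<in> {x \<in> carrier R. x \<ominus> ?g x \<in> bracket m}"
      using g0 lin.zero by (simp add: a_minus_def)
  next
    fix c t assume c: "c \<in> carrier R" "t \<in> Y"
    then have t: "t \<in> carrier R" using Y_carrier by blast
    have "c [^] q \<in> carrier R" using c by simp
    then have "c [^] q \<otimes> t \<ominus> ?g (c [^] q \<otimes> t) = c [^] q \<otimes> (t \<ominus> ?g t)"
      unfolding gsm[OF t c(1)] using t gc[OF t] by algebra
    then show "c [^] q \<otimes> t \<in> {x \<in> carrier R. x \<ominus> ?g x \<in> bracket m}"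
      using B.I_l_closed[OF ds(3)[OF c(2)], of "c [^] q"] c(1) t by simp
  next
    fix a b assume *: "a \<in> {x \<in> carrier R. x \<ominus> ?g x \<in> bracket m}" "b \<in> {x \<in> carrier R. x \<ominus> ?g x \<in> bracket m}"
    then have ab: "a \<in> carrier R" "b \<in> carrier R" by auto
    have "(a \<oplus> b) \<ominus> ?g (a \<oplus> b) = (a \<ominus> ?g a) \<oplus> (b \<ominus> ?g b)"
      unfolding gadd[OF ab] using ab gc[OF ab(1)] gc[OF ab(2)] by algebra
    then show "a \<oplus> b \<in> {x \<in> carrier R. x \<ominus> ?g x \<in> bracket m}" using * B.a_closed ab by simp
  qed
  then have res: "x \<ominus> ?g x \<in> bracket m" if "x \<in> carrier R" for x using Y_span that by blast
  let ?N = "?g ` carrier R"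
  have N: "?N \<subseteq> carrier R" using gc by blast
  have "carrier R \<subseteq> ?N"
  proof (rule span_nakayama[OF N])
    show "span ?N \<subseteq> ?N"
    proof (rule lin_least)
      show "\<zero> \<in> ?N" using g0 by (metis imageI zero_closed)
      show "c [^] q \<otimes> t \<in> ?N" if "c \<in> carrier R" "t \<in> ?N" for c t
        using that gsm[symmetric] by auto
      show "a \<oplus> b \<in> ?N" if "a \<in> ?N" "b \<in> ?N" for a b using that gadd[symmetric] by auto
    qed
    fix y assume y: "y \<in> carrier R"
    have "y = ?g y \<oplus> (y \<ominus> ?g y)" using y gc[OF y] by algebra
    then show "\<exists>n\<in>?N. \<exists>w\<in>bracket m. y = n \<oplus> w" using res[OF y] y by blast
  qed
  then have "?g x = x" if "x \<in> carrier R" for x using that ds(2) by blast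
  then show ?thesis using \<Phi>(1) ds(1) by blast
qed

end

section \<open>Frobenius in prime characteristic\<close>

context cring
begin

text \<open>\<open>\<Sum> c k * a\<^sup>k * b\<^bsup>n-k\<^esup>\<close> over \<open>k \<le> n\<close>, by a Horner scheme in \<open>b\<close>. It allows the
  binomial theorem to be proved without reindexing sums.\<close>

primrec binary_form :: "'a \<Rightarrow> 'a \<Rightarrow> nat \<Rightarrow> (nat \<Rightarrow> nat) \<Rightarrow> 'a" where
  "binary_form a b 0 c = add_pow R (c 0) \<one>"
| "binary_form a b (Suc n) c = b \<otimes> binary_form a b n c \<oplus> add_pow R (c (Suc n)) (a [^] Suc n)"

context
  fixes a b assumes a: "a \<in> carrier R" and b: "b \<in> carrier R"
begin

lemma binary_form_closed: "binary_form a b n c \<in> carrier R"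
  using a b by (induction n) auto

lemma binary_form_add:
  "binary_form a b n (\<lambda>k. c k + d k) = binary_form a b n c \<oplus> binary_form a b n d"
proof (induction n)
  case 0
  then show ?case by (simp add: add.nat_pow_mult[symmetric])
next
  case (Suc n)
  have cl: "add_pow R (c (Suc n)) (a [^] Suc n) \<in> carrier R" "add_pow R (d (Suc n)) (a [^] Suc n) \<in> carrier R"
    using a by auto
  have "add_pow R (c (Suc n) + d (Suc n)) (a [^] Suc n)
      = add_pow R (c (Suc n)) (a [^] Suc n) \<oplus> add_pow R (d (Suc n)) (a [^] Suc n)"
    using a by (intro add.nat_pow_mult[symmetric]) simp
  then show ?case unfolding binary_form.simps Suc.IH
    using cl binary_form_closed b by (simp only:) algebra
qed

lemma binary_form_shift:
  "a \<otimes> binary_form a b n c = binary_form a b (Suc n) (\<lambda>k. case k of 0 \<Rightarrow> 0 | Suc k \<Rightarrow> c k)"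
proof (induction n)
  case 0
  then show ?case using a b by (simp add: add_pow_rdistr)
next
  case (Suc n)
  let ?s = "\<lambda>k. case k of 0 \<Rightarrow> 0 | Suc k \<Rightarrow> c k"
  have cl: "add_pow R (c (Suc n)) (a [^] Suc n) \<in> carrier R" using a by auto
  have "a \<otimes> binary_form a b (Suc n) c
      = b \<otimes> (a \<otimes> binary_form a b n c) \<oplus> a \<otimes> add_pow R (c (Suc n)) (a [^] Suc n)"
    unfolding binary_form.simps using cl a b binary_form_closed by algebra
  also have "a \<otimes> add_pow R (c (Suc n)) (a [^] Suc n) = add_pow R (c (Suc n)) (a [^] Suc (Suc n))"
    using a by (simp add: add_pow_rdistr m_comm)
  finally show ?case unfolding Suc.IH by simp
qed

lemma binomial_expansion: "(a \<oplus> b) [^] n = binary_form a b n (\<lambda>k. n choose k)"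
proof (induction n)
  case 0
  then show ?case by simp
next
  case (Suc n)
  let ?c = "\<lambda>k. n choose k"
  have "binary_form a b (Suc n) ?c = b \<otimes> binary_form a b n ?c \<oplus> \<zero>"
    unfolding binary_form.simps using a by (simp add: binomial_eq_0)
  then have bc: "binary_form a b (Suc n) ?c = b \<otimes> binary_form a b n ?c"
    using b binary_form_closed by simp
  have "(a \<oplus> b) [^] Suc n = a \<otimes> binary_form a b n ?c \<oplus> b \<otimes> binary_form a b n ?c"
    unfolding nat_pow_Suc Suc using a b binary_form_closed by algebra
  also have "\<dots> = binary_form a b (Suc n) (\<lambda>k. (case k of 0 \<Rightarrow> 0 | Suc k \<Rightarrow> ?c k) + ?c k)"
    unfolding binary_form_shift bc[symmetric] binary_form_add ..
  also have "(\<lambda>k. (case k of 0 \<Rightarrow> 0 | Suc k \<Rightarrow> ?c k) + ?c k) = (\<lambda>k. Suc n choose k)"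
    by (auto simp: fun_eq_iff split: nat.splits)
  finally show ?case .
qed

end

lemma freshmans_dream:
  assumes p: "Factorial_Ring.prime (p::nat)" and char: "add_pow R p \<one> = \<zero>"
    and a: "a \<in> carrier R" and b: "b \<in> carrier R"
  shows "(a \<oplus> b) [^] p = a [^] p \<oplus> b [^] p"
proof -
  have kill: "add_pow R n x = \<zero>" if dvd: "p dvd n" and x: "x \<in> carrier R" for n :: nat and x
  proof -
    obtain k where n: "n = p * k" using dvd by (rule dvdE)
    have "add_pow R p x = add_pow R p \<one> \<otimes> x" using x by (simp add: add_pow_ldistr)
    then have "add_pow R p x = \<zero>" using char x by simp
    then have "add_pow R k (add_pow R p x) = \<zero>" by (simp add: add.nat_pow_one)
    then show ?thesis unfolding n using x by (simp add: add.nat_pow_pow)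
  qed
  have low: "binary_form a b n (\<lambda>k. p choose k) = b [^] n" if "n < p" for n
    using that
  proof (induction n)
    case 0
    then show ?case by (simp add: add.nat_pow_eone)
  next
    case (Suc n)
    have "p dvd (p choose Suc n)" using Suc.prems p by (intro dvd_choose_prime) auto
    then have "add_pow R (p choose Suc n) (a [^] Suc n) = \<zero>" using a by (intro kill) auto
    then show ?case using Suc b by (simp add: m_comm)
  qed
  obtain n where n: "p = Suc n" using prime_gt_0_nat[OF p] by (cases p) auto
  have "(a \<oplus> b) [^] p = b \<otimes> b [^] n \<oplus> add_pow R (p choose p) (a [^] p)"
    using binomial_expansion[OF a b, of p] low[of n] n by simp
  then show ?thesis using a b n by (simp add: a_comm m_comm add.nat_pow_eone)
qed

lemma frob_cring_char_p:
  assumes p: "Factorial_Ring.prime (p::nat)" and char: "add_pow R p \<one> = \<zero>"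
  shows "frob_cring R (p ^ e)"
proof (unfold_locales)
  show "0 < p ^ e" using p by (simp add: prime_gt_0_nat)
  show "(a \<oplus> b) [^] (p ^ e) = a [^] (p ^ e) \<oplus> b [^] (p ^ e)"
    if "a \<in> carrier R" "b \<in> carrier R" for a b
  proof (induction e)
    case (Suc e)
    have pw: "x [^] (p ^ Suc e) = (x [^] (p ^ e)) [^] p" if "x \<in> carrier R" for x
      using that by (simp add: nat_pow_pow mult.commute)
    show ?case using that Suc by (simp only: pw a_closed) (simp add: freshmans_dream[OF p char])
  qed (use that in simp)
qed

end

lemma enat_Sup_attained:
  assumes "enat d = Sup A" "A \<noteq> {}" shows "enat d \<in> A"
proof -
  have "finite A" using assms by (auto simp: Sup_enat_def split: if_splits)
  then show ?thesis using assms Max_in[of A] by (simp add: Sup_enat_def)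
qed

section \<open>Regular local rings\<close>

text \<open>Regularity provides a generating set of the maximal ideal and a chain of primes of the same length,
  and the chain may be assumed to end in the maximal ideal. The induction applies with the zero
  ideal for \<open>A\<close>.\<close>

lemma regular_local_dual_basis:
  fixes R (structure)
  assumes reg: "regular_local_ring R" and frob: "frob_cring R q"
    and Y: "finite Y" "Y \<subseteq> carrier R" "carrier R \<subseteq> frob_cring.lin R q (carrier R) Y"
  shows "\<exists>\<Phi> ds. frob_cring.cartier_map R q \<Phi> \<and> set ds \<subseteq> carrier R \<times> carrier R \<and>
    (\<forall>x\<in>carrier R. frob_cring.dual_sum R q \<Phi> ds x = x)"
proof -
  obtain M where M: "\<And>N. maximalideal N R \<longleftrightarrow> N = M" and dim: "enat (min_gens R M) = krull_dim R"
    and cr: "cring R" and nr: "noetherian_ring R"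
    using reg unfolding regular_local_ring_def by blast
  interpret noetherian_cring R using cr nr by (rule noetherian_cring.intro)
  have maxM: "maximalideal M R" using M by blast
  have primeM: "primeideal M R" by (rule maximalideal_prime[OF maxM])
  interpret M: primeideal M R by fact
  have inM: "I \<subseteq> M" if "ideal I R" "I \<noteq> carrier R" for I
    using exists_maximal_ideal[OF that] M by blast
  interpret local_frob R q M Y
  proof (intro local_frob.intro local_frob_axioms.intro frob)
    show "noetherian_cring R" by (rule noetherian_cring_axioms)
    show "primeideal M R" by fact
    show "a \<in> Units R" if a: "a \<in> carrier R" "a \<notin> M" for a
    proof -
      have "PIdl a = carrier R" using inM[OF cgenideal_ideal[OF a(1)]] cgenideal_self[OF a(1)] a(2) by blast
      then have "\<one> \<in> PIdl a" by simp
      then obtain x where "x \<in> carrier R" "\<one> = x \<otimes> a" unfolding cgenideal_def by blast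
      then show ?thesis using a(1) m_comm[of x a] unfolding Units_def by auto
    qed
  qed (use Y in auto)
  let ?d = "min_gens R M"
  have "\<exists>X. X \<subseteq> carrier R \<and> finite X \<and> card X = ?d \<and> Idl X = M"
    unfolding min_gens_def
    by (rule LeastI_ex) (use finetely_gen[OF M.is_ideal] in blast)
  then obtain X where X: "X \<subseteq> carrier R" "finite X" "card X = ?d" "Idl X = M" by blast
  have "enat ?d \<in> {enat n |n. \<exists>P :: nat \<Rightarrow> 'a set.
      (\<forall>i\<le>n. primeideal (P i) R) \<and> (\<forall>i<n. P i \<subset> P (Suc i))}"
  proof (rule enat_Sup_attained)
    show "enat ?d = Sup {enat n |n. \<exists>P :: nat \<Rightarrow> 'a set.
      (\<forall>i\<le>n. primeideal (P i) R) \<and> (\<forall>i<n. P i \<subset> P (Suc i))}"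
      using dim unfolding krull_dim_def .
    have "enat 0 \<in> {enat n |n. \<exists>P :: nat \<Rightarrow> 'a set.
      (\<forall>i\<le>n. primeideal (P i) R) \<and> (\<forall>i<n. P i \<subset> P (Suc i))}"
      using primeM by (auto intro!: exI[of _ "\<lambda>_. M"])
    then show "{enat n |n. \<exists>P :: nat \<Rightarrow> 'a set.
      (\<forall>i\<le>n. primeideal (P i) R) \<and> (\<forall>i<n. P i \<subset> P (Suc i))} \<noteq> {}" by blast
  qed
  then obtain P where P: "\<And>i. i \<le> ?d \<Longrightarrow> primeideal (P i) R" "\<And>i. i < ?d \<Longrightarrow> P i \<subset> P (Suc i)"
    by auto
  let ?P = "P (?d := M)"
  have P1: "primeideal (?P i) R" if "i \<le> ?d" for i using P(1) primeM that by simp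
  have P2: "?P i \<subset> ?P (Suc i)" if i: "i < ?d" for i
  proof (cases "Suc i = ?d")
    case True
    have Pd: "primeideal (P ?d) R" using P(1) by simp
    have "P ?d \<subseteq> M"
      by (rule inM[OF primeideal.axioms(1)[OF Pd] primeideal.I_notcarr[OF Pd, symmetric]])
    then show ?thesis using P(2)[OF i] True i by auto
  next
    case False
    then show ?thesis using P(2)[OF i] i by simp
  qed
  interpret P0: primeideal "?P 0" R by (rule P1) simp
  have z: "{\<zero>} \<union> X \<subseteq> carrier R" using X by simp
  have "Idl ({\<zero>} \<union> X) = M"
  proof
    show "Idl ({\<zero>} \<union> X) \<subseteq> M"
      using genideal_minimal[OF M.is_ideal, of "{\<zero>} \<union> X"] genideal_self[OF X(1)] X(4) by auto
    have "X \<subseteq> Idl ({\<zero>} \<union> X)" using genideal_self[OF z] by blast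
    then show "M \<subseteq> Idl ({\<zero>} \<union> X)" using genideal_minimal[OF genideal_ideal[OF z]] X(4) by blast
  qed
  then have "{\<zero>} = ?P 0 \<and> (\<exists>bs. frob_basis {\<zero>} bs \<and> bs \<noteq> [] \<and> socle_gen {\<zero>} (hd bs))"
    using X(3) P0.zero_closed
    by (intro regular_frob_basis[of "{\<zero>}" X ?d ?P] zeroideal X(1,2) P1 P2) auto
  then show ?thesis using dual_basis_of_frob_basis by blast
qed

section \<open>Localization at a prime\<close>

text \<open>The properties that characterize the canonical map into the localization at \<open>M\<close>.\<close>

locale localization_hom = R: noetherian_cring R + L: cring L + ring_hom_ring R L h
  for R (structure) and L (structure) and h +
  fixes M
  assumes M: "primeideal M R"
    and h_unit: "t \<in> carrier R - M \<Longrightarrow> h t \<in> Units L"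
    and h_frac: "l \<in> carrier L \<Longrightarrow> \<exists>s\<in>carrier R - M. \<exists>a\<in>carrier R. l \<otimes>\<^bsub>L\<^esub> h s = h a"
    and h_ker: "a \<in> carrier R \<Longrightarrow> h a = \<zero>\<^bsub>L\<^esub> \<Longrightarrow> \<exists>t\<in>carrier R - M. t \<otimes>\<^bsub>R\<^esub> a = \<zero>\<^bsub>R\<^esub>"

context cring
begin

context
  fixes P assumes P: "primeideal P R"
begin

lemma frac_rel_iff:
  "((a, s), (b, t)) \<in> frac_rel R (carrier R - P) \<longleftrightarrow>
    a \<in> carrier R \<and> s \<in> carrier R - P \<and> b \<in> carrier R \<and> t \<in> carrier R - P \<and>
    (\<exists>u\<in>carrier R - P. u \<otimes> (a \<otimes> t) = u \<otimes> (b \<otimes> s))"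
  unfolding frac_rel_def by simp

lemma frac_rel_equiv: "equiv (carrier R \<times> (carrier R - P)) (frac_rel R (carrier R - P))"
proof (rule equivI)
  show "frac_rel R (carrier R - P) \<subseteq>
      (carrier R \<times> (carrier R - P)) \<times> (carrier R \<times> (carrier R - P))"
    unfolding frac_rel_def by auto
  show "refl_on (carrier R \<times> (carrier R - P)) (frac_rel R (carrier R - P))"
    unfolding refl_on_def frac_rel_def using primeideal_one_notin[OF P] by auto
  show "sym (frac_rel R (carrier R - P))"
    by (rule symI) (unfold frac_rel_def, auto intro: sym)
  show "trans (frac_rel R (carrier R - P))"
  proof (rule transI)
    fix x y z assume xy: "(x, y) \<in> frac_rel R (carrier R - P)" and yz: "(y, z) \<in> frac_rel R (carrier R - P)"
    obtain a s b t c w where xyz: "x = (a, s)" "y = (b, t)" "z = (c, w)" by (cases x, cases y, cases z)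
    obtain u v where *: "a \<in> carrier R" "b \<in> carrier R" "c \<in> carrier R" "s \<in> carrier R - P"
      "t \<in> carrier R - P" "w \<in> carrier R - P" "u \<in> carrier R - P" "v \<in> carrier R - P"
      "u \<otimes> (a \<otimes> t) = u \<otimes> (b \<otimes> s)" "v \<otimes> (b \<otimes> w) = v \<otimes> (c \<otimes> t)"
      using xy yz unfolding xyz frac_rel_iff by blast
    have cl: "s \<in> carrier R" "t \<in> carrier R" "w \<in> carrier R" "u \<in> carrier R" "v \<in> carrier R"
      using * by auto
    have "(u \<otimes> v \<otimes> t) \<otimes> (a \<otimes> w) = (v \<otimes> w) \<otimes> (u \<otimes> (a \<otimes> t))" using cl *(1-3) by algebra
    also have "\<dots> = (u \<otimes> s) \<otimes> (v \<otimes> (b \<otimes> w))" unfolding *(9) using cl *(1-3) by algebra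
    also have "\<dots> = (u \<otimes> v \<otimes> t) \<otimes> (c \<otimes> s)" unfolding *(10) using cl *(1-3) by algebra
    finally have "(u \<otimes> v \<otimes> t) \<otimes> (a \<otimes> w) = (u \<otimes> v \<otimes> t) \<otimes> (c \<otimes> s)" .
    moreover have "u \<otimes> v \<otimes> t \<in> carrier R - P"
      using primeideal_compl_mult[OF P primeideal_compl_mult[OF P *(7,8)] *(5)] .
    ultimately show "(x, z) \<in> frac_rel R (carrier R - P)"
      unfolding xyz frac_rel_iff using *(1,3,4,6) by blast
  qed
qed

lemma fraction_eq_iff:
  assumes "a \<in> carrier R" "b \<in> carrier R" "s \<in> carrier R - P" "t \<in> carrier R - P"
  shows "fraction R (carrier R - P) a s = fraction R (carrier R - P) b t \<longleftrightarrow>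
    (\<exists>u\<in>carrier R - P. u \<otimes> (a \<otimes> t) = u \<otimes> (b \<otimes> s))"
proof -
  have "fraction R (carrier R - P) a s = fraction R (carrier R - P) b t \<longleftrightarrow>
      ((a, s), (b, t)) \<in> frac_rel R (carrier R - P)"
    unfolding fraction_def using eq_equiv_class_iff[OF frac_rel_equiv] assms by simp
  then show ?thesis unfolding frac_rel_def using assms by simp
qed

lemma fraction_mem_iff:
  "(b, t) \<in> fraction R (carrier R - P) a s \<longleftrightarrow>
    a \<in> carrier R \<and> s \<in> carrier R - P \<and> b \<in> carrier R \<and> t \<in> carrier R - P \<and>
    (\<exists>u\<in>carrier R - P. u \<otimes> (a \<otimes> t) = u \<otimes> (b \<otimes> s))"
  unfolding fraction_def Image_singleton_iff frac_rel_iff by blast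

text \<open>The operations of the localization are unions over all representatives; when the value is the
  same for all of them, the union is that value.\<close>

lemma union_fractions:
  assumes "a \<in> carrier R" "b \<in> carrier R" "s \<in> carrier R - P" "t \<in> carrier R - P"
    and "\<And>a' s' b' t'. (a', s') \<in> fraction R (carrier R - P) a s \<Longrightarrow>
       (b', t') \<in> fraction R (carrier R - P) b t \<Longrightarrow> F a' s' b' t' = F a s b t"
  shows "(\<Union>(a', s')\<in>fraction R (carrier R - P) a s. \<Union>(b', t')\<in>fraction R (carrier R - P) b t. F a' s' b' t')
    = F a s b t"
proof -
  have "(a, s) \<in> fraction R (carrier R - P) a s" "(b, t) \<in> fraction R (carrier R - P) b t"
    unfolding fraction_mem_iff using assms primeideal_one_notin[OF P] by auto
  moreover have "(\<Union>(b', t')\<in>fraction R (carrier R - P) b t. F a' s' b' t') = F a s b t"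
    if "(a', s') \<in> fraction R (carrier R - P) a s" for a' s'
    using assms(5)[OF that] \<open>(b, t) \<in> _\<close> by (intro SUP_eq_const) auto
  ultimately show ?thesis by (intro SUP_eq_const) auto
qed

lemma localization_mult:
  assumes "a \<in> carrier R" "b \<in> carrier R" "s \<in> carrier R - P" "t \<in> carrier R - P"
  shows "fraction R (carrier R - P) a s \<otimes>\<^bsub>localization_at R P\<^esub> fraction R (carrier R - P) b t
    = fraction R (carrier R - P) (a \<otimes> b) (s \<otimes> t)"
proof -
  have "fraction R (carrier R - P) (a' \<otimes> b') (s' \<otimes> t') = fraction R (carrier R - P) (a \<otimes> b) (s \<otimes> t)"
    if m: "(a', s') \<in> fraction R (carrier R - P) a s" "(b', t') \<in> fraction R (carrier R - P) b t"
    for a' s' b' t'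
  proof -
    obtain u v where *: "a' \<in> carrier R" "b' \<in> carrier R" "s' \<in> carrier R - P" "t' \<in> carrier R - P"
       "u \<in> carrier R - P" "v \<in> carrier R - P"
       "u \<otimes> (a \<otimes> s') = u \<otimes> (a' \<otimes> s)" "v \<otimes> (b \<otimes> t') = v \<otimes> (b' \<otimes> t)"
      using m unfolding fraction_mem_iff by blast
    have cl: "s' \<in> carrier R" "t' \<in> carrier R" "u \<in> carrier R" "v \<in> carrier R" "s \<in> carrier R" "t \<in> carrier R"
      using * assms by auto
    have "(u \<otimes> v) \<otimes> ((a' \<otimes> b') \<otimes> (s \<otimes> t)) = (u \<otimes> (a' \<otimes> s)) \<otimes> (v \<otimes> (b' \<otimes> t))"
      using cl *(1,2) by algebra
    also have "\<dots> = (u \<otimes> v) \<otimes> ((a \<otimes> b) \<otimes> (s' \<otimes> t'))"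
      unfolding *(7,8)[symmetric] using cl assms(1,2) by algebra
    finally show ?thesis
      using primeideal_compl_mult[OF P] *(1-6) assms by (subst fraction_eq_iff) auto
  qed
  then show ?thesis
    unfolding localization_at_def localization_def
    using union_fractions[OF assms, of "\<lambda>a s b t. fraction R (carrier R - P) (a \<otimes> b) (s \<otimes> t)"] by simp
qed

lemma localization_add:
  assumes "a \<in> carrier R" "b \<in> carrier R" "s \<in> carrier R - P" "t \<in> carrier R - P"
  shows "fraction R (carrier R - P) a s \<oplus>\<^bsub>localization_at R P\<^esub> fraction R (carrier R - P) b t
    = fraction R (carrier R - P) (a \<otimes> t \<oplus> b \<otimes> s) (s \<otimes> t)"
proof -
  have "fraction R (carrier R - P) (a' \<otimes> t' \<oplus> b' \<otimes> s') (s' \<otimes> t')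
      = fraction R (carrier R - P) (a \<otimes> t \<oplus> b \<otimes> s) (s \<otimes> t)"
    if m: "(a', s') \<in> fraction R (carrier R - P) a s" "(b', t') \<in> fraction R (carrier R - P) b t"
    for a' s' b' t'
  proof -
    obtain u v where *: "a' \<in> carrier R" "b' \<in> carrier R" "s' \<in> carrier R - P" "t' \<in> carrier R - P"
       "u \<in> carrier R - P" "v \<in> carrier R - P"
       "u \<otimes> (a \<otimes> s') = u \<otimes> (a' \<otimes> s)" "v \<otimes> (b \<otimes> t') = v \<otimes> (b' \<otimes> t)"
      using m unfolding fraction_mem_iff by blast
    have cl: "s' \<in> carrier R" "t' \<in> carrier R" "u \<in> carrier R" "v \<in> carrier R" "s \<in> carrier R" "t \<in> carrier R"
      using * assms by auto
    have "(u \<otimes> v) \<otimes> ((a' \<otimes> t' \<oplus> b' \<otimes> s') \<otimes> (s \<otimes> t))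
        = (v \<otimes> t \<otimes> t') \<otimes> (u \<otimes> (a' \<otimes> s)) \<oplus> (u \<otimes> s \<otimes> s') \<otimes> (v \<otimes> (b' \<otimes> t))"
      using cl *(1,2) by algebra
    also have "\<dots> = (u \<otimes> v) \<otimes> ((a \<otimes> t \<oplus> b \<otimes> s) \<otimes> (s' \<otimes> t'))"
      unfolding *(7,8)[symmetric] using cl assms(1,2) by algebra
    finally show ?thesis
      using primeideal_compl_mult[OF P] *(1-6) assms by (subst fraction_eq_iff) auto
  qed
  then show ?thesis
    unfolding localization_at_def localization_def
    using union_fractions[OF assms, of
      "\<lambda>a s b t. fraction R (carrier R - P) (a \<otimes> t \<oplus> b \<otimes> s) (s \<otimes> t)"] by simp
qed

lemma fraction_in_localization:
  "a \<in> carrier R \<Longrightarrow> s \<in> carrier R - P \<Longrightarrow> fraction R (carrier R - P) a s \<in> carrier (localization_at R P)"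
  unfolding localization_at_def localization_def fraction_def by (auto intro: quotientI)

lemma localization_one: "\<one>\<^bsub>localization_at R P\<^esub> = fraction R (carrier R - P) \<one> \<one>"
  unfolding localization_at_def localization_def by simp

lemma localization_zero: "\<zero>\<^bsub>localization_at R P\<^esub> = fraction R (carrier R - P) \<zero> \<one>"
  unfolding localization_at_def localization_def by simp

lemma localization_carrierE:
  assumes "l \<in> carrier (localization_at R P)"
  obtains a s where "a \<in> carrier R" "s \<in> carrier R - P" "l = fraction R (carrier R - P) a s"
  using assms unfolding localization_at_def localization_def fraction_def by (auto elim!: quotientE)

end
end

lemma (in noetherian_cring) localization_hom_localization_at:
  assumes P: "primeideal P R" and L: "cring (localization_at R P)"
  shows "localization_hom R (localization_at R P) (\<lambda>a. fraction R (carrier R - P) a \<one>) P"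
proof -
  let ?L = "localization_at R P" and ?f = "fraction R (carrier R - P)"
  interpret L: cring ?L by (rule L)
  note one = primeideal_one_notin[OF P]
  have one': "\<one> \<in> carrier R - P" using one by simp
  note mlt = localization_mult[OF P] and ad = localization_add[OF P] and frac = fraction_eq_iff[OF P]
  have hom: "ring_hom_ring R ?L (\<lambda>a. ?f a \<one>)"
  proof (rule ring_hom_ringI)
    show "ring R" "ring ?L" by unfold_locales
    show "?f x \<one> \<in> carrier ?L" if "x \<in> carrier R" for x
      by (rule fraction_in_localization[OF P that one'])
    show "?f (x \<otimes> y) \<one> = ?f x \<one> \<otimes>\<^bsub>?L\<^esub> ?f y \<one>" if "x \<in> carrier R" "y \<in> carrier R" for x y
      using mlt[OF that one' one'] by simp
    show "?f (x \<oplus> y) \<one> = ?f x \<one> \<oplus>\<^bsub>?L\<^esub> ?f y \<one>" if "x \<in> carrier R" "y \<in> carrier R" for x y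
      using ad[OF that one' one'] that by simp
    show "?f \<one> \<one> = \<one>\<^bsub>?L\<^esub>" by (simp add: localization_one[OF P])
  qed
  show ?thesis
  proof (intro localization_hom.intro localization_hom_axioms.intro)
    show "noetherian_cring R" by (rule noetherian_cring_axioms)
    show "cring ?L" by (rule L)
    show "ring_hom_ring R ?L (\<lambda>a. ?f a \<one>)" by (rule hom)
    show "primeideal P R" by (rule P)
    show "?f t \<one> \<in> Units ?L" if t: "t \<in> carrier R - P" for t
    proof -
      have tc: "t \<in> carrier R" using t by simp
      have "?f \<one> t \<otimes>\<^bsub>?L\<^esub> ?f t \<one> = ?f t t" using mlt[OF one_closed tc t one'] tc by simp
      also have "\<dots> = \<one>\<^bsub>?L\<^esub>"
        unfolding localization_one[OF P] using tc t one' by (subst frac) (auto intro!: bexI[of _ \<one>])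
      finally have e: "?f \<one> t \<otimes>\<^bsub>?L\<^esub> ?f t \<one> = \<one>\<^bsub>?L\<^esub>" .
      have c: "?f \<one> t \<in> carrier ?L" "?f t \<one> \<in> carrier ?L"
        using fraction_in_localization[OF P] t tc one' by auto
      show ?thesis unfolding Units_def using e c L.m_comm[OF c] by auto
    qed
    show "\<exists>s\<in>carrier R - P. \<exists>a\<in>carrier R. l \<otimes>\<^bsub>?L\<^esub> ?f s \<one> = ?f a \<one>" if l: "l \<in> carrier ?L" for l
    proof -
      obtain a s where as: "a \<in> carrier R" "s \<in> carrier R - P" "l = ?f a s"
        by (rule localization_carrierE[OF P l])
      have sc: "s \<in> carrier R" using as by simp
      have "l \<otimes>\<^bsub>?L\<^esub> ?f s \<one> = ?f (a \<otimes> s) s" unfolding as(3) using mlt[OF as(1) sc as(2) one'] sc by simp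
      also have "\<dots> = ?f a \<one>"
        using as sc one' by (subst frac) (auto intro!: bexI[of _ \<one>])
      finally show ?thesis using as by blast
    qed
    show "\<exists>t\<in>carrier R - P. t \<otimes> a = \<zero>" if a: "a \<in> carrier R" "?f a \<one> = \<zero>\<^bsub>?L\<^esub>" for a
    proof -
      obtain u where u: "u \<in> carrier R - P" "u \<otimes> (a \<otimes> \<one>) = u \<otimes> (\<zero> \<otimes> \<one>)"
        using a(2) frac[OF a(1) zero_closed one' one'] unfolding localization_zero[OF P] by blast
      then show ?thesis using a(1) by (intro bexI[of _ u]) auto
    qed
  qed
qed

section \<open>Clearing denominators\<close>

context localization_hom
begin

lemma compl_mult: "s \<in> carrier R - M \<Longrightarrow> t \<in> carrier R - M \<Longrightarrow> s \<otimes> t \<in> carrier R - M"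
  by (rule R.primeideal_compl_mult[OF M])

lemma common_denominator:
  assumes "finite X" "X \<subseteq> carrier L"
  shows "\<exists>s\<in>carrier R - M. \<forall>l\<in>X. \<exists>a\<in>carrier R. l \<otimes>\<^bsub>L\<^esub> h s = h a"
  using assms
proof (induction X)
  case empty
  show ?case using R.primeideal_one_notin[OF M] by blast
next
  case (insert l X)
  obtain s where s: "s \<in> carrier R - M" "\<And>l. l \<in> X \<Longrightarrow> \<exists>a\<in>carrier R. l \<otimes>\<^bsub>L\<^esub> h s = h a"
    using insert by auto
  have lc: "l \<in> carrier L" using insert by simp
  obtain t a where t: "t \<in> carrier R - M" "a \<in> carrier R" "l \<otimes>\<^bsub>L\<^esub> h t = h a"
    using h_frac[OF lc] by blast
  have sc: "s \<in> carrier R" "t \<in> carrier R" using s t by auto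
  have "\<exists>a\<in>carrier R. v \<otimes>\<^bsub>L\<^esub> h (s \<otimes> t) = h a" if v: "v \<in> insert l X" for v
  proof (cases "v = l")
    case True
    have "l \<otimes>\<^bsub>L\<^esub> h (s \<otimes> t) = h s \<otimes>\<^bsub>L\<^esub> (l \<otimes>\<^bsub>L\<^esub> h t)" using lc sc by (simp add: L.m_lcomm)
    also have "\<dots> = h (s \<otimes> a)" using t sc by simp
    finally show ?thesis using True sc t(2) by blast
  next
    case False
    then obtain b where b: "b \<in> carrier R" "v \<otimes>\<^bsub>L\<^esub> h s = h b" using s(2) v by blast
    have vc: "v \<in> carrier L" using insert v by auto
    have "v \<otimes>\<^bsub>L\<^esub> h (s \<otimes> t) = (v \<otimes>\<^bsub>L\<^esub> h s) \<otimes>\<^bsub>L\<^esub> h t" using vc sc by (simp add: L.m_assoc)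
    also have "\<dots> = h (b \<otimes> t)" using b sc by simp
    finally show ?thesis using b(1) sc by blast
  qed
  then show ?case using compl_mult[OF s(1) t(1)] by blast
qed

text \<open>The kernel is finitely generated, so one denominator kills all of it. Multiplying by it turns
  equality of images into equality.\<close>

lemma kernel_killed: "\<exists>t\<in>carrier R - M. \<forall>a\<in>carrier R. h a = \<zero>\<^bsub>L\<^esub> \<longrightarrow> t \<otimes> a = \<zero>"
proof -
  let ?K = "{a \<in> carrier R. h a = \<zero>\<^bsub>L\<^esub>}"
  have K: "ideal ?K R" by (rule R.ideal_of_closedI) auto
  obtain X where X: "X \<subseteq> carrier R" "finite X" "?K = Idl X" using R.finetely_gen[OF K] by blast
  have XK: "X \<subseteq> ?K" unfolding X(3) by (rule R.genideal_self[OF X(1)])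
  have "\<exists>t\<in>carrier R - M. \<forall>a\<in>X. t \<otimes> a = \<zero>" using X(2) XK
  proof (induction X)
    case empty
    show ?case using R.primeideal_one_notin[OF M] by blast
  next
    case (insert a X)
    then obtain t where t: "t \<in> carrier R - M" "\<And>a. a \<in> X \<Longrightarrow> t \<otimes> a = \<zero>" by auto
    have ac: "a \<in> carrier R" "h a = \<zero>\<^bsub>L\<^esub>" using insert by auto
    obtain u where u: "u \<in> carrier R - M" "u \<otimes> a = \<zero>" using h_ker[OF ac] by blast
    have cl: "t \<in> carrier R" "u \<in> carrier R" using t u by auto
    have "(u \<otimes> t) \<otimes> b = \<zero>" if b: "b \<in> insert a X" for b
    proof (cases "b = a")
      case True
      have "(u \<otimes> t) \<otimes> a = t \<otimes> (u \<otimes> a)" using cl ac(1) by algebra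
      then show ?thesis using True u cl by simp
    next
      case False
      then have "t \<otimes> b = \<zero>" "b \<in> carrier R" using b t insert.prems by auto
      then show ?thesis using cl by (simp add: R.m_assoc)
    qed
    then show ?case using compl_mult[OF u(1) t(1)] by blast
  qed
  then obtain t where t: "t \<in> carrier R - M" "\<And>a. a \<in> X \<Longrightarrow> t \<otimes> a = \<zero>" by blast
  have tc: "t \<in> carrier R" using t by simp
  have "ideal {a \<in> carrier R. t \<otimes> a \<in> {\<zero>}} R" by (rule R.colon_elem_ideal[OF R.zeroideal tc])
  then have "Idl X \<subseteq> {a \<in> carrier R. t \<otimes> a \<in> {\<zero>}}" by (rule R.genideal_minimal) (use t X in auto)
  then show ?thesis using t(1) X(3) by blast
qed

context
  fixes q assumes Rq: "frob_cring R q" and Lq: "frob_cring L q"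
begin

interpretation RF: frob_cring R q by (rule Rq)
interpretation LF: frob_cring L q by (rule Lq)

lemma span_localizes:
  assumes Y: "Y \<subseteq> carrier R" "carrier R \<subseteq> RF.span Y"
  shows "carrier L \<subseteq> LF.span (h ` Y)"
proof
  have hY: "h ` Y \<subseteq> carrier L" using Y by auto
  have img: "h y \<in> LF.span (h ` Y)" if "y \<in> RF.span Y" for y
    using that
  proof induction
    case zero
    then show ?case using LF.lin.zero by simp
  next
    case (step c t y)
    have cl: "c \<in> carrier R" "t \<in> carrier R" "y \<in> carrier R"
      using step Y RF.lin_closed[OF _ Y(1)] by auto
    have "h (c [^] q \<otimes> t \<oplus> y) = h c [^]\<^bsub>L\<^esub> q \<otimes>\<^bsub>L\<^esub> h t \<oplus>\<^bsub>L\<^esub> h y" using cl by (simp add: hom_nat_pow)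
    also have "\<dots> \<in> LF.span (h ` Y)" using step cl by (intro LF.lin.step) auto
    finally show ?case .
  qed
  fix l assume l: "l \<in> carrier L"
  obtain s a where sa: "s \<in> carrier R - M" "a \<in> carrier R" "l \<otimes>\<^bsub>L\<^esub> h s = h a" using h_frac[OF l] by blast
  obtain n where n: "q = Suc n" using RF.q_pos by (cases q) auto
  let ?u = "inv\<^bsub>L\<^esub> (h s)"
  have sc: "s \<in> carrier R" using sa by simp
  have u: "?u \<in> carrier L" "?u \<otimes>\<^bsub>L\<^esub> h s = \<one>\<^bsub>L\<^esub>" "h s \<in> carrier L" using h_unit[OF sa(1)] sc by auto
  have "h (a \<otimes> s [^] n) = l \<otimes>\<^bsub>L\<^esub> h s [^]\<^bsub>L\<^esub> q"
    using sa sc l unfolding n by (simp add: hom_nat_pow sa(3)[symmetric] L.m_ac)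
  moreover have "?u [^]\<^bsub>L\<^esub> q \<otimes>\<^bsub>L\<^esub> (l \<otimes>\<^bsub>L\<^esub> h s [^]\<^bsub>L\<^esub> q)
      = (?u [^]\<^bsub>L\<^esub> q \<otimes>\<^bsub>L\<^esub> h s [^]\<^bsub>L\<^esub> q) \<otimes>\<^bsub>L\<^esub> l"
    using u(1,3) l by (simp add: L.m_ac)
  moreover have "?u [^]\<^bsub>L\<^esub> q \<otimes>\<^bsub>L\<^esub> h s [^]\<^bsub>L\<^esub> q = (?u \<otimes>\<^bsub>L\<^esub> h s) [^]\<^bsub>L\<^esub> q"
    using u(1,3) by (rule L.nat_pow_distrib[symmetric])
  ultimately have "?u [^]\<^bsub>L\<^esub> q \<otimes>\<^bsub>L\<^esub> h (a \<otimes> s [^] n) = (?u \<otimes>\<^bsub>L\<^esub> h s) [^]\<^bsub>L\<^esub> q \<otimes>\<^bsub>L\<^esub> l"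
    by simp
  then have "l = ?u [^]\<^bsub>L\<^esub> q \<otimes>\<^bsub>L\<^esub> h (a \<otimes> s [^] n)" using u(2) l by simp
  moreover have "a \<otimes> s [^] n \<in> carrier R" using sa sc by simp
  then have "h (a \<otimes> s [^] n) \<in> LF.span (h ` Y)" using img Y(2) by blast
  ultimately show "l \<in> LF.span (h ` Y)" using LF.span_smult[OF hY u(1)] by metis
qed

text \<open>On finitely many generators, and hence everywhere, the values of \<open>\<Phi>\<close> have a common denominator
  \<open>s\<close>. The numerator of \<open>\<Phi> (h x)\<close> is determined up to the kernel of \<open>h\<close>, so it becomes
  well defined, and exactly Frobenius-linear, after multiplication by an element \<open>t\<close> that kills
  the kernel. This is the map \<open>\<Psi>\<close>. The pairs are lifted in the same way with a common
  denominator \<open>w\<close>.\<close>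

lemma dual_basis_descends:
  assumes Y: "finite Y" "Y \<subseteq> carrier R" "carrier R \<subseteq> RF.span Y"
    and \<Phi>: "LF.cartier_map \<Phi>" and ds: "set ds \<subseteq> carrier L \<times> carrier L"
    and id: "\<And>x. x \<in> carrier L \<Longrightarrow> LF.dual_sum \<Phi> ds x = x"
  shows "\<exists>c\<in>carrier R - M. \<exists>\<Psi> es. RF.cartier_map \<Psi> \<and> set es \<subseteq> carrier R \<times> carrier R \<and>
    (\<forall>x\<in>carrier R. RF.dual_sum \<Psi> es x = c \<otimes> x)"
proof -
  obtain t where t: "t \<in> carrier R - M" "\<And>a. a \<in> carrier R \<Longrightarrow> h a = \<zero>\<^bsub>L\<^esub> \<Longrightarrow> t \<otimes> a = \<zero>"
    using kernel_killed by blast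
  have tc: "t \<in> carrier R" using t by simp
  have t_eq: "t \<otimes> a = t \<otimes> b" if ab: "a \<in> carrier R" "b \<in> carrier R" "h a = h b" for a b
  proof -
    have "h (a \<ominus> b) = \<zero>\<^bsub>L\<^esub>" using ab by (simp add: R.minus_eq L.r_neg)
    then have "t \<otimes> (a \<ominus> b) = \<zero>" using t(2) ab by simp
    moreover have "t \<otimes> (a \<ominus> b) = t \<otimes> a \<ominus> t \<otimes> b" using ab tc by algebra
    ultimately show ?thesis using ab tc by (simp add: R.r_right_minus_eq)
  qed
  have "\<exists>s\<in>carrier R - M. \<forall>l\<in>(\<lambda>y. \<Phi> (h y)) ` Y. \<exists>a\<in>carrier R. l \<otimes>\<^bsub>L\<^esub> h s = h a"
    by (rule common_denominator) (use Y LF.cartier_closed[OF \<Phi>] in auto)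
  then obtain s where s: "s \<in> carrier R - M"
      "\<And>y. y \<in> Y \<Longrightarrow> \<exists>a\<in>carrier R. \<Phi> (h y) \<otimes>\<^bsub>L\<^esub> h s = h a" by blast
  have sc: "s \<in> carrier R" using s by simp
  have num: "\<exists>a\<in>carrier R. \<Phi> (h x) \<otimes>\<^bsub>L\<^esub> h s = h a" if "x \<in> RF.span Y" for x
    using that
  proof induction
    case zero
    have "\<Phi> (h \<zero>) \<otimes>\<^bsub>L\<^esub> h s = h \<zero>" using sc by (simp add: LF.cartier_zero[OF \<Phi>])
    then show ?case by blast
  next
    case (step c y x)
    obtain a b where ab: "a \<in> carrier R" "\<Phi> (h y) \<otimes>\<^bsub>L\<^esub> h s = h a"
      "b \<in> carrier R" "\<Phi> (h x) \<otimes>\<^bsub>L\<^esub> h s = h b" using s(2)[OF step(2)] step by blast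
    have cl: "c \<in> carrier R" "y \<in> carrier R" "x \<in> carrier R"
      using step Y RF.lin_closed[OF _ Y(2)] by auto
    have hc: "h c \<in> carrier L" "h y \<in> carrier L" "h x \<in> carrier L" "h s \<in> carrier L"
      "\<Phi> (h y) \<in> carrier L" "\<Phi> (h x) \<in> carrier L" using cl sc LF.cartier_closed[OF \<Phi>] by auto
    have "\<Phi> (h (c [^] q \<otimes> y \<oplus> x)) = h c \<otimes>\<^bsub>L\<^esub> \<Phi> (h y) \<oplus>\<^bsub>L\<^esub> \<Phi> (h x)"
      using cl by (simp add: hom_nat_pow LF.cartier_add[OF \<Phi>] LF.cartier_smult[OF \<Phi>])
    then have "\<Phi> (h (c [^] q \<otimes> y \<oplus> x)) \<otimes>\<^bsub>L\<^esub> h s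
        = h c \<otimes>\<^bsub>L\<^esub> (\<Phi> (h y) \<otimes>\<^bsub>L\<^esub> h s) \<oplus>\<^bsub>L\<^esub> \<Phi> (h x) \<otimes>\<^bsub>L\<^esub> h s"
      using hc by (simp add: L.l_distr L.m_assoc)
    also have "\<dots> = h (c \<otimes> a \<oplus> b)" using ab cl by simp
    finally show ?case using ab cl by (intro bexI[of _ "c \<otimes> a \<oplus> b"]) auto
  qed
  define num_of where "num_of x = (SOME a. a \<in> carrier R \<and> \<Phi> (h x) \<otimes>\<^bsub>L\<^esub> h s = h a)" for x
  have num_of: "num_of x \<in> carrier R" "\<Phi> (h x) \<otimes>\<^bsub>L\<^esub> h s = h (num_of x)" if x: "x \<in> carrier R" for x
  proof -
    have "\<exists>a. a \<in> carrier R \<and> \<Phi> (h x) \<otimes>\<^bsub>L\<^esub> h s = h a" using num Y(3) x by blast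
    from someI_ex[OF this] show "num_of x \<in> carrier R" "\<Phi> (h x) \<otimes>\<^bsub>L\<^esub> h s = h (num_of x)"
      unfolding num_of_def by blast+
  qed
  define \<Psi> where "\<Psi> x = t \<otimes> num_of x" for x
  have \<Psi>: "RF.cartier_map \<Psi>"
    unfolding RF.cartier_map_def
  proof (intro conjI ballI)
    fix x assume x: "x \<in> carrier R"
    show "\<Psi> x \<in> carrier R" unfolding \<Psi>_def using num_of(1)[OF x] tc by simp
    fix y assume y: "y \<in> carrier R"
    have cl: "\<Phi> (h x) \<in> carrier L" "\<Phi> (h y) \<in> carrier L" "h s \<in> carrier L"
      using x y sc LF.cartier_closed[OF \<Phi>] by auto
    have "h (num_of (x \<oplus> y)) = \<Phi> (h x \<oplus>\<^bsub>L\<^esub> h y) \<otimes>\<^bsub>L\<^esub> h s" using num_of(2)[of "x \<oplus> y"] x y by simp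
    also have "\<dots> = \<Phi> (h x) \<otimes>\<^bsub>L\<^esub> h s \<oplus>\<^bsub>L\<^esub> \<Phi> (h y) \<otimes>\<^bsub>L\<^esub> h s"
      using x y cl by (simp add: LF.cartier_add[OF \<Phi>] L.l_distr)
    also have "\<dots> = h (num_of x \<oplus> num_of y)" using num_of x y by simp
    finally have "t \<otimes> num_of (x \<oplus> y) = t \<otimes> (num_of x \<oplus> num_of y)"
      using num_of(1) x y by (intro t_eq) auto
    then show "\<Psi> (x \<oplus> y) = \<Psi> x \<oplus> \<Psi> y"
      unfolding \<Psi>_def using num_of(1) x y tc by (simp add: R.r_distr)
  next
    fix r x assume r: "r \<in> carrier R" and x: "x \<in> carrier R"
    have cl: "\<Phi> (h x) \<in> carrier L" "h s \<in> carrier L" "h r \<in> carrier L"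
      using x r sc LF.cartier_closed[OF \<Phi>] by auto
    have "h (num_of (r [^] q \<otimes> x)) = \<Phi> (h r [^]\<^bsub>L\<^esub> q \<otimes>\<^bsub>L\<^esub> h x) \<otimes>\<^bsub>L\<^esub> h s"
      using num_of(2)[of "r [^] q \<otimes> x"] x r by (simp add: hom_nat_pow)
    also have "\<dots> = h r \<otimes>\<^bsub>L\<^esub> (\<Phi> (h x) \<otimes>\<^bsub>L\<^esub> h s)"
      using x r cl by (simp add: LF.cartier_smult[OF \<Phi>] L.m_assoc)
    also have "\<dots> = h (r \<otimes> num_of x)" using num_of x r by simp
    finally have "t \<otimes> num_of (r [^] q \<otimes> x) = t \<otimes> (r \<otimes> num_of x)"
      using num_of(1) x r by (intro t_eq) auto
    then show "\<Psi> (r [^] q \<otimes> x) = r \<otimes> \<Psi> x"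
      unfolding \<Psi>_def using num_of(1) x r tc by (simp add: R.m_lcomm)
  qed
  define c0 where "c0 = t \<otimes> s"
  have c0: "c0 \<in> carrier R - M" "c0 \<in> carrier R" unfolding c0_def using compl_mult[OF t(1) s(1)] tc sc by auto
  have h\<Psi>: "h (\<Psi> x) = h c0 \<otimes>\<^bsub>L\<^esub> \<Phi> (h x)" if x: "x \<in> carrier R" for x
  proof -
    have cl: "\<Phi> (h x) \<in> carrier L" using x LF.cartier_closed[OF \<Phi>] by simp
    have "h (\<Psi> x) = h t \<otimes>\<^bsub>L\<^esub> (\<Phi> (h x) \<otimes>\<^bsub>L\<^esub> h s)"
      unfolding \<Psi>_def num_of(2)[OF x] using num_of(1)[OF x] tc by simp
    then show ?thesis unfolding c0_def using cl tc sc by (simp add: L.m_ac)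
  qed
  have "\<exists>w\<in>carrier R - M. \<forall>l\<in>fst ` set ds \<union> snd ` set ds. \<exists>a\<in>carrier R. l \<otimes>\<^bsub>L\<^esub> h w = h a"
    by (rule common_denominator) (use ds in auto)
  then obtain w where w: "w \<in> carrier R - M"
     "\<And>l. l \<in> fst ` set ds \<union> snd ` set ds \<Longrightarrow> \<exists>a\<in>carrier R. l \<otimes>\<^bsub>L\<^esub> h w = h a" by blast
  have wc: "w \<in> carrier R" using w by simp
  obtain n where n: "q = Suc n" using RF.q_pos by (cases q) auto
  \<comment> \<open>Each summand collects \<open>c0\<^sup>q\<close> from \<open>\<Psi>\<close>, and \<open>w\<^sup>q\<close> from each of the two lifted entries of its pair.\<close>
  define C where "C = (c0 \<otimes> w \<otimes> w) [^] q"
  have C: "C \<in> carrier R" "C \<notin> M"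
  proof -
    have "c0 \<otimes> w \<otimes> w \<in> carrier R - M" using compl_mult[OF compl_mult[OF c0(1) w(1)] w(1)] .
    then show "C \<in> carrier R" "C \<notin> M" unfolding C_def using R.primeideal_pow_mem[OF M] by auto
  qed
  have "\<exists>es. set es \<subseteq> carrier R \<times> carrier R \<and>
    (\<forall>x\<in>carrier R. h (RF.dual_sum \<Psi> es x) = h C \<otimes>\<^bsub>L\<^esub> LF.dual_sum \<Phi> ds (h x))"
    using ds w(2)
  proof (induction ds)
    case Nil
    show ?case by (intro exI[of _ "[]"]) (use C in simp)
  next
    case (Cons d ds)
    then obtain es where es: "set es \<subseteq> carrier R \<times> carrier R"
      "\<And>x. x \<in> carrier R \<Longrightarrow> h (RF.dual_sum \<Psi> es x) = h C \<otimes>\<^bsub>L\<^esub> LF.dual_sum \<Phi> ds (h x)" by auto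
    obtain d1 d2 where d: "d = (d1, d2)" "d1 \<in> carrier L" "d2 \<in> carrier L" using Cons.prems by (cases d) auto
    obtain b1 b2 where b: "b1 \<in> carrier R" "d1 \<otimes>\<^bsub>L\<^esub> h w = h b1" "b2 \<in> carrier R" "d2 \<otimes>\<^bsub>L\<^esub> h w = h b2"
      using Cons.prems(2)[of d1] Cons.prems(2)[of d2] d by auto
    let ?e = "(w [^] n \<otimes> b1, w [^] n \<otimes> b2)"
    have ec: "fst ?e \<in> carrier R" "snd ?e \<in> carrier R" using wc b by auto
    have lift: "h (w [^] n \<otimes> b) = h w [^]\<^bsub>L\<^esub> q \<otimes>\<^bsub>L\<^esub> l"
      if "b \<in> carrier R" "l \<in> carrier L" "l \<otimes>\<^bsub>L\<^esub> h w = h b" for b l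
      using that(1,2) wc unfolding n by (simp add: hom_nat_pow that(3)[symmetric] L.m_ac)
    have "h (RF.dual_sum \<Psi> (?e # es) x) = h C \<otimes>\<^bsub>L\<^esub> LF.dual_sum \<Phi> (d # ds) (h x)"
      if x: "x \<in> carrier R" for x
    proof -
      let ?f = "\<Phi> (d2 \<otimes>\<^bsub>L\<^esub> h x)" and ?p = "\<lambda>l. l [^]\<^bsub>L\<^esub> q"
      have fc: "?f \<in> carrier L" "LF.dual_sum \<Phi> ds (h x) \<in> carrier L"
        using LF.cartier_closed[OF \<Phi>] d x LF.dual_sum_closed[OF \<Phi>] Cons.prems by auto
      have es_c: "RF.dual_sum \<Psi> es x \<in> carrier R" using RF.dual_sum_closed[OF \<Psi> es(1) x] .
      have "h (snd ?e \<otimes> x) = h w [^]\<^bsub>L\<^esub> q \<otimes>\<^bsub>L\<^esub> (d2 \<otimes>\<^bsub>L\<^esub> h x)"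
        using lift[OF b(3) d(3) b(4)] ec x d wc by (simp add: L.m_assoc)
      then have "h (\<Psi> (snd ?e \<otimes> x)) = h c0 \<otimes>\<^bsub>L\<^esub> (h w \<otimes>\<^bsub>L\<^esub> ?f)"
        using h\<Psi>[of "snd ?e \<otimes> x"] ec(2) x d wc LF.cartier_smult[OF \<Phi>, of "h w" "d2 \<otimes>\<^bsub>L\<^esub> h x"] by simp
      then have "h (\<Psi> (snd ?e \<otimes> x) [^] q) = ?p (h c0) \<otimes>\<^bsub>L\<^esub> (?p (h w) \<otimes>\<^bsub>L\<^esub> ?p ?f)"
        using RF.cartier_closed[OF \<Psi>, of "snd ?e \<otimes> x"] ec(2) x c0 wc fc
        by (simp add: hom_nat_pow L.nat_pow_distrib)
      moreover have "h (RF.dual_sum \<Psi> (?e # es) x)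
          = h (\<Psi> (snd ?e \<otimes> x) [^] q) \<otimes>\<^bsub>L\<^esub> h (fst ?e) \<oplus>\<^bsub>L\<^esub> h (RF.dual_sum \<Psi> es x)"
        using RF.cartier_closed[OF \<Psi>, of "snd ?e \<otimes> x"] ec x es_c by simp
      moreover have "h (fst ?e) = ?p (h w) \<otimes>\<^bsub>L\<^esub> d1" using lift[OF b(1) d(2) b(2)] by simp
      ultimately have "h (RF.dual_sum \<Psi> (?e # es) x)
          = ?p (h c0) \<otimes>\<^bsub>L\<^esub> (?p (h w) \<otimes>\<^bsub>L\<^esub> ?p ?f) \<otimes>\<^bsub>L\<^esub> (?p (h w) \<otimes>\<^bsub>L\<^esub> d1)
             \<oplus>\<^bsub>L\<^esub> h C \<otimes>\<^bsub>L\<^esub> LF.dual_sum \<Phi> ds (h x)"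
        using es(2)[OF x] by simp
      also have "?p (h c0) \<otimes>\<^bsub>L\<^esub> (?p (h w) \<otimes>\<^bsub>L\<^esub> ?p ?f) \<otimes>\<^bsub>L\<^esub> (?p (h w) \<otimes>\<^bsub>L\<^esub> d1)
          = h C \<otimes>\<^bsub>L\<^esub> (?p ?f \<otimes>\<^bsub>L\<^esub> d1)"
        unfolding C_def using c0 wc fc d
        by (simp add: hom_nat_pow L.nat_pow_distrib L.m_ac)
      finally show ?thesis using d fc C by (simp add: L.r_distr)
    qed
    then show ?case using ec es(1) by (intro exI[of _ "?e # es"]) auto
  qed
  then obtain es where es: "set es \<subseteq> carrier R \<times> carrier R"
    "\<And>x. x \<in> carrier R \<Longrightarrow> h (RF.dual_sum \<Psi> es x) = h C \<otimes>\<^bsub>L\<^esub> LF.dual_sum \<Phi> ds (h x)" by blast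
  let ?es = "map (\<lambda>(b, b'). (t \<otimes> b, b')) es"
  have scale: "RF.dual_sum \<Psi> (map (\<lambda>(b, b'). (t \<otimes> b, b')) es) x = t \<otimes> RF.dual_sum \<Psi> es x"
    if "set es \<subseteq> carrier R \<times> carrier R" "x \<in> carrier R" for x es
    using that
  proof (induction es)
    case (Cons e es)
    obtain b b' where e: "e = (b, b')" "b \<in> carrier R" "b' \<in> carrier R" using Cons.prems by (cases e) auto
    have cl: "\<Psi> (b' \<otimes> x) [^] q \<in> carrier R" "RF.dual_sum \<Psi> es x \<in> carrier R"
      using RF.cartier_closed[OF \<Psi>] RF.dual_sum_closed[OF \<Psi>] Cons.prems e by auto
    show ?case using Cons e cl tc by (simp add: R.r_distr R.m_lcomm)
  qed (use tc in simp)
  have "RF.dual_sum \<Psi> ?es x = (t \<otimes> C) \<otimes> x" if x: "x \<in> carrier R" for x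
  proof -
    have "h (RF.dual_sum \<Psi> es x) = h (C \<otimes> x)" using es(2)[OF x] id[of "h x"] x C by simp
    then have "t \<otimes> RF.dual_sum \<Psi> es x = t \<otimes> (C \<otimes> x)"
      using RF.dual_sum_closed[OF \<Psi> es(1) x] C x by (intro t_eq) auto
    then show ?thesis using scale[OF es(1) x] tc C x by (simp add: R.m_assoc)
  qed
  moreover have "set ?es \<subseteq> carrier R \<times> carrier R" using es(1) tc by auto
  moreover have "t \<otimes> C \<in> carrier R - M" using compl_mult[OF t(1)] C by simp
  ultimately show ?thesis using \<Psi> by blast
qed

end
end

section \<open>Iterates of Frobenius on F-finite rings\<close>

lemma F_finite_imp_span:
  fixes R (structure)
  assumes "cring R" and p: "Factorial_Ring.prime (p::nat)" and char: "add_pow R p \<one> = \<zero>"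
    and fin: "F_finite R p"
  shows "\<exists>Y. finite Y \<and> Y \<subseteq> carrier R \<and> carrier R \<subseteq> frob_cring.lin R p (carrier R) Y"
proof -
  interpret cring R by fact
  interpret F: frob_cring R p using frob_cring_char_p[OF p char, of 1] by simp
  let ?M = "frob_pushforward R p 1"
  interpret N: abelian_monoid ?M
    by (rule abelian_monoidI) (auto simp: frob_pushforward_def a_ac)
  obtain X where X: "finite X" "X \<subseteq> carrier R"
    "\<And>x. x \<in> carrier R \<Longrightarrow> \<exists>c\<in>X \<rightarrow> carrier R. x = (\<Oplus>\<^bsub>?M\<^esub>y\<in>X. c y \<odot>\<^bsub>?M\<^esub> y)"
    using fin unfolding F_finite_def fin_gen_module_def by (auto simp: frob_pushforward_def)
  have sums: "(\<Oplus>\<^bsub>?M\<^esub>y\<in>Z. c y \<odot>\<^bsub>?M\<^esub> y) \<in> F.span X"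
    if "finite Z" "Z \<subseteq> X" "c \<in> X \<rightarrow> carrier R" for Z c
    using that
  proof (induction Z)
    case empty
    have "\<zero>\<^bsub>?M\<^esub> = \<zero>" by (simp add: frob_pushforward_def)
    then show ?case unfolding N.finsum_empty using F.lin.zero by simp
  next
    case (insert z Z)
    have c: "c y \<odot>\<^bsub>?M\<^esub> y = c y [^] p \<otimes> y" for y by (simp add: frob_pushforward_def)
    have cc: "c y [^] p \<otimes> y \<in> carrier ?M" if "y \<in> insert z Z" for y
    proof -
      have "y \<in> X" using that insert.prems(1) by blast
      then have "c y \<in> carrier R" "y \<in> carrier R" using insert.prems(2) X(2) by auto
      then show ?thesis by (simp add: frob_pushforward_def)
    qed
    have "(\<Oplus>\<^bsub>?M\<^esub>y\<in>insert z Z. c y \<odot>\<^bsub>?M\<^esub> y)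
        = c z [^] p \<otimes> z \<oplus>\<^bsub>?M\<^esub> (\<Oplus>\<^bsub>?M\<^esub>y\<in>Z. c y \<odot>\<^bsub>?M\<^esub> y)"
      unfolding c using insert cc by (intro N.finsum_insert) auto
    also have "\<dots> = c z [^] p \<otimes> z \<oplus> (\<Oplus>\<^bsub>?M\<^esub>y\<in>Z. c y \<odot>\<^bsub>?M\<^esub> y)"
      by (simp add: frob_pushforward_def)
    also have "\<dots> \<in> F.span X" using insert by (intro F.lin.step) auto
    finally show ?case .
  qed
  have "carrier R \<subseteq> F.span X"
  proof
    fix x assume "x \<in> carrier R"
    then obtain c where c: "c \<in> X \<rightarrow> carrier R" "x = (\<Oplus>\<^bsub>?M\<^esub>y\<in>X. c y \<odot>\<^bsub>?M\<^esub> y)"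
      using X(3) by blast
    show "x \<in> F.span X" unfolding c(2) by (rule sums[OF X(1) order_refl c(1)])
  qed
  then show ?thesis using X(1,2) by blast
qed

text \<open>If \<open>X\<close> generates for \<open>p\<close> and \<open>Y\<close> for \<open>p\<^sup>e\<close>, then the products \<open>y\<^sup>p x\<close> generate for \<open>p\<^bsup>e+1\<^esup>\<close>.\<close>

lemma F_finite_iterate:
  fixes R (structure)
  assumes cr: "cring R" and p: "Factorial_Ring.prime (p::nat)" and char: "add_pow R p \<one> = \<zero>"
    and fin: "F_finite R p"
  shows "\<exists>Y. finite Y \<and> Y \<subseteq> carrier R \<and> carrier R \<subseteq> frob_cring.lin R (p ^ e) (carrier R) Y"
proof -
  interpret cring R by fact
  interpret F: frob_cring R p using frob_cring_char_p[OF p char, of 1] by simp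
  obtain X where X: "finite X" "X \<subseteq> carrier R" "carrier R \<subseteq> F.span X"
    using F_finite_imp_span[OF assms] by blast
  show ?thesis
  proof (induction e)
    case 0
    interpret G: frob_cring R "p ^ 0" by (rule frob_cring_char_p[OF p char])
    have "x \<in> G.span {\<one>}" if "x \<in> carrier R" for x
      using G.lin_single[of "carrier R" "{\<one>}" x \<one>] that by simp
    then show ?case by (intro exI[of _ "{\<one>}"]) auto
  next
    case (Suc e)
    interpret G: frob_cring R "p ^ e" by (rule frob_cring_char_p[OF p char])
    interpret K: frob_cring R "p ^ Suc e" by (rule frob_cring_char_p[OF p char])
    obtain Y where Y: "finite Y" "Y \<subseteq> carrier R" "carrier R \<subseteq> G.span Y" using Suc by blast
    let ?Z = "(\<lambda>(y, x). y [^] p \<otimes> x) ` (Y \<times> X)"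
    have Z: "?Z \<subseteq> carrier R" using X(2) Y(2) by auto
    have pw: "c [^] p ^ Suc e = (c [^] (p ^ e)) [^] p" if "c \<in> carrier R" for c
      using that by (simp add: nat_pow_pow mult.commute)
    have step: "c [^] p \<otimes> x \<in> K.span ?Z" if x: "x \<in> X" and c: "c \<in> G.span Y" for c x
      using c
    proof induction
      case zero
      have "x \<in> carrier R" using x X by blast
      then show ?case using K.lin.zero by (simp add: F.frob_zero)
    next
      case (step d y c)
      have cl: "d \<in> carrier R" "y \<in> carrier R" "c \<in> carrier R" "x \<in> carrier R"
        using step(1,2) x X(2) Y(2) G.lin_closed[OF order_refl Y(2) step(3)] by auto
      have "(d [^] (p ^ e) \<otimes> y \<oplus> c) [^] p \<otimes> x = d [^] (p ^ Suc e) \<otimes> (y [^] p \<otimes> x) \<oplus> c [^] p \<otimes> x"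
        using cl unfolding pw[OF cl(1)]
        by (simp add: F.frob_add nat_pow_distrib l_distr m_assoc)
      also have "\<dots> \<in> K.span ?Z" using step x by (intro K.lin.step) auto
      finally show ?case .
    qed
    have "F.span X \<subseteq> K.span ?Z"
    proof (rule F.lin_least)
      show "\<zero> \<in> K.span ?Z" by (rule K.lin.zero)
      show "c [^] p \<otimes> t \<in> K.span ?Z" if "c \<in> carrier R" "t \<in> X" for c t
        using step[OF that(2)] that(1) Y(3) by blast
      show "a \<oplus> b \<in> K.span ?Z" if "a \<in> K.span ?Z" "b \<in> K.span ?Z" for a b
        using K.span_add[OF Z that] .
    qed
    then show ?case using X(1,3) Y(1) Z by (intro exI[of _ ?Z]) blast
  qed
qed

section \<open>Maps on the quotient and the colon criterion\<close>

context frob_cring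
begin

definition dual_basis_at :: "'a set \<Rightarrow> bool" where
  "dual_basis_at M \<longleftrightarrow> (\<exists>c\<in>carrier R - M. \<exists>\<Psi> es. cartier_map \<Psi> \<and>
     set es \<subseteq> carrier R \<times> carrier R \<and> (\<forall>x\<in>carrier R. dual_sum \<Psi> es x = c \<otimes> x))"

lemma dual_sum_in_bracket:
  assumes K: "K \<subseteq> carrier R" and \<Psi>: "\<And>b. b \<in> carrier R \<Longrightarrow> \<Psi> (b \<otimes> x) \<in> K"
    and "set es \<subseteq> carrier R \<times> carrier R"
  shows "dual_sum \<Psi> es x \<in> bracket K"
  using assms(3)
proof (induction es)
  case Nil
  show ?case by (simp add: lin.zero)
next
  case (Cons e es)
  then show ?case using \<Psi> by (auto intro!: lin.step)
qed

text \<open>The set-theoretic lifts of Frobenius-linear maps on the quotient by \<open>I\<close>.\<close>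

definition quasi_cartier :: "'a set \<Rightarrow> ('a \<Rightarrow> 'a) \<Rightarrow> bool" where
  "quasi_cartier I f \<longleftrightarrow> (\<forall>x\<in>carrier R. f x \<in> carrier R) \<and> (\<forall>x\<in>I. f x \<in> I) \<and>
    (\<forall>x\<in>carrier R. \<forall>y\<in>carrier R. f (x \<oplus> y) \<ominus> (f x \<oplus> f y) \<in> I) \<and>
    (\<forall>r\<in>carrier R. \<forall>x\<in>carrier R. f (r [^] q \<otimes> x) \<ominus> r \<otimes> f x \<in> I)"

text \<open>Composed with a sum \<open>\<Sum> \<Psi> (b' x)\<^sup>q b\<close>, a map \<open>f\<close> becomes \<open>\<Sum> \<Psi> (b' x) * f b\<close>, and each
  coefficient \<open>f b\<close> moves under \<open>\<Psi>\<close> as \<open>(f b)\<^sup>q\<close>; so \<open>s = \<Sum> (f b)\<^sup>q b'\<close>.\<close>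

lemma quasi_cartier_factors:
  assumes I: "ideal I R" and f: "quasi_cartier I f" and \<Psi>: "cartier_map \<Psi>"
    and es: "set es \<subseteq> carrier R \<times> carrier R"
  shows "\<exists>s\<in>carrier R. \<forall>x\<in>carrier R. f (dual_sum \<Psi> es x) \<ominus> \<Psi> (s \<otimes> x) \<in> I"
  using es
proof (induction es)
  interpret I: ideal I R by fact
  case Nil
  have "f \<zero> \<in> I" using f unfolding quasi_cartier_def using I.zero_closed by blast
  then have "f \<zero> \<ominus> \<zero> \<in> I" using I.Icarr by (simp add: a_minus_def)
  then show ?case by (intro bexI[of _ \<zero>]) (auto simp: cartier_zero[OF \<Psi>])
next
  interpret I: ideal I R by fact
  case (Cons e es)
  obtain b b' where e: "e = (b, b')" "b \<in> carrier R" "b' \<in> carrier R" using Cons.prems by (cases e) auto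
  obtain s where s: "s \<in> carrier R" "\<And>x. x \<in> carrier R \<Longrightarrow> f (dual_sum \<Psi> es x) \<ominus> \<Psi> (s \<otimes> x) \<in> I"
    using Cons by auto
  have fc: "f x \<in> carrier R" if "x \<in> carrier R" for x using f that unfolding quasi_cartier_def by blast
  let ?s = "f b [^] q \<otimes> b' \<oplus> s"
  have fb: "f b [^] q \<in> carrier R" "f b \<in> carrier R" using fc e by auto
  have "f (dual_sum \<Psi> (e # es) x) \<ominus> \<Psi> (?s \<otimes> x) \<in> I" if x: "x \<in> carrier R" for x
  proof -
    let ?p = "\<Psi> (b' \<otimes> x)" and ?D = "dual_sum \<Psi> es x"
    have p: "?p \<in> carrier R" "?p [^] q \<in> carrier R" "?p [^] q \<otimes> b \<in> carrier R" "?D \<in> carrier R" "\<Psi> (s \<otimes> x) \<in> carrier R"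
      using cartier_closed[OF \<Psi>] e x s dual_sum_closed[OF \<Psi>] Cons.prems by auto
    have 1: "f (?p [^] q \<otimes> b \<oplus> ?D) \<ominus> (f (?p [^] q \<otimes> b) \<oplus> f ?D) \<in> I"
      using f p unfolding quasi_cartier_def by blast
    have 2: "f (?p [^] q \<otimes> b) \<ominus> ?p \<otimes> f b \<in> I" using f p e unfolding quasi_cartier_def by blast
    have 3: "f ?D \<ominus> \<Psi> (s \<otimes> x) \<in> I" using s(2)[OF x] .
    have cl: "f (?p [^] q \<otimes> b \<oplus> ?D) \<in> carrier R" "f (?p [^] q \<otimes> b) \<in> carrier R" "f ?D \<in> carrier R"
      using fc p by auto
    have "?s \<otimes> x = f b [^] q \<otimes> (b' \<otimes> x) \<oplus> s \<otimes> x" using fb e s x by algebra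
    then have "\<Psi> (?s \<otimes> x) = f b \<otimes> ?p \<oplus> \<Psi> (s \<otimes> x)"
      using fb e s x by (simp add: cartier_add[OF \<Psi>] cartier_smult[OF \<Psi>])
    then have "f (?p [^] q \<otimes> b \<oplus> ?D) \<ominus> \<Psi> (?s \<otimes> x) =
       (f (?p [^] q \<otimes> b \<oplus> ?D) \<ominus> (f (?p [^] q \<otimes> b) \<oplus> f ?D))
        \<oplus> ((f (?p [^] q \<otimes> b) \<ominus> ?p \<otimes> f b) \<oplus> (f ?D \<ominus> \<Psi> (s \<otimes> x)))"
      using p cl fb(2) by (simp only:) algebra
    then show ?thesis using I.a_closed[OF 1 I.a_closed[OF 2 3]] e by simp
  qed
  then show ?case using fb e s by (intro bexI[of _ ?s]) auto
qed

lemma colonI: "s \<in> carrier R \<Longrightarrow> (\<And>x. x \<in> L \<Longrightarrow> s \<otimes> x \<in> K) \<Longrightarrow> s \<in> colon R K L"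
  unfolding colon_def by blast

end

locale locally_frobenius = noetherian_cring R + frob_cring R q for R (structure) and q +
  assumes dual_basis: "maximalideal M R \<Longrightarrow> dual_basis_at M"
begin

text \<open>Locally \<open>c f\<close> is \<open>\<Psi> (s _)\<close> modulo \<open>I\<close>. Since \<open>f\<close> preserves \<open>I\<close>, all values \<open>\<Psi> (b s x)\<close>
  with \<open>x \<in> I\<close> lie in \<open>I\<close>, and the dual basis turns this into \<open>c s \<in> I\<^bsup>[q]\<^esup> : I\<close>. The hypothesis on
  \<open>r\<close> then places \<open>c\<^sup>q s r\<close> in \<open>J\<^bsup>[q]\<^esup>\<close>, and \<open>\<Psi>\<close> maps it to \<open>c \<Psi> (s r) \<in> J\<close>.\<close>

lemma quasi_cartier_maps_into:
  assumes I: "ideal I R" and J: "ideal J R" and "I \<subseteq> J" and f: "quasi_cartier I f"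
    and r: "r \<in> carrier R" "r \<in> colon R (bracket J) (colon R (bracket I) I)"
  shows "f r \<in> J"
proof -
  interpret I: ideal I R by fact
  interpret J: ideal J R by fact
  have Ic: "I \<subseteq> carrier R" and Jc: "J \<subseteq> carrier R" using I.Icarr J.Icarr by auto
  have fr: "f r \<in> carrier R" using f r unfolding quasi_cartier_def by blast
  obtain n where n: "q = Suc n" using q_pos by (cases q) auto
  have "\<one> \<in> {a \<in> carrier R. f r \<otimes> a \<in> J}"
  proof (rule ideal_eq_carrier_locally[OF colon_elem_ideal[OF J fr]])
    fix M assume M: "maximalideal M R"
    have PM: "primeideal M R" by (rule maximalideal_prime[OF M])
    obtain c \<Psi> es where c: "c \<in> carrier R - M" and \<Psi>: "cartier_map \<Psi>"
      and es: "set es \<subseteq> carrier R \<times> carrier R" "\<And>x. x \<in> carrier R \<Longrightarrow> dual_sum \<Psi> es x = c \<otimes> x"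
      using dual_basis[OF M] unfolding dual_basis_at_def by blast
    have cc: "c \<in> carrier R" "c [^] n \<in> carrier R" using c by auto
    obtain s0 where s0: "s0 \<in> carrier R" "\<And>x. x \<in> carrier R \<Longrightarrow> f (dual_sum \<Psi> es x) \<ominus> \<Psi> (s0 \<otimes> x) \<in> I"
      using quasi_cartier_factors[OF I f \<Psi> es(1)] by blast
    \<comment> \<open>The dual basis yields \<open>f (c x)\<close>, but \<open>f\<close> is linear only over \<open>q\<close>-th powers; the factor \<open>c\<^bsup>q-1\<^esup>\<close> completes \<open>c\<close> to one.\<close>
    define s where "s = s0 \<otimes> c [^] n"
    have s: "s \<in> carrier R" unfolding s_def using s0 cc by simp
    have \<Psi>c: "\<Psi> x \<in> carrier R" if "x \<in> carrier R" for x using cartier_closed[OF \<Psi> that] .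
    have key: "c \<otimes> f x \<ominus> \<Psi> (s \<otimes> x) \<in> I" if x: "x \<in> carrier R" for x
    proof -
      have "dual_sum \<Psi> es (c [^] n \<otimes> x) = c [^] q \<otimes> x"
        using es(2)[of "c [^] n \<otimes> x"] cc x unfolding n by (simp add: m_ac)
      moreover have "s0 \<otimes> (c [^] n \<otimes> x) = s \<otimes> x" unfolding s_def using s0 cc x by (simp add: m_assoc)
      ultimately have 1: "f (c [^] q \<otimes> x) \<ominus> \<Psi> (s \<otimes> x) \<in> I"
        using s0(2)[of "c [^] n \<otimes> x"] cc x by simp
      have 2: "f (c [^] q \<otimes> x) \<ominus> c \<otimes> f x \<in> I" using f cc x unfolding quasi_cartier_def by blast
      have cl: "f (c [^] q \<otimes> x) \<in> carrier R" "f x \<in> carrier R" "\<Psi> (s \<otimes> x) \<in> carrier R"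
        using f cc x s \<Psi>c unfolding quasi_cartier_def by auto
      have "c \<otimes> f x \<ominus> \<Psi> (s \<otimes> x) = (f (c [^] q \<otimes> x) \<ominus> \<Psi> (s \<otimes> x)) \<oplus> \<ominus> (f (c [^] q \<otimes> x) \<ominus> c \<otimes> f x)"
        using cl cc by algebra
      then show ?thesis using I.a_closed[OF 1 I.a_inv_closed[OF 2]] by simp
    qed
    have \<Psi>I: "\<Psi> (s \<otimes> x) \<in> I" if x: "x \<in> I" for x
    proof -
      have xc: "x \<in> carrier R" using x Ic by blast
      have "f x \<in> I" using f x unfolding quasi_cartier_def by blast
      then have 1: "c \<otimes> f x \<in> I" using cc I.I_l_closed by blast
      have cl: "c \<otimes> f x \<in> carrier R" "\<Psi> (s \<otimes> x) \<in> carrier R" using 1 Ic \<Psi>c s xc by auto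
      have "\<Psi> (s \<otimes> x) = c \<otimes> f x \<oplus> \<ominus> (c \<otimes> f x \<ominus> \<Psi> (s \<otimes> x))" using cl by algebra
      then show ?thesis using I.a_closed[OF 1 I.a_inv_closed[OF key[OF xc]]] by simp
    qed
    have "c \<otimes> s \<in> colon R (bracket I) I"
    proof (rule colonI)
      show "c \<otimes> s \<in> carrier R" using cc s by simp
      fix x assume x: "x \<in> I"
      have xc: "x \<in> carrier R" using x Ic by blast
      have "dual_sum \<Psi> es (s \<otimes> x) \<in> bracket I"
      proof (rule dual_sum_in_bracket[OF Ic _ es(1)])
        fix b assume b: "b \<in> carrier R"
        have "b \<otimes> (s \<otimes> x) = s \<otimes> (b \<otimes> x)" using b s xc by (simp add: m_lcomm)
        then show "\<Psi> (b \<otimes> (s \<otimes> x)) \<in> I" using \<Psi>I[OF I.I_l_closed[OF x b]] by simp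
      qed
      then show "c \<otimes> s \<otimes> x \<in> bracket I" using es(2)[of "s \<otimes> x"] s xc cc by (simp add: m_assoc)
    qed
    then have "r \<otimes> (c \<otimes> s) \<in> bracket J" using r(2) unfolding colon_def by blast
    then have "c [^] n \<otimes> (r \<otimes> (c \<otimes> s)) \<in> bracket J"
      using ideal.I_l_closed[OF bracket_ideal[OF Jc]] cc by blast
    moreover have "c [^] n \<otimes> (r \<otimes> (c \<otimes> s)) = c [^] q \<otimes> (s \<otimes> r)"
      unfolding n using cc r s by (simp add: m_ac)
    ultimately have "\<Psi> (c [^] q \<otimes> (s \<otimes> r)) \<in> J" using cartier_bracket[OF \<Psi> J] by simp
    then have 1: "c \<otimes> \<Psi> (s \<otimes> r) \<in> J" using cc s r by (simp add: cartier_smult[OF \<Psi>])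
    have 2: "c \<otimes> (c \<otimes> f r \<ominus> \<Psi> (s \<otimes> r)) \<in> J"
      using key[OF r(1)] \<open>I \<subseteq> J\<close> J.I_l_closed cc by blast
    have "f r \<otimes> (c \<otimes> c) = c \<otimes> \<Psi> (s \<otimes> r) \<oplus> c \<otimes> (c \<otimes> f r \<ominus> \<Psi> (s \<otimes> r))"
      using cc fr \<Psi>c[of "s \<otimes> r"] s r by (simp, algebra)
    then have "f r \<otimes> (c \<otimes> c) \<in> J" using J.a_closed[OF 1 2] by simp
    then show "\<exists>c\<in>carrier R - M. c \<in> {a \<in> carrier R. f r \<otimes> a \<in> J}"
      using primeideal_compl_mult[OF PM c c] by blast
  qed
  then show ?thesis using fr by simp
qed

text \<open>For \<open>s \<in> I\<^bsup>[q]\<^esup> : I\<close> the maps \<open>\<Psi> (b s _)\<close> send \<open>I\<close> into \<open>\<Psi> (I\<^bsup>[q]\<^esup>) \<subseteq> I\<close>. They are thus among the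
  maps in the hypothesis, which places every coefficient of \<open>c r s\<close> in the dual basis into \<open>J\<close>.\<close>

lemma in_colon_of_cartier_maps:
  assumes I: "ideal I R" and J: "ideal J R" and r: "r \<in> carrier R"
    and maps: "\<And>f. cartier_map f \<Longrightarrow> (\<And>x. x \<in> I \<Longrightarrow> f x \<in> I) \<Longrightarrow> f r \<in> J"
  shows "r \<in> colon R (bracket J) (colon R (bracket I) I)"
proof (rule colonI[OF r])
  interpret I: ideal I R by fact
  interpret J: ideal J R by fact
  have Ic: "I \<subseteq> carrier R" and Jc: "J \<subseteq> carrier R" using I.Icarr J.Icarr by auto
  fix s assume "s \<in> colon R (bracket I) I"
  then have s: "s \<in> carrier R" "\<And>x. x \<in> I \<Longrightarrow> s \<otimes> x \<in> bracket I" unfolding colon_def by auto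
  have rs: "r \<otimes> s \<in> carrier R" using r s by simp
  have "\<one> \<in> {a \<in> carrier R. r \<otimes> s \<otimes> a \<in> bracket J}"
  proof (rule ideal_eq_carrier_locally[OF colon_elem_ideal[OF bracket_ideal[OF Jc] rs]])
    fix M assume M: "maximalideal M R"
    obtain c \<Psi> es where c: "c \<in> carrier R - M" and \<Psi>: "cartier_map \<Psi>"
      and es: "set es \<subseteq> carrier R \<times> carrier R" "\<And>x. x \<in> carrier R \<Longrightarrow> dual_sum \<Psi> es x = c \<otimes> x"
      using dual_basis[OF M] unfolding dual_basis_at_def by blast
    have cc: "c \<in> carrier R" using c by simp
    have "dual_sum \<Psi> es (r \<otimes> s) \<in> bracket J"
    proof (rule dual_sum_in_bracket[OF Jc _ es(1)])
      fix b assume b: "b \<in> carrier R"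
      let ?f = "\<lambda>x. \<Psi> (b \<otimes> (x \<otimes> s))"
      have "cartier_map ?f"
        unfolding cartier_map_def
      proof (intro conjI ballI)
        fix x assume x: "x \<in> carrier R"
        show "?f x \<in> carrier R" using cartier_closed[OF \<Psi>] b x s by simp
        show "?f (x \<oplus> y) = ?f x \<oplus> ?f y" if "y \<in> carrier R" for y
          using that b x s by (simp add: l_distr r_distr cartier_add[OF \<Psi>])
      next
        fix a x assume a: "a \<in> carrier R" and x: "x \<in> carrier R"
        have "b \<otimes> (a [^] q \<otimes> x \<otimes> s) = a [^] q \<otimes> (b \<otimes> (x \<otimes> s))" using a b x s(1) by (simp add: m_ac)
        then show "?f (a [^] q \<otimes> x) = a \<otimes> ?f x" using cartier_smult[OF \<Psi> a] b x s(1) by simp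
      qed
      moreover have "?f x \<in> I" if x: "x \<in> I" for x
      proof -
        have "s \<otimes> x = x \<otimes> s" using x Ic s(1) m_comm by blast
        then have "b \<otimes> (x \<otimes> s) \<in> bracket I" using ideal.I_l_closed[OF bracket_ideal[OF Ic] s(2)[OF x] b] by simp
        then show ?thesis by (rule cartier_bracket[OF \<Psi> I])
      qed
      ultimately show "\<Psi> (b \<otimes> (r \<otimes> s)) \<in> J" using maps[of ?f] by blast
    qed
    then have "r \<otimes> s \<otimes> c \<in> bracket J" using es(2)[OF rs] m_comm[OF cc rs] by simp
    then show "\<exists>c\<in>carrier R - M. c \<in> {a \<in> carrier R. r \<otimes> s \<otimes> a \<in> bracket J}" using c by blast
  qed
  then show "r \<otimes> s \<in> bracket J" using rs by simp
qed

end

lemma regular_locally_frobenius: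
  fixes R (structure)
  assumes cr: "cring R" and nr: "noetherian_ring R" and p: "Factorial_Ring.prime (p::nat)"
    and char: "add_pow R p \<one> = \<zero>" and reg: "regular_ring R" and fin: "F_finite R p"
  shows "locally_frobenius R (p ^ e)"
proof -
  interpret noetherian_cring R using cr nr by (rule noetherian_cring.intro)
  interpret F: frob_cring R "p ^ e" by (rule frob_cring_char_p[OF p char])
  obtain Y where Y: "finite Y" "Y \<subseteq> carrier R" "carrier R \<subseteq> F.span Y"
    using F_finite_iterate[OF cr p char fin] by blast
  have "F.dual_basis_at M" if M: "maximalideal M R" for M
  proof -
    have PM: "primeideal M R" by (rule maximalideal_prime[OF M])
    let ?L = "localization_at R M" and ?h = "\<lambda>a. fraction R (carrier R - M) a \<one>"
    have regL: "regular_local_ring ?L" using reg PM unfolding regular_ring_def by blast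
    then have crL: "cring ?L" unfolding regular_local_ring_def by blast
    interpret H: localization_hom R ?L ?h M by (rule localization_hom_localization_at[OF PM crL])
    have "?h (add_pow R n \<one>) = add_pow ?L n \<one>\<^bsub>?L\<^esub>" for n :: nat
      by (induction n) (auto simp del: H.hom_one simp: H.hom_one[symmetric])
    then have charL: "add_pow ?L p \<one>\<^bsub>?L\<^esub> = \<zero>\<^bsub>?L\<^esub>" using char H.hom_zero by metis
    have LF: "frob_cring ?L (p ^ e)" by (rule cring.frob_cring_char_p[OF crL p charL])
    have hY: "?h ` Y \<subseteq> carrier ?L" using H.hom_closed Y(2) by blast
    obtain \<Phi> ds where d: "frob_cring.cartier_map ?L (p ^ e) \<Phi> \<and>
        set ds \<subseteq> carrier ?L \<times> carrier ?L \<and>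
        (\<forall>x\<in>carrier ?L. frob_cring.dual_sum ?L (p ^ e) \<Phi> ds x = x)"
      using regular_local_dual_basis[OF regL LF finite_imageI[OF Y(1)] hY
        H.span_localizes[OF F.frob_cring_axioms LF Y(2,3)]] by (elim exE) (rule that)
    have "\<exists>c\<in>carrier R - M. \<exists>\<Psi> es. F.cartier_map \<Psi> \<and> set es \<subseteq> carrier R \<times> carrier R \<and>
        (\<forall>x\<in>carrier R. F.dual_sum \<Psi> es x = c \<otimes> x)"
      by (rule H.dual_basis_descends[OF F.frob_cring_axioms LF Y, of \<Phi> ds]) (use d in \<open>simp_all\<close>)
    then show ?thesis unfolding F.dual_basis_at_def .
  qed
  then show ?thesis by unfold_locales
qed

text \<open>One exponent \<open>e\<close> at a time. Maps on \<open>S\<close> preserving \<open>I\<close> descend to the quotient, and a map on the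
  quotient lifts to a quasi-linear one by choice of representatives.\<close>

lemma (in locally_frobenius) quotient_maps_iff_colon:
  assumes I: "ideal I R" and J: "ideal J R" and IJ: "I \<subseteq> J" and r: "r \<in> carrier R"
    and q: "q = p ^ e"
  shows "(\<forall>\<phi>\<in>mod_hom (R Quot I) (frob_pushforward (R Quot I) p e) (ring_module (R Quot I)).
      \<phi> (I +> r) \<in> quot_image R J I)
    \<longleftrightarrow> r \<in> colon R (frob_power R J q) (colon R (frob_power R I q) I)"
proof -
  interpret I: ideal I R by fact
  interpret J: ideal J R by fact
  let ?Q = "R Quot I"
  interpret Q: ring_hom_ring R ?Q "(+>) I" by (rule I.rcos_ring_hom_ring)
  have Ic: "I \<subseteq> carrier R" and Jc: "J \<subseteq> carrier R" using I.Icarr J.Icarr by auto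
  have eq_iff: "I +> a = I +> b \<longleftrightarrow> a \<ominus> b \<in> I" if "a \<in> carrier R" "b \<in> carrier R" for a b
    by (rule quotient_eq_iff_same_a_r_cos[OF I that, symmetric])
  have surj: "\<exists>x. x \<in> carrier R \<and> X = I +> x" if "X \<in> carrier ?Q" for X
  proof -
    have "X \<in> a_rcosets I" using that unfolding FactRing_def by simp
    then show ?thesis unfolding A_RCOSETS_def' by blast
  qed
  have img: "I +> y \<in> quot_image R J I \<longleftrightarrow> y \<in> J" if y: "y \<in> carrier R" for y
  proof
    assume "I +> y \<in> quot_image R J I"
    then obtain j where j: "j \<in> J" "I +> y = I +> j" unfolding quot_image_def by blast
    have jc: "j \<in> carrier R" using j Jc by blast
    have "y \<ominus> j \<in> I" using j(2) eq_iff[OF y jc] by simp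
    then have "y \<ominus> j \<in> J" using IJ by (rule subsetD[rotated])
    moreover have "y = (y \<ominus> j) \<oplus> j" using y jc by algebra
    ultimately show "y \<in> J" using J.a_closed[OF \<open>y \<ominus> j \<in> J\<close> j(1)] by simp
  qed (auto simp: quot_image_def)
  have hom_iff: "\<phi> \<in> mod_hom ?Q (frob_pushforward ?Q p e) (ring_module ?Q) \<longleftrightarrow>
      (\<forall>X\<in>carrier ?Q. \<phi> X \<in> carrier ?Q) \<and>
      (\<forall>X\<in>carrier ?Q. \<forall>Y\<in>carrier ?Q. \<phi> (X \<oplus>\<^bsub>?Q\<^esub> Y) = \<phi> X \<oplus>\<^bsub>?Q\<^esub> \<phi> Y) \<and>
      (\<forall>A\<in>carrier ?Q. \<forall>X\<in>carrier ?Q. \<phi> (A [^]\<^bsub>?Q\<^esub> q \<otimes>\<^bsub>?Q\<^esub> X) = A \<otimes>\<^bsub>?Q\<^esub> \<phi> X)" for \<phi>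
    unfolding mod_hom_def frob_pushforward_def ring_module_def q by auto
  have bJ: "frob_power R J q = bracket J" "frob_power R I q = bracket I"
    using frob_power_eq_bracket Ic Jc by auto
  show ?thesis
    unfolding bJ
  proof
    assume L: "\<forall>\<phi>\<in>mod_hom ?Q (frob_pushforward ?Q p e) (ring_module ?Q). \<phi> (I +> r) \<in> quot_image R J I"
    show "r \<in> colon R (bracket J) (colon R (bracket I) I)"
    proof (rule in_colon_of_cartier_maps[OF I J r])
      fix f assume f: "cartier_map f" and fI: "\<And>x. x \<in> I \<Longrightarrow> f x \<in> I"
      define \<phi> where "\<phi> X = I +> f (SOME x. x \<in> carrier R \<and> X = I +> x)" for X
      have \<phi>: "\<phi> (I +> x) = I +> f x" if x: "x \<in> carrier R" for x
      proof -
        let ?y = "SOME y. y \<in> carrier R \<and> I +> x = I +> y"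
        have y: "?y \<in> carrier R \<and> I +> x = I +> ?y" by (rule someI[of _ x]) (use x in simp)
        then have "x \<ominus> ?y \<in> I" using eq_iff[OF x] by blast
        then have "f (x \<ominus> ?y) \<in> I" by (rule fI)
        then have "f x \<ominus> f ?y \<in> I" using cartier_diff[OF f x, of ?y] y by simp
        then have "I +> f x = I +> f ?y"
          using eq_iff[OF cartier_closed[OF f x] cartier_closed[OF f, of ?y]] y by blast
        then show ?thesis unfolding \<phi>_def by simp
      qed
      have "\<phi> \<in> mod_hom ?Q (frob_pushforward ?Q p e) (ring_module ?Q)"
        unfolding hom_iff
      proof (intro conjI ballI)
        fix X assume "X \<in> carrier ?Q"
        then obtain x where x: "x \<in> carrier R" "X = I +> x" using surj by blast
        show "\<phi> X \<in> carrier ?Q" unfolding x(2) \<phi>[OF x(1)] using cartier_closed[OF f x(1)] by (rule Q.hom_closed)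
        fix Y assume "Y \<in> carrier ?Q"
        then obtain y where y: "y \<in> carrier R" "Y = I +> y" using surj by blast
        have "\<phi> (X \<oplus>\<^bsub>?Q\<^esub> Y) = \<phi> (I +> (x \<oplus> y))" unfolding x(2) y(2) using x(1) y(1) by (simp only: Q.hom_add)
        also have "\<dots> = I +> (f x \<oplus> f y)"
          by (simp only: \<phi>[OF a_closed[OF x(1) y(1)]] cartier_add[OF f x(1) y(1)])
        also have "\<dots> = \<phi> X \<oplus>\<^bsub>?Q\<^esub> \<phi> Y"
          unfolding x(2) y(2) \<phi>[OF x(1)] \<phi>[OF y(1)] using cartier_closed[OF f] x(1) y(1) by (simp only: Q.hom_add)
        finally show "\<phi> (X \<oplus>\<^bsub>?Q\<^esub> Y) = \<phi> X \<oplus>\<^bsub>?Q\<^esub> \<phi> Y" .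
      next
        fix A X assume "A \<in> carrier ?Q" "X \<in> carrier ?Q"
        then obtain a x where x: "x \<in> carrier R" "X = I +> x" "a \<in> carrier R" "A = I +> a" using surj by metis
        have "A [^]\<^bsub>?Q\<^esub> q \<otimes>\<^bsub>?Q\<^esub> X = I +> (a [^] q \<otimes> x)"
          unfolding x(2,4) using x(1,3) Q.hom_nat_pow[OF x(3), of q] by simp
        then have "\<phi> (A [^]\<^bsub>?Q\<^esub> q \<otimes>\<^bsub>?Q\<^esub> X) = I +> (a \<otimes> f x)"
          using \<phi>[of "a [^] q \<otimes> x"] x by (simp add: cartier_smult[OF f])
        also have "\<dots> = A \<otimes>\<^bsub>?Q\<^esub> \<phi> X"
          unfolding x(2,4) \<phi>[OF x(1)] using x cartier_closed[OF f] by (simp only: Q.hom_mult)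
        finally show "\<phi> (A [^]\<^bsub>?Q\<^esub> q \<otimes>\<^bsub>?Q\<^esub> X) = A \<otimes>\<^bsub>?Q\<^esub> \<phi> X" .
      qed
      then have "\<phi> (I +> r) \<in> quot_image R J I" using L by blast
      then show "f r \<in> J" unfolding \<phi>[OF r] using img cartier_closed[OF f r] by blast
    qed
  next
    assume col: "r \<in> colon R (bracket J) (colon R (bracket I) I)"
    show "\<forall>\<phi>\<in>mod_hom ?Q (frob_pushforward ?Q p e) (ring_module ?Q). \<phi> (I +> r) \<in> quot_image R J I"
    proof
      fix \<phi> assume "\<phi> \<in> mod_hom ?Q (frob_pushforward ?Q p e) (ring_module ?Q)"
      then have \<phi>: "\<And>X. X \<in> carrier ?Q \<Longrightarrow> \<phi> X \<in> carrier ?Q"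
        "\<And>X Y. X \<in> carrier ?Q \<Longrightarrow> Y \<in> carrier ?Q \<Longrightarrow> \<phi> (X \<oplus>\<^bsub>?Q\<^esub> Y) = \<phi> X \<oplus>\<^bsub>?Q\<^esub> \<phi> Y"
        "\<And>A X. A \<in> carrier ?Q \<Longrightarrow> X \<in> carrier ?Q \<Longrightarrow> \<phi> (A [^]\<^bsub>?Q\<^esub> q \<otimes>\<^bsub>?Q\<^esub> X) = A \<otimes>\<^bsub>?Q\<^esub> \<phi> X"
        unfolding hom_iff by blast+
      define f where "f x = (SOME y. y \<in> carrier R \<and> \<phi> (I +> x) = I +> y)" for x
      have f: "f x \<in> carrier R" "\<phi> (I +> x) = I +> f x" if x: "x \<in> carrier R" for x
        using someI_ex[OF surj[OF \<phi>(1)[OF Q.hom_closed[OF x]]]] unfolding f_def by blast+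
      have zeroQ: "I +> x = I +> \<zero>" if "x \<in> I" for x
        using eq_iff[of x \<zero>] that Ic by (auto simp: a_minus_def)
      have add: "f (x \<oplus> y) \<ominus> (f x \<oplus> f y) \<in> I" if xy: "x \<in> carrier R" "y \<in> carrier R" for x y
      proof -
        have "I +> f (x \<oplus> y) = \<phi> ((I +> x) \<oplus>\<^bsub>?Q\<^esub> (I +> y))" using f(2)[of "x \<oplus> y"] xy by (simp only: Q.hom_add a_closed)
        also have "\<dots> = (I +> f x) \<oplus>\<^bsub>?Q\<^esub> (I +> f y)"
          using \<phi>(2)[OF Q.hom_closed[OF xy(1)] Q.hom_closed[OF xy(2)]] f(2) xy by simp
        also have "\<dots> = I +> (f x \<oplus> f y)" using f(1) xy by (simp only: Q.hom_add)
        finally show ?thesis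
          using eq_iff[OF f(1)[OF a_closed[OF xy]] a_closed[OF f(1)[OF xy(1)] f(1)[OF xy(2)]]] by blast
      qed
      have smult: "f (a [^] q \<otimes> x) \<ominus> a \<otimes> f x \<in> I" if xy: "a \<in> carrier R" "x \<in> carrier R" for a x
      proof -
        have "I +> f (a [^] q \<otimes> x) = \<phi> ((I +> a) [^]\<^bsub>?Q\<^esub> q \<otimes>\<^bsub>?Q\<^esub> (I +> x))"
          using f(2)[of "a [^] q \<otimes> x"] Q.hom_nat_pow[OF xy(1), of q] xy by simp
        also have "\<dots> = (I +> a) \<otimes>\<^bsub>?Q\<^esub> (I +> f x)"
          using \<phi>(3)[OF Q.hom_closed[OF xy(1)] Q.hom_closed[OF xy(2)]] f(2) xy by simp
        also have "\<dots> = I +> (a \<otimes> f x)" using f(1) xy by (simp only: Q.hom_mult)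
        finally show ?thesis
          using eq_iff[OF f(1)[OF m_closed[OF nat_pow_closed[OF xy(1)] xy(2)]]
              m_closed[OF xy(1) f(1)[OF xy(2)]]] by blast
      qed
      have f0: "f \<zero> \<in> I"
      proof -
        have "f (\<zero> [^] q \<otimes> \<zero>) \<ominus> \<zero> \<otimes> f \<zero> \<in> I" by (rule smult) simp_all
        then show ?thesis using f(1)[of \<zero>] by (simp add: a_minus_def)
      qed
      have fI: "f x \<in> I" if x: "x \<in> I" for x
      proof -
        have xc: "x \<in> carrier R" using x Ic by blast
        have "I +> f x = I +> f \<zero>" using f(2)[OF xc] f(2)[of \<zero>] zeroQ[OF x] by simp
        then have "f x \<ominus> f \<zero> \<in> I" using eq_iff[OF f(1)[OF xc] f(1)[OF zero_closed]] by blast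
        then have "(f x \<ominus> f \<zero>) \<oplus> f \<zero> \<in> I" using f0 I.a_closed by blast
        moreover have "(f x \<ominus> f \<zero>) \<oplus> f \<zero> = f x" using f(1)[OF xc] f(1)[OF zero_closed] by algebra
        ultimately show ?thesis by simp
      qed
      have "quasi_cartier I f"
        unfolding quasi_cartier_def by (intro conjI ballI f(1) fI add smult)
      then have "f r \<in> J" by (rule quasi_cartier_maps_into[OF I J IJ _ r col])
      then show "\<phi> (I +> r) \<in> quot_image R J I" using f[OF r] img by simp
    qed
  qed
qed

theorem theoremB:
  fixes S :: "('a, 'm) ring_scheme" and p :: nat and I J :: "'a set"
  assumes "cring S" and "noetherian_ring S"
    and "Factorial_Ring.prime p" and "has_char S p"
    and "regular_ring S" and "F_finite S p"
    and "ideal I S" and "ideal J S" and "I \<subseteq> J"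
  shows "cartier_core (S Quot I) p (quot_image S J I) =
    quot_image S
      (\<Inter>e\<in>{e::nat. e > 0}.
        colon S (frob_power S J (p ^ e)) (colon S (frob_power S I (p ^ e)) I)) I"
proof -
  have char: "add_pow S p \<one>\<^bsub>S\<^esub> = \<zero>\<^bsub>S\<^esub>" using assms(4) unfolding has_char_def by simp
  interpret I: ideal I S by fact
  interpret Q: ring_hom_ring S "S Quot I" "(+>\<^bsub>S\<^esub>) I" by (rule I.rcos_ring_hom_ring)
  let ?K = "\<Inter>e\<in>{e::nat. e > 0}.
        colon S (frob_power S J (p ^ e)) (colon S (frob_power S I (p ^ e)) I)"
  have core_iff: "I +>\<^bsub>S\<^esub> r \<in> cartier_core (S Quot I) p (quot_image S J I) \<longleftrightarrow> r \<in> ?K"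
    if r: "r \<in> carrier S" for r
  proof -
    have "I +>\<^bsub>S\<^esub> r \<in> carrier (S Quot I)" using r by (rule Q.hom_closed)
    moreover have "(\<forall>\<phi>\<in>mod_hom (S Quot I) (frob_pushforward (S Quot I) p e) (ring_module (S Quot I)).
        \<phi> (I +>\<^bsub>S\<^esub> r) \<in> quot_image S J I)
      \<longleftrightarrow> r \<in> colon S (frob_power S J (p ^ e)) (colon S (frob_power S I (p ^ e)) I)" for e
      by (rule locally_frobenius.quotient_maps_iff_colon
            [OF regular_locally_frobenius[OF assms(1-3) char assms(5,6)] assms(7-9) r refl])
    ultimately show ?thesis unfolding cartier_core_def by simp
  qed
  have "?K \<subseteq> colon S (frob_power S J (p ^ 1)) (colon S (frob_power S I (p ^ 1)) I)"
    by (rule INT_lower) simp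
  then have sub: "?K \<subseteq> carrier S" unfolding colon_def by blast
  show ?thesis
  proof
    show "cartier_core (S Quot I) p (quot_image S J I) \<subseteq> quot_image S ?K I"
    proof
      fix X assume X: "X \<in> cartier_core (S Quot I) p (quot_image S J I)"
      then have "X \<in> a_rcosets\<^bsub>S\<^esub> I" unfolding cartier_core_def FactRing_def by simp
      then obtain r where r: "r \<in> carrier S" "X = I +>\<^bsub>S\<^esub> r" unfolding A_RCOSETS_def' by blast
      have "r \<in> ?K" using core_iff[OF r(1)] X r(2) by blast
      then show "X \<in> quot_image S ?K I" unfolding quot_image_def r(2) by (rule imageI)
    qed
    show "quot_image S ?K I \<subseteq> cartier_core (S Quot I) p (quot_image S J I)"
    proof
      fix X assume "X \<in> quot_image S ?K I"
      then obtain r where r: "r \<in> ?K" "X = I +>\<^bsub>S\<^esub> r" unfolding quot_image_def by (elim imageE)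
      have "r \<in> carrier S" using sub r(1) by (rule subsetD)
      then show "X \<in> cartier_core (S Quot I) p (quot_image S J I)"
        using core_iff r unfolding r(2) by blast
    qed
  qed
qed

end
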